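(* The matrix of the cell-centered displacement-rotation system of the MSMFE-0 method, $$\begin{pmatrix}A_{\sigma u}A_{\sigma\sigma}^{-1}A_{\sigma u}^T & A_{\sigma u}A_{\sigma\sigma}^{-1}A_{\sigma\gamma}^T\\ A_{\sigma\gamma}A_{\sigma\sigma}^{-1}A_{\sigma u}^T & A_{\sigma\gamma}A_{\sigma\sigma}^{-1}A_{\sigma\gamma}^T\end{pmatrix},$$ is symmetric and positive definite, where $(A_{\sigma\sigma})_{ij}=(A\tau_j,\tau_i)_Q$, $(A_{\sigma u})_{ij}=(\operatorname{div}\tau_j,v_i)$, $(A_{\sigma\gamma})_{ij}=(\tau_j,\xi_i)$, and $\{\tau_j\}$, $\{v_i\}$, $\{\xi_i\}$ are the finite element bases of $\mathbb X_h$, $V_h$, $\mathbb W_h^0$.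
   Context: $d\in\{2,3\}$; $\Omega\subset\mathbb R^d$ is a simply connected bounded polygonal (polyhedral) domain with outward unit normal $n$; $\partial\Omega=\Gamma_D\cup\Gamma_N$ with $\Gamma_D\neq\emptyset$. $\mathbb M,\mathbb S,\mathbb N$ are the real $d\times d$ matrices, symmetric matrices and skew-symmetric matrices. $A=A(x)$, $x\in\Omega$, is at each point a symmetric linear operator $\mathbb M\to\mathbb M$ (mapping $\mathbb S$ to $\mathbb S$), bounded and uniformly positive definite in $x$. The divergence of a matrix field is taken row-wise. $(\cdot,\cdot)$ is the $L^2(\Omega)$ inner product (Frobenius product for matrices). $\mathbb X=\{\tau\in L^2(\Omega,\mathbb M):\operatorname{div}\tau\in L^2(\Omega,\mathbb R^d),\ \tau n=0\text{ on }\Gamma_N\}$, $V=L^2(\Omega,\mathbb R^d)$, $\mathbb W=L^2(\Omega,\mathbb N)$. $\mathcal T_h$ is a shape-regular, quasi-uniform conforming partition of $\Omega$ into triangles ($d=2$) or tetrahedra ($d=3$) of maximum diameter $h$; each boundary facet is contained in $\overline{\Gamma_D}$ or in $\overline{\Gamma_N}$. $\mathbb X_h=\{\tau\in\mathbb X:\tau|_E\in\mathcal P_1(E)^{d\times d}\ \forall E\in\mathcal T_h\}$, $V_h=\{v\in V: v|_E\in\mathcal P_0(E)^d\ \forall E\}$, $\mathbb W_h^0=\{\xi\in\mathbb W:\xi|_E\text{ is a constant skew-symmetric matrix }\forall E\}$. Vertex quadrature: for an element $E$ with vertices $\mathbf r_1,\dots,\mathbf r_s$, $s=d+1$, $(\varphi,\psi)_{Q,E}=\frac{|E|}{s}\sum_{i=1}^s\varphi(\mathbf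 r_i):\psi(\mathbf r_i)$, with the values at $\mathbf r_i$ taken from within $E$, and $(\varphi,\psi)_Q=\sum_{E\in\mathcal T_h}(\varphi,\psi)_{Q,E}$. The MSMFE-0 method seeks $(\sigma_h,u_h,\gamma_h)\in\mathbb X_h\times V_h\times\mathbb W_h^0$ with $(A\sigma_h,\tau)_Q+(u_h,\operatorname{div}\tau)+(\gamma_h,\tau)=\langle g,\tau n\rangle_{\Gamma_D}$ for all $\tau\in\mathbb X_h$, $(\operatorname{div}\sigma_h,v)=(f,v)$ for all $v\in V_h$, $(\sigma_h,\xi)=0$ for all $\xi\in\mathbb W_h^0$; its algebraic system is $\begin{pmatrix}A_{\sigma\sigma}&A_{\sigma u}^T&A_{\sigma\gamma}^T\\ -A_{\sigma u}&0&0\\ -A_{\sigma\gamma}&0&0\end{pmatrix}\begin{pmatrix}\sigma\\ u\\ \gamma\end{pmatrix}=\begin{pmatrix}g\\ -f\\ 0\end{pmatrix}$, and the displacement-rotation system results from eliminating $\sigma$ ($A_{\sigma\sigma}$ is invertible). *)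

theory Defs
  imports "HOL-Analysis.Analysis"
begin

section \<open>Domain and boundary\<close>

text \<open>
  The condition \<open>\<Omega> = interior (closure \<Omega>)\<close> says that \<open>\<Omega>\<close> lies nowhere on both sides of its
  boundary (no slits, no missing lower-dimensional pieces).
\<close>

definition polyhedral_domain :: "(real^'d::finite) set \<Rightarrow> bool" where
  "polyhedral_domain \<Omega> \<longleftrightarrow>
     open \<Omega> \<and> connected \<Omega> \<and> \<Omega> \<noteq> {} \<and> bounded \<Omega> \<and> \<Omega> = interior (closure \<Omega>) \<and>
     (\<exists>P. finite P \<and> (\<forall>p\<in>P. polytope p) \<and> closure \<Omega> = \<Union>P)"

text \<open>
  Up to its relative boundary, each part is a relatively open piece of \<open>\<partial>\<Omega>\<close>, so it is
  \<open>(d-1)\<close>-dimensional wherever it is nonempty. In particular a nonempty \<open>\<Gamma>D\<close> cannot be a single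
  point, which would carry no boundary condition (the pure traction problem is singular). The
  points of the interface between the parts may belong to either of them.
\<close>

definition surface_piece :: "(real^'d::finite) set \<Rightarrow> (real^'d) set \<Rightarrow> bool" where
  "surface_piece \<Omega> \<Gamma> \<longleftrightarrow>
     (\<exists>S. openin (top_of_set (frontier \<Omega>)) S \<and> S \<subseteq> \<Gamma> \<and> \<Gamma> \<subseteq> closure S)"

definition boundary_parts ::
    "(real^'d::finite) set \<Rightarrow> (real^'d) set \<Rightarrow> (real^'d) set \<Rightarrow> bool" where
  "boundary_parts \<Omega> \<Gamma>D \<Gamma>N \<longleftrightarrow>
     frontier \<Omega> = \<Gamma>D \<union> \<Gamma>N \<and> \<Gamma>D \<inter> \<Gamma>N = {} \<and> \<Gamma>D \<noteq> {} \<and>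
     surface_piece \<Omega> \<Gamma>D \<and> surface_piece \<Omega> \<Gamma>N"


section \<open>The material tensor\<close>

text \<open>
  Matrices are elements of \<^typ>\<open>real^'d^'d\<close>, whose norm and inner product \<open>\<bullet>\<close> are the
  Frobenius ones.
\<close>

definition material_tensor ::
    "(real^'d::finite) set \<Rightarrow> (real^'d \<Rightarrow> real^'d^'d \<Rightarrow> real^'d^'d) \<Rightarrow> bool" where
  "material_tensor \<Omega> A \<longleftrightarrow>
     (\<forall>x\<in>\<Omega>. linear (A x) \<and>
            (\<forall>M N. A x M \<bullet> N = M \<bullet> A x N) \<and>
            (\<forall>M. transpose M = M \<longrightarrow> transpose (A x M) = A x M)) \<and>
     (\<exists>C. \<forall>x\<in>\<Omega>. \<forall>M. norm (A x M) \<le> C * norm M) \<and>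
     (\<exists>\<alpha>>0. \<forall>x\<in>\<Omega>. \<forall>M. A x M \<bullet> M \<ge> \<alpha> * (norm M)\<^sup>2)"


section \<open>Lebesgue spaces, divergence and normal trace\<close>

definition L2 :: "(real^'d::finite) set \<Rightarrow> (real^'d \<Rightarrow> 'b::euclidean_space) set" where
  "L2 \<Omega> = {f. f \<in> borel_measurable (lebesgue_on \<Omega>) \<and>
              integrable (lebesgue_on \<Omega>) (\<lambda>x. (norm (f x))\<^sup>2)}"

definition L2_inner ::
    "(real^'d::finite) set \<Rightarrow> (real^'d \<Rightarrow> 'b::euclidean_space) \<Rightarrow> (real^'d \<Rightarrow> 'b) \<Rightarrow> real" where
  "L2_inner \<Omega> f g = integral\<^sup>L (lebesgue_on \<Omega>) (\<lambda>x. f x \<bullet> g x)"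

text \<open>The \<open>(i,j)\<close> entry of \<^term>\<open>jacobian \<phi> (at x)\<close> is the partial derivative \<open>\<partial>\<^sub>j \<phi>\<^sub>i\<close>.\<close>

definition C1_field :: "(real^'d::finite \<Rightarrow> real^'d) \<Rightarrow> bool" where
  "C1_field \<phi> \<longleftrightarrow>
     (\<forall>x. \<phi> differentiable (at x)) \<and> continuous_on UNIV (\<lambda>x. jacobian \<phi> (at x))"

text \<open>
  \<open>g\<close> is the weak row-wise divergence of \<open>\<tau>\<close>, i.e. \<open>g\<^sub>i = \<Sum>\<^sub>j \<partial>\<^sub>j \<tau>\<^sub>i\<^sub>j\<close>. The test fields are the
  continuously differentiable ones with compact support in \<open>\<Omega>\<close>; by mollification, smooth ones
  give the same notion.
\<close>

definition has_weak_div ::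
    "(real^'d::finite) set \<Rightarrow> (real^'d \<Rightarrow> real^'d^'d) \<Rightarrow> (real^'d \<Rightarrow> real^'d) \<Rightarrow> bool" where
  "has_weak_div \<Omega> \<tau> g \<longleftrightarrow>
     (\<forall>\<phi>. C1_field \<phi> \<and> (\<exists>K. compact K \<and> K \<subseteq> \<Omega> \<and> (\<forall>x. x \<notin> K \<longrightarrow> \<phi> x = 0)) \<longrightarrow>
        L2_inner \<Omega> \<tau> (\<lambda>x. jacobian \<phi> (at x)) = - L2_inner \<Omega> g \<phi>)"

definition wdiv ::
    "(real^'d::finite) set \<Rightarrow> (real^'d \<Rightarrow> real^'d^'d) \<Rightarrow> real^'d \<Rightarrow> real^'d" where
  "wdiv \<Omega> \<tau> = (SOME g. g \<in> L2 \<Omega> \<and> has_weak_div \<Omega> \<tau> g)"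

definition Hdiv :: "(real^'d::finite) set \<Rightarrow> (real^'d \<Rightarrow> real^'d^'d) set" where
  "Hdiv \<Omega> = {\<tau> \<in> L2 \<Omega>. \<exists>g\<in>L2 \<Omega>. has_weak_div \<Omega> \<tau> g}"

text \<open>
  For \<open>\<tau>\<close> in \<^const>\<open>Hdiv\<close> the normal trace \<open>\<tau> n\<close> is the functional
  \<open>\<langle>\<tau> n, w\<rangle> = (\<tau>, \<nabla> w) + (div \<tau>, w)\<close> (Green's formula with the outward unit normal \<open>n\<close>). It
  vanishes on \<open>\<Gamma>\<close> iff it annihilates the fields \<open>w\<close> that vanish on the rest of the boundary.
\<close>

definition zero_normal_trace ::
    "(real^'d::finite) set \<Rightarrow> (real^'d) set \<Rightarrow> (real^'d \<Rightarrow> real^'d^'d) \<Rightarrow> bool" where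
  "zero_normal_trace \<Omega> \<Gamma> \<tau> \<longleftrightarrow>
     (\<forall>w. C1_field w \<and> (\<forall>x \<in> frontier \<Omega> - \<Gamma>. w x = 0) \<longrightarrow>
        L2_inner \<Omega> \<tau> (\<lambda>x. jacobian w (at x)) + L2_inner \<Omega> (wdiv \<Omega> \<tau>) w = 0)"

definition X_space ::
    "(real^'d::finite) set \<Rightarrow> (real^'d) set \<Rightarrow> (real^'d \<Rightarrow> real^'d^'d) set" where
  "X_space \<Omega> \<Gamma>N = {\<tau> \<in> Hdiv \<Omega>. zero_normal_trace \<Omega> \<Gamma>N \<tau>}"

definition V_space :: "(real^'d::finite) set \<Rightarrow> (real^'d \<Rightarrow> real^'d) set" where
  "V_space \<Omega> = L2 \<Omega>"

definition skew :: "real^'d^'d::finite \<Rightarrow> bool" where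
  "skew M \<longleftrightarrow> transpose M = - M"

definition W_space :: "(real^'d::finite) set \<Rightarrow> (real^'d \<Rightarrow> real^'d^'d) set" where
  "W_space \<Omega> = {\<xi> \<in> L2 \<Omega>. AE x in lebesgue_on \<Omega>. skew (\<xi> x)}"


section \<open>Meshes\<close>

text \<open>
  The library's \<^const>\<open>triangulation\<close> contains the conformity condition: any two cells meet in a
  common (possibly empty) face. The elements are the closed full-dimensional simplices.
\<close>

definition simplicial_mesh :: "(real^'d::finite) set \<Rightarrow> (real^'d) set set \<Rightarrow> bool" where
  "simplicial_mesh \<Omega> \<T> \<longleftrightarrow>
     triangulation \<T> \<and> (\<forall>E\<in>\<T>. int CARD('d) simplex E) \<and> \<Union>\<T> = closure \<Omega>"

definition mesh_size :: "(real^'d::finite) set set \<Rightarrow> real" where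
  "mesh_size \<T> = Max (diameter ` \<T>)"

definition inradius :: "(real^'d::finite) set \<Rightarrow> real" where
  "inradius E = Sup {r. 0 \<le> r \<and> (\<exists>c. cball c r \<subseteq> E)}"

definition shape_regular :: "real \<Rightarrow> (real^'d::finite) set set \<Rightarrow> bool" where
  "shape_regular \<kappa> \<T> \<longleftrightarrow> (\<forall>E\<in>\<T>. diameter E \<le> \<kappa> * inradius E)"

definition quasi_uniform :: "real \<Rightarrow> (real^'d::finite) set set \<Rightarrow> bool" where
  "quasi_uniform c \<T> \<longleftrightarrow> (\<forall>E\<in>\<T>. mesh_size \<T> \<le> c * diameter E)"

definition mesh_resolves_boundary ::
    "(real^'d::finite) set \<Rightarrow> (real^'d) set \<Rightarrow> (real^'d) set \<Rightarrow> (real^'d) set set \<Rightarrow> bool" where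
  "mesh_resolves_boundary \<Omega> \<Gamma>D \<Gamma>N \<T> \<longleftrightarrow>
     (\<forall>E\<in>\<T>. \<forall>F. F facet_of E \<and> F \<subseteq> frontier \<Omega> \<longrightarrow> F \<subseteq> closure \<Gamma>D \<or> F \<subseteq> closure \<Gamma>N)"

definition vertices :: "(real^'d::finite) set \<Rightarrow> (real^'d) set" where
  "vertices E = {r. r extreme_point_of E}"


section \<open>Finite element spaces\<close>

text \<open>
  Elements of these spaces may be discontinuous across facets, so the polynomial on \<open>E\<close> is
  prescribed on the interior of \<open>E\<close> only; the values on the (null) mesh skeleton are
  irrelevant. Functions that agree almost everywhere are identified in \<^term>\<open>fe_basis\<close> below.
\<close>

definition Xh ::
    "(real^'d::finite) set \<Rightarrow> (real^'d) set \<Rightarrow> (real^'d) set set \<Rightarrow> (real^'d \<Rightarrow> real^'d^'d) set" where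
  "Xh \<Omega> \<Gamma>N \<T> = {\<tau> \<in> X_space \<Omega> \<Gamma>N.
      \<forall>E\<in>\<T>. \<exists>L c. linear L \<and> (\<forall>x \<in> interior E. \<tau> x = L x + c)}"

definition Vh ::
    "(real^'d::finite) set \<Rightarrow> (real^'d) set set \<Rightarrow> (real^'d \<Rightarrow> real^'d) set" where
  "Vh \<Omega> \<T> = {v \<in> V_space \<Omega>. \<forall>E\<in>\<T>. \<exists>c. \<forall>x \<in> interior E. v x = c}"

definition Wh0 ::
    "(real^'d::finite) set \<Rightarrow> (real^'d) set set \<Rightarrow> (real^'d \<Rightarrow> real^'d^'d) set" where
  "Wh0 \<Omega> \<T> = {\<xi> \<in> W_space \<Omega>. \<forall>E\<in>\<T>. \<exists>c. skew c \<and> (\<forall>x \<in> interior E. \<xi> x = c)}"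

text \<open>A basis, indexed by a finite type, of a space of functions modulo equality a.e. in \<open>\<Omega>\<close>.\<close>

definition fe_basis ::
    "(real^'d::finite) set \<Rightarrow> (real^'d \<Rightarrow> 'b::euclidean_space) set \<Rightarrow>
     ('i::finite \<Rightarrow> real^'d \<Rightarrow> 'b) \<Rightarrow> bool" where
  "fe_basis \<Omega> S b \<longleftrightarrow>
     (\<forall>j. b j \<in> S) \<and>
     (\<forall>a. (AE x in lebesgue_on \<Omega>. (\<Sum>j\<in>UNIV. a j *\<^sub>R b j x) = 0) \<longrightarrow> (\<forall>j. a j = 0)) \<and>
     (\<forall>f\<in>S. \<exists>a. AE x in lebesgue_on \<Omega>. f x = (\<Sum>j\<in>UNIV. a j *\<^sub>R b j x))"


section \<open>Vertex quadrature\<close>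

text \<open>The value at a vertex \<open>r\<close> of \<open>E\<close> taken from within \<open>E\<close>.\<close>

definition vertex_value ::
    "(real^'d::finite) set \<Rightarrow> (real^'d \<Rightarrow> 'b::euclidean_space) \<Rightarrow> real^'d \<Rightarrow> 'b" where
  "vertex_value E \<phi> r = Lim (at r within interior E) \<phi>"

text \<open>For the quadrature rule to make sense, the material tensor needs such vertex values.\<close>

definition has_vertex_values ::
    "(real^'d::finite) set set \<Rightarrow> (real^'d \<Rightarrow> real^'d^'d \<Rightarrow> real^'d^'d) \<Rightarrow> bool" where
  "has_vertex_values \<T> A \<longleftrightarrow>
     (\<forall>E\<in>\<T>. \<forall>r \<in> vertices E. \<forall>M. \<exists>l. ((\<lambda>x. A x M) \<longlongrightarrow> l) (at r within interior E))"

definition quad_elem ::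
    "(real^'d::finite) set \<Rightarrow> (real^'d \<Rightarrow> real^'d^'d) \<Rightarrow> (real^'d \<Rightarrow> real^'d^'d) \<Rightarrow> real" where
  "quad_elem E \<phi> \<psi> =
     measure lebesgue E / real (CARD('d) + 1) *
       (\<Sum>r \<in> vertices E. vertex_value E \<phi> r \<bullet> vertex_value E \<psi> r)"

definition quad ::
    "(real^'d::finite) set set \<Rightarrow> (real^'d \<Rightarrow> real^'d^'d) \<Rightarrow> (real^'d \<Rightarrow> real^'d^'d) \<Rightarrow> real" where
  "quad \<T> \<phi> \<psi> = (\<Sum>E\<in>\<T>. quad_elem E \<phi> \<psi>)"


section \<open>The matrices of the method\<close>

definition A_ss ::
    "(real^'d::finite) set set \<Rightarrow> (real^'d \<Rightarrow> real^'d^'d \<Rightarrow> real^'d^'d) \<Rightarrow>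
     ('s::finite \<Rightarrow> real^'d \<Rightarrow> real^'d^'d) \<Rightarrow> real^'s^'s" where
  "A_ss \<T> A \<tau> = (\<chi> i j. quad \<T> (\<lambda>x. A x (\<tau> j x)) (\<tau> i))"

definition A_su ::
    "(real^'d::finite) set \<Rightarrow> ('s::finite \<Rightarrow> real^'d \<Rightarrow> real^'d^'d) \<Rightarrow>
     ('u::finite \<Rightarrow> real^'d \<Rightarrow> real^'d) \<Rightarrow> real^'s^'u" where
  "A_su \<Omega> \<tau> v = (\<chi> i j. L2_inner \<Omega> (wdiv \<Omega> (\<tau> j)) (v i))"

definition A_sg ::
    "(real^'d::finite) set \<Rightarrow> ('s::finite \<Rightarrow> real^'d \<Rightarrow> real^'d^'d) \<Rightarrow>
     ('g::finite \<Rightarrow> real^'d \<Rightarrow> real^'d^'d) \<Rightarrow> real^'s^'g" where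
  "A_sg \<Omega> \<tau> \<xi> = (\<chi> i j. L2_inner \<Omega> (\<tau> j) (\<xi> i))"

definition block_matrix ::
    "real^'u^'u \<Rightarrow> real^'g^'u \<Rightarrow> real^'u^'g \<Rightarrow> real^'g^'g \<Rightarrow>
     real^('u::finite + 'g::finite)^('u + 'g)" where
  "block_matrix P Q R S = (\<chi> i j.
     case i of
       Inl k \<Rightarrow> (case j of Inl l \<Rightarrow> P $ k $ l | Inr l \<Rightarrow> Q $ k $ l)
     | Inr k \<Rightarrow> (case j of Inl l \<Rightarrow> R $ k $ l | Inr l \<Rightarrow> S $ k $ l))"

definition displacement_rotation_matrix ::
    "real^'s^'s \<Rightarrow> real^'s^'u \<Rightarrow> real^'s^'g \<Rightarrow>
     real^('u::finite + 'g::finite)^('u + 'g)" where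
  "displacement_rotation_matrix Ass Asu Asg =
     block_matrix
       (Asu ** matrix_inv Ass ** transpose Asu) (Asu ** matrix_inv Ass ** transpose Asg)
       (Asg ** matrix_inv Ass ** transpose Asu) (Asg ** matrix_inv Ass ** transpose Asg)"

definition symmetric_matrix :: "real^'n^'n::finite \<Rightarrow> bool" where
  "symmetric_matrix M \<longleftrightarrow> transpose M = M"

definition positive_definite_matrix :: "real^'n^'n::finite \<Rightarrow> bool" where
  "positive_definite_matrix M \<longleftrightarrow> (\<forall>x. x \<noteq> 0 \<longrightarrow> x \<bullet> (M *v x) > 0)"

end

theory Submission
  imports Defs
begin

text \<open>
  Write \<open>M\<close> for the stress matrix and \<open>B\<close> for the two constraint matrices stacked on top of each
  other. The displacement-rotation matrix is \<open>B M\<inverse> B\<^sup>T\<close>, so it is symmetric and positive definite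
  once \<open>M\<close> is and \<open>B\<^sup>T\<close> is injective.

  The quadrature form is a sum over elements and vertices of \<open>A(r) \<tau>(r) : \<tau>(r)\<close> with positive
  weights. The vertex values of \<open>A\<close> inherit symmetry and coercivity by passing to the limit, and a
  field that is affine on each element is determined by its vertex values. This settles \<open>M\<close>
  (\<open>A_ss_symmetric\<close>, \<open>A_ss_positive\<close>).

  Injectivity of \<open>B\<^sup>T\<close> says that a pair \<open>(v, \<xi>)\<close> of piecewise constant fields, \<open>\<xi>\<close> skew, with
  \<open>(div \<sigma>, v) + (\<sigma>, \<xi>) = 0\<close> for every discrete stress \<open>\<sigma>\<close> is zero (\<open>kernel_trivial\<close>). On an
  element \<open>E\<close> with centroid \<open>c\<close>, integration by parts turns the two terms into the boundary
  integral of \<open>\<sigma> n\<close> against the infinitesimal rigid motion \<open>v\<^sub>E + \<xi>\<^sub>E (x - c)\<close>. On an interior or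
  Dirichlet facet, the normal trace of \<open>\<sigma>\<close> can be any affine field. Hence the rigid motions of two
  neighbours agree on their common facet, and those of elements with a facet in \<open>\<Gamma>\<^sub>D\<close> vanish
  there. A rigid motion that vanishes on a facet is zero (\<open>rigid_motion_eq_zero\<close>), so zero spreads
  from one Dirichlet facet through the mesh.

  To make this rigorous with the weak divergence and the weak normal trace, one tests with
  explicit stresses. Let \<open>F\<close> be the facet of \<open>E\<close> opposite the vertex \<open>p\<close>, \<open>r\<close> a vertex of \<open>F\<close>, and
  \<open>\<lambda>\<^sub>r\<close> the barycentric coordinate of \<open>r\<close>. The field \<open>\<lambda>\<^sub>r a \<otimes> (p - r)\<close> has a normal trace on \<open>F\<close>
  only: the edge \<open>p - r\<close> is tangent to the facets through \<open>p\<close> and \<open>r\<close>, and \<open>\<lambda>\<^sub>r\<close> vanishes on the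
  remaining one. Scaled by the inverse volume, the fields of the two elements at \<open>F\<close> have opposite
  products with a fixed normal of \<open>F\<close>, so their difference is a discrete stress. The Green
  identity behind this is proved on the reference simplex (\<open>ref_simplex_divergence\<close>) and carried
  to the elements by affine maps (\<open>element_flux_interior\<close>, \<open>element_flux_boundary\<close>).

  The spreading argument needs two facts on the mesh: any two elements are linked by a chain of
  elements with common facets (\<open>mesh_facet_connected\<close>), and some facet lies in the closure of
  \<open>\<Gamma>\<^sub>D\<close> (\<open>dirichlet_facet\<close>). Both follow from a segment in general position, which avoids all
  faces of codimension two.
\<close>

section \<open>Barycentric coordinates\<close>

text \<open>
  The vertex sets of the full-dimensional simplices.
\<close>

definition affine_frame :: "(real^'d::finite) set \<Rightarrow> bool" where
  "affine_frame V \<longleftrightarrow> \<not> affine_dependent V \<and> card V = CARD('d) + 1"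

lemma affine_frame_finite: "affine_frame V \<Longrightarrow> finite V"
  by (metis affine_frame_def card.infinite add_is_0 zero_neq_one)

lemma affine_frame_other:
  assumes V: "affine_frame V"
  obtains r where "r \<in> V" "r \<noteq> p"
proof -
  have "\<not> V \<subseteq> {p}"
  proof
    assume "V \<subseteq> {p}"
    then have "card V \<le> 1" using card_mono[of "{p}" V] by simp
    then show False using V by (simp add: affine_frame_def)
  qed
  then show ?thesis using that by auto
qed

lemma affine_frame_span:
  fixes V :: "(real^'d::finite) set"
  assumes "affine_frame V" "r \<in> V"
  shows "independent ((\<lambda>q. q - r) ` (V - {r}))" "span ((\<lambda>q. q - r) ` (V - {r})) = UNIV"
proof -
  have e: "(\<lambda>q. q - r) ` (V - {r}) = (\<lambda>x. -r + x) ` (V - {r})" by (auto simp: image_def)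
  show i: "independent ((\<lambda>q. q - r) ` (V - {r}))"
    using affine_dependent_iff_dependent2[OF assms(2)] assms(1) unfolding affine_frame_def e by blast
  have "card ((\<lambda>q. q - r) ` (V - {r})) = CARD('d)"
    using assms affine_frame_finite[OF assms(1)]
    by (subst card_image) (auto simp: inj_on_def affine_frame_def)
  then show "span ((\<lambda>q. q - r) ` (V - {r})) = UNIV"
    using i card_ge_dim_independent[of "(\<lambda>q. q - r) ` (V - {r})" UNIV] by auto
qed

text \<open>
  The edges \<open>q - r\<close> at a vertex \<open>r\<close> form a basis of the space. The dual functionals are the
  coordinates that belong to the other vertices; the coordinate of \<open>r\<close> is what is missing to the
  sum \<open>1\<close>.
\<close>

lemma bary_exists:
  fixes V :: "(real^'d::finite) set"
  assumes V: "affine_frame V"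
  shows "\<exists>g k. \<forall>x. (\<Sum>q\<in>V. g q \<bullet> x + k q) = 1 \<and> (\<Sum>q\<in>V. (g q \<bullet> x + k q) *\<^sub>R q) = x"
proof -
  have fin: "finite V" and "V \<noteq> {}" using V affine_frame_finite[OF V] by (auto simp: affine_frame_def)
  then obtain r where r: "r \<in> V" by auto
  let ?W = "V - {r}" and ?B = "(\<lambda>q. q - r) ` (V - {r})"
  have "\<exists>g. \<forall>q'\<in>?W. g \<bullet> (q' - r) = (if q' = q then 1 else 0)" for q
  proof -
    obtain f :: "real^'d \<Rightarrow> real" where f: "linear f" "\<forall>b\<in>?B. f b = (if b = q - r then 1 else 0)"
      using linear_independent_extend[OF affine_frame_span(1)[OF V r], of "\<lambda>b. if b = q - r then 1 else 0"] by blast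
    have "f x = adjoint f 1 \<bullet> x" for x
      using adjoint_works[OF f(1), of x 1] by (simp add: inner_commute)
    then have "\<forall>q'\<in>?W. adjoint f 1 \<bullet> (q' - r) = (if q' = q then 1 else 0)" using f(2) by auto
    then show ?thesis by blast
  qed
  then obtain g where g: "\<And>q q'. q' \<in> ?W \<Longrightarrow> g q \<bullet> (q' - r) = (if q' = q then 1 else 0)" by metis
  have id: "(\<Sum>q\<in>?W. (g q \<bullet> z) *\<^sub>R (q - r)) = z" for z
  proof -
    have "(\<lambda>z. \<Sum>q\<in>?W. (g q \<bullet> z) *\<^sub>R (q - r)) = (\<lambda>z. z)"
    proof (rule linear_eq_stdbasis[OF _ linear_id[unfolded id_def]])
      show l: "linear (\<lambda>z. \<Sum>q\<in>?W. (g q \<bullet> z) *\<^sub>R (q - r))"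
        by (intro linear_compose_sum ballI linear_compose[of "\<lambda>z. _ \<bullet> z" "\<lambda>t. t *\<^sub>R _", unfolded o_def])
           (auto intro!: linearI simp: inner_simps scaleR_left_distrib)
      fix b :: "real^'d" assume "b \<in> Basis"
      have "x \<in> span ?B \<Longrightarrow> (\<Sum>q\<in>?W. (g q \<bullet> x) *\<^sub>R (q - r)) = x" for x
      proof (rule linear_eq_on[OF l linear_id[unfolded id_def]], assumption)
        fix b assume "b \<in> ?B"
        then obtain q' where q': "q' \<in> ?W" "b = q' - r" by auto
        have "(\<Sum>q\<in>?W. (g q \<bullet> b) *\<^sub>R (q - r)) = (\<Sum>q\<in>?W. if q' = q then q - r else 0)"
          using q' g by (intro sum.cong) auto
        also have "\<dots> = b" using q' fin by (subst sum.delta') auto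
        finally show "(\<Sum>q\<in>?W. (g q \<bullet> b) *\<^sub>R (q - r)) = b" .
      qed
      then show "(\<Sum>q\<in>?W. (g q \<bullet> b) *\<^sub>R (q - r)) = b" using affine_frame_span(2)[OF V r] by auto
    qed
    then show ?thesis by meson
  qed
  define g' where "g' q = (if q = r then - (\<Sum>q\<in>?W. g q) else g q)" for q
  define k where "k q = (if q = r then 1 + (\<Sum>q\<in>?W. g q \<bullet> r) else - (g q \<bullet> r))" for q
  have sr: "g' r \<bullet> x + k r = 1 - (\<Sum>q\<in>?W. g q \<bullet> (x - r))" for x
    by (simp add: g'_def k_def inner_simps inner_sum_left sum_subtractf)
  have sq: "g' q \<bullet> x + k q = g q \<bullet> (x - r)" if "q \<in> ?W" for q x
    using that by (simp add: g'_def k_def inner_simps)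
  show ?thesis
  proof (intro exI allI conjI)
    fix x
    show "(\<Sum>q\<in>V. g' q \<bullet> x + k q) = 1"
      using r fin sr[of x] sq by (subst sum.remove[of _ r]) auto
    have "(\<Sum>q\<in>V. (g' q \<bullet> x + k q) *\<^sub>R q) = (g' r \<bullet> x + k r) *\<^sub>R r + (\<Sum>q\<in>?W. (g' q \<bullet> x + k q) *\<^sub>R q)"
      using r fin by (subst sum.remove[of _ r]) auto
    also have "\<dots> = r + (\<Sum>q\<in>?W. (g q \<bullet> (x - r)) *\<^sub>R (q - r))"
      using sq by (simp add: sr scaleR_left_diff_distrib scaleR_right_diff_distrib sum_subtractf scaleR_sum_left)
    also have "\<dots> = x" using id[of "x - r"] by simp
    finally show "(\<Sum>q\<in>V. (g' q \<bullet> x + k q) *\<^sub>R q) = x" .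
  qed
qed

text \<open>
  Gradients and constant terms are chosen once for all points, so that each barycentric coordinate
  is an affine function on the whole space, with the same gradient everywhere.
\<close>

definition bary_coeffs :: "(real^'d::finite) set \<Rightarrow> (real^'d \<Rightarrow> real^'d) \<times> (real^'d \<Rightarrow> real)" where
  "bary_coeffs V = (SOME (g, k). \<forall>x. (\<Sum>q\<in>V. g q \<bullet> x + k q) = 1 \<and> (\<Sum>q\<in>V. (g q \<bullet> x + k q) *\<^sub>R q) = x)"

definition bary_grad :: "(real^'d::finite) set \<Rightarrow> real^'d \<Rightarrow> real^'d" where
  "bary_grad V = fst (bary_coeffs V)"

definition bary :: "(real^'d::finite) set \<Rightarrow> real^'d \<Rightarrow> real^'d \<Rightarrow> real" where
  "bary V q x = bary_grad V q \<bullet> x + snd (bary_coeffs V) q"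

lemma bary_sum:
  assumes V: "affine_frame V"
  shows "(\<Sum>q\<in>V. bary V q x) = 1" and bary_combination: "(\<Sum>q\<in>V. bary V q x *\<^sub>R q) = x"
proof -
  have "case bary_coeffs V of (g, k) \<Rightarrow>
      \<forall>x. (\<Sum>q\<in>V. g q \<bullet> x + k q) = 1 \<and> (\<Sum>q\<in>V. (g q \<bullet> x + k q) *\<^sub>R q) = x"
    unfolding bary_coeffs_def by (rule someI_ex) (use bary_exists[OF V] in auto)
  then show "(\<Sum>q\<in>V. bary V q x) = 1" "(\<Sum>q\<in>V. bary V q x *\<^sub>R q) = x"
    unfolding bary_def bary_grad_def by (auto simp: case_prod_beta)
qed

lemma bary_diff: "bary V q y = bary V q x + bary_grad V q \<bullet> (y - x)"
  by (simp add: bary_def inner_simps)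

lemma bary_unique:
  assumes V: "affine_frame V" and "(\<Sum>q\<in>V. u q) = 1" "(\<Sum>q\<in>V. u q *\<^sub>R q) = x" "q \<in> V"
  shows "bary V q x = u q"
proof (rule ccontr)
  assume "bary V q x \<noteq> u q"
  then have "affine_dependent V"
    unfolding affine_dependent_explicit_finite[OF affine_frame_finite[OF V]]
    using assms bary_sum[OF V, of x] bary_combination[OF V, of x]
    by (intro exI[of _ "\<lambda>q. bary V q x - u q"]) (auto simp: sum_subtractf scaleR_left_diff_distrib)
  then show False using V by (simp add: affine_frame_def)
qed

lemma bary_vertex:
  assumes "affine_frame V" "q \<in> V" "q' \<in> V"
  shows "bary V q q' = (if q = q' then 1 else 0)"
  using assms affine_frame_finite[OF assms(1)]
  by (intro bary_unique) (auto simp: if_distrib[of "\<lambda>t. t *\<^sub>R _"] cong: if_cong)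

lemma bary_mem_hull:
  assumes V: "affine_frame V"
  shows "x \<in> convex hull V \<longleftrightarrow> (\<forall>q\<in>V. 0 \<le> bary V q x)"
proof
  assume "x \<in> convex hull V"
  then obtain u where u: "\<forall>q\<in>V. 0 \<le> u q" "(\<Sum>q\<in>V. u q) = 1" "(\<Sum>q\<in>V. u q *\<^sub>R q) = x"
    unfolding convex_hull_finite[OF affine_frame_finite[OF V]] by auto
  then show "\<forall>q\<in>V. 0 \<le> bary V q x" using bary_unique[OF V u(2,3)] by auto
next
  assume "\<forall>q\<in>V. 0 \<le> bary V q x"
  then show "x \<in> convex hull V"
    unfolding convex_hull_finite[OF affine_frame_finite[OF V]]
    using bary_sum[OF V, of x] bary_combination[OF V, of x] by auto
qed

lemma bary_mem_facet:
  assumes V: "affine_frame V" and p: "p \<in> V"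
  shows "x \<in> convex hull (V - {p}) \<longleftrightarrow> x \<in> convex hull V \<and> bary V p x = 0"
proof
  have fin: "finite V" "finite (V - {p})" using affine_frame_finite[OF V] by auto
  assume x: "x \<in> convex hull (V - {p})"
  then obtain u where u: "(\<Sum>q\<in>V - {p}. u q) = 1" "(\<Sum>q\<in>V - {p}. u q *\<^sub>R q) = x"
    unfolding convex_hull_finite[OF fin(2)] by auto
  have "bary V p x = (u(p := 0)) p"
    using u p fin by (intro bary_unique[OF V]) (auto simp: sum.remove[of V p])
  then show "x \<in> convex hull V \<and> bary V p x = 0"
    using x hull_mono[of "V - {p}" V convex] by auto
next
  have fin: "finite V" "finite (V - {p})" using affine_frame_finite[OF V] by auto
  assume x: "x \<in> convex hull V \<and> bary V p x = 0"
  then show "x \<in> convex hull (V - {p})"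
    unfolding convex_hull_finite[OF fin(2)]
    using bary_sum[OF V, of x] bary_combination[OF V, of x] bary_mem_hull[OF V, of x] p fin
    by (auto simp: sum.remove[of V p] intro!: exI[of _ "\<lambda>q. bary V q x"])
qed

lemma bary_grad_vertex:
  assumes "affine_frame V" "q \<in> V" "a \<in> V" "b \<in> V"
  shows "bary_grad V q \<bullet> (a - b) = (if q = a then 1 else 0) - (if q = b then 1 else 0)"
  using bary_diff[of V q a b] assms by (simp add: bary_vertex)

lemma continuous_bary [continuous_intros]: "continuous_on S (bary V q)"
  unfolding bary_def by (intro continuous_intros)

lemma bary_mem_interior:
  assumes V: "affine_frame V"
  shows "x \<in> interior (convex hull V) \<longleftrightarrow> (\<forall>q\<in>V. 0 < bary V q x)"
proof
  assume x: "x \<in> interior (convex hull V)"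
  show "\<forall>q\<in>V. 0 < bary V q x"
  proof
    fix q assume q: "q \<in> V"
    obtain q' where q': "q' \<in> V" "q' \<noteq> q" using affine_frame_other[OF V] by auto
    then have g0: "bary_grad V q \<noteq> 0" using bary_grad_vertex[OF V q q q'(1)] by auto
    obtain e where e: "e > 0" "ball x e \<subseteq> convex hull V" using x mem_interior by blast
    define y where "y = x - (e / 2 / norm (bary_grad V q)) *\<^sub>R bary_grad V q"
    have "dist x y = e / 2" using g0 e(1) by (simp add: y_def dist_norm)
    then have "y \<in> convex hull V" using e by auto
    then have "0 \<le> bary V q y" using q by (simp add: bary_mem_hull[OF V])
    also have "bary V q y = bary V q x - e / 2 * norm (bary_grad V q)"
      by (subst bary_diff[of V q y x]) (simp add: y_def power2_norm_eq_inner[symmetric] power2_eq_square)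
    finally show "0 < bary V q x" using e(1) g0
      by (smt (verit) half_gt_zero mult_pos_pos zero_less_norm_iff)
  qed
next
  assume "\<forall>q\<in>V. 0 < bary V q x"
  moreover have "open (\<Inter>q\<in>V. {x. 0 < bary V q x})"
    using affine_frame_finite[OF V] by (intro open_INT ballI open_Collect_less continuous_intros) auto
  ultimately show "x \<in> interior (convex hull V)"
    by (intro interiorI[of "\<Inter>q\<in>V. {x. 0 < bary V q x}"]) (auto simp: bary_mem_hull[OF V] less_imp_le)
qed

lemma affine_eq_zero:
  assumes V: "affine_frame V" and L: "linear L" and z: "\<And>q. q \<in> V \<Longrightarrow> L q + c = 0"
  shows "L x + c = 0"
proof -
  have "L x + c = L (\<Sum>q\<in>V. bary V q x *\<^sub>R q) + (\<Sum>q\<in>V. bary V q x) *\<^sub>R c"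
    by (simp add: bary_sum[OF V] bary_combination[OF V])
  also have "\<dots> = (\<Sum>q\<in>V. bary V q x *\<^sub>R (L q + c))"
    by (simp add: linear_sum[OF L] linear_scale[OF L] scaleR_sum_left sum.distrib scaleR_right_distrib)
  also have "\<dots> = 0" using z by simp
  finally show ?thesis .
qed

text \<open>
  Subtracting the equations of two vertices shows that \<open>K\<close> annihilates the edges of the facet
  opposite \<open>p\<close>. By skewness, the image of one more edge \<open>p - r0\<close> is orthogonal to all these edges,
  and to \<open>p - r0\<close> itself; as these vectors span the space, \<open>K\<close> annihilates \<open>p - r0\<close> as well.
\<close>

lemma rigid_motion_eq_zero:
  assumes V: "affine_frame V" and p: "p \<in> V" and K: "skew K"
    and z: "\<And>r. r \<in> V - {p} \<Longrightarrow> v + \<mu> *\<^sub>R (K *v (r - p)) = 0" and \<mu>: "\<mu> \<noteq> 0"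
  shows "v = 0" "K = 0"
proof -
  have sk: "(K *v x) \<bullet> y = - (x \<bullet> (K *v y))" for x y
  proof -
    have "(K *v x) \<bullet> y = x \<bullet> (transpose K *v y)"
      by (metis dot_lmul_matrix inner_commute transpose_matrix_vector)
    moreover have "(- K) *v y = - (K *v y)" by (simp add: matrix_vector_mult_def vec_eq_iff sum_negf)
    ultimately show ?thesis using K unfolding skew_def by simp
  qed
  obtain r0 where r0: "r0 \<in> V" "r0 \<noteq> p" using affine_frame_other[OF V] by auto
  have K0: "K *v (q - r0) = 0" if "q \<in> V" "q \<noteq> p" for q
  proof -
    have "\<mu> *\<^sub>R (K *v (q - p)) = \<mu> *\<^sub>R (K *v (r0 - p))"
      using z[of q] z[of r0] r0 that by (simp add: add_eq_0_iff)
    then show ?thesis using \<mu> by (simp add: matrix_vector_mult_diff_distrib)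
  qed
  let ?B = "(\<lambda>q. q - r0) ` (V - {r0})"
  have "K *v (p - r0) = 0"
  proof -
    have "orthogonal (K *v (p - r0)) b" if "b \<in> ?B" for b
    proof -
    from that obtain q where q: "q \<in> V" "b = q - r0" by blast
    have "(K *v (p - r0)) \<bullet> b = 0"
    proof (cases "q = p")
      case True
      then show ?thesis using sk[of "p - r0" "p - r0"] q by (simp add: inner_commute)
    next
      case False
      then show ?thesis using sk[of "p - r0" b] K0 q by simp
    qed
    then show ?thesis by (simp add: orthogonal_def)
    qed
    then have "orthogonal (K *v (p - r0)) (K *v (p - r0))"
      using orthogonal_to_span[of "K *v (p - r0)" ?B] affine_frame_span(2)[OF V r0(1)] by auto
    then show ?thesis by (simp add: orthogonal_self)
  qed
  then have "\<forall>b\<in>?B. K *v b = 0" using K0 by auto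
  then have "K *v x = 0" for x
    using linear_eq_0_on_span[of "(*v) K" ?B x] affine_frame_span(2)[OF V r0(1)] by auto
  then show "K = 0" by (simp add: matrix_eq)
  then show "v = 0" using z[of r0] r0 by simp
qed

section \<open>Divergence on the reference simplex\<close>

text \<open>
  This is the uniqueness of translation-invariant measures up to a factor. The integrals of \<open>f \<circ>
  L\<close> and \<open>g\<close> are multiplied for an even test function \<open>f\<close>; with Fubini and the shifts \<open>y \<mapsto> y + L
  x\<close> and \<open>x \<mapsto> x - L\<inverse> y\<close>, the roles of \<open>f\<close> and \<open>g\<close> are exchanged.
\<close>

lemma nn_integral_linear_image:
  fixes L :: "'a::euclidean_space \<Rightarrow> 'a"
  assumes L: "linear L" "bij L"
  shows "\<exists>c>0. \<forall>g \<in> borel_measurable borel.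
    (\<integral>\<^sup>+x. g (L x) \<partial>lborel) = ennreal c * (\<integral>\<^sup>+x. g x \<partial>lborel)"
proof -
  define f :: "'a \<Rightarrow> ennreal" where "f = indicator (cball 0 1)"
  have Lm [measurable]: "L \<in> borel_measurable borel"
    using L(1) by (intro borel_measurable_continuous_onI linear_continuous_on) (simp add: linear_conv_bounded_linear)
  have f [measurable]: "f \<in> borel_measurable borel" unfolding f_def by (intro borel_measurable_indicator) simp
  have sym: "f (- y) = f y" for y by (simp add: f_def indicator_def)
  have shift: "(\<integral>\<^sup>+y. h (y + a) \<partial>lborel) = (\<integral>\<^sup>+y. h y \<partial>lborel)"
    if [measurable]: "h \<in> borel_measurable borel" for h :: "'a \<Rightarrow> ennreal" and a
    by (subst (2) lborel_distr_plus[of a, symmetric]) (simp add: nn_integral_distr add.commute)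
  have refl: "(\<integral>\<^sup>+y. f (a - y) \<partial>lborel) = (\<integral>\<^sup>+y. f y \<partial>lborel)" for a
  proof -
    have "(\<integral>\<^sup>+y. f (a - y) \<partial>lborel) = (\<integral>\<^sup>+y. f (y + (- a)) \<partial>lborel)"
      by (subst sym[symmetric]) simp
    also have "\<dots> = (\<integral>\<^sup>+y. f y \<partial>lborel)" by (rule shift) simp
    finally show ?thesis .
  qed
  define If where "If = (\<integral>\<^sup>+y. f y \<partial>lborel)"
  define IL where "IL = (\<integral>\<^sup>+y. f (L y) \<partial>lborel)"
  have swap: "IL * (\<integral>\<^sup>+y. g y \<partial>lborel) = (\<integral>\<^sup>+x. g (L x) \<partial>lborel) * If"
    if g [measurable]: "g \<in> borel_measurable borel" for g
  proof -
    have "IL * (\<integral>\<^sup>+y. g y \<partial>lborel) = (\<integral>\<^sup>+x. f (L x) * (\<integral>\<^sup>+y. g y \<partial>lborel) \<partial>lborel)"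
      unfolding IL_def by (subst nn_integral_multc) auto
    also have "\<dots> = (\<integral>\<^sup>+x. (\<integral>\<^sup>+y. f (L x) * g (y + L x) \<partial>lborel) \<partial>lborel)"
      by (subst nn_integral_cmult) (auto simp: shift)
    also have "\<dots> = (\<integral>\<^sup>+y. (\<integral>\<^sup>+x. f (L x) * g (y + L x) \<partial>lborel) \<partial>lborel)"
      by (rule lborel_pair.Fubini') simp
    also have "\<dots> = (\<integral>\<^sup>+y. (\<integral>\<^sup>+x. f (L x - y) * g (L x) \<partial>lborel) \<partial>lborel)"
    proof (rule nn_integral_cong)
      fix y
      obtain z where z: "L z = y" using L(2) by (metis bij_pointE)
      show "(\<integral>\<^sup>+x. f (L x) * g (y + L x) \<partial>lborel) = (\<integral>\<^sup>+x. f (L x - y) * g (L x) \<partial>lborel)"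
        using shift[of "\<lambda>x. f (L x - y) * g (L x)" z] by (simp add: linear_add[OF L(1)] z add.commute)
    qed
    also have "\<dots> = (\<integral>\<^sup>+x. (\<integral>\<^sup>+y. f (L x - y) * g (L x) \<partial>lborel) \<partial>lborel)"
      by (rule lborel_pair.Fubini') simp
    also have "\<dots> = (\<integral>\<^sup>+x. g (L x) * If \<partial>lborel)"
      unfolding If_def by (subst nn_integral_multc) (auto simp: refl mult.commute)
    also have "\<dots> = (\<integral>\<^sup>+x. g (L x) \<partial>lborel) * If"
      by (subst nn_integral_multc) auto
    finally show ?thesis .
  qed
  have If_eq: "If = emeasure lborel (cball (0::'a) 1)"
    by (simp add: If_def f_def)
  have If_fin: "If < \<infinity>" unfolding If_eq by (rule emeasure_lborel_cball_finite)
  have pos: "0 < emeasure lborel (ball (0::'a) e)" if "e > 0" for e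
    using content_ball_pos[OF that, of "0::'a"] by (simp add: measure_def enn2real_positive_iff)
  have If_pos: "0 < If"
    unfolding If_eq by (rule less_le_trans[OF pos[of 1]]) (auto intro!: emeasure_mono)
  have IL_eq: "IL = emeasure lborel (L -` cball 0 1)" and LB: "L -` cball 0 1 \<in> sets borel"
  proof -
    have "f (L y) = indicator (L -` cball 0 1) y" for y by (simp add: f_def indicator_def)
    moreover show "L -` cball 0 1 \<in> sets borel" using measurable_sets_borel[OF Lm, of "cball 0 1"] by simp
    ultimately show "IL = emeasure lborel (L -` cball 0 1)" by (simp add: IL_def)
  qed
  have IL_fin: "IL < \<infinity>"
  proof -
    have "L -` cball 0 1 = inv L ` cball 0 1" using L(2) by (simp add: bij_vimage_eq_inv_image)
    moreover have "bounded_linear (inv L)"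
      using L by (simp add: inj_linear_imp_inv_bounded_linear linear_conv_bounded_linear bij_is_inj)
    ultimately have "compact (L -` cball 0 1)"
      by (simp add: compact_continuous_image linear_continuous_on)
    then show ?thesis unfolding IL_eq by (rule emeasure_compact_finite)
  qed
  have IL_pos: "0 < IL"
  proof -
    obtain B where B: "B > 0" "\<And>x. norm (L x) \<le> B * norm x"
      using linear_bounded_pos[OF L(1)] by auto
    have "ball 0 (1 / B) \<subseteq> L -` cball 0 1"
    proof
      fix x :: 'a assume "x \<in> ball 0 (1 / B)"
      then have "B * norm x \<le> 1" using B(1) by (simp add: field_simps)
      then show "x \<in> L -` cball 0 1" using B(2)[of x] by simp
    qed
    then have "emeasure lborel (ball (0::'a) (1 / B)) \<le> IL"
      unfolding IL_eq using LB by (intro emeasure_mono) auto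
    then show ?thesis using pos[of "1 / B"] B(1) by (auto intro: less_le_trans)
  qed
  define c where "c = enn2real IL / enn2real If"
  have c: "c > 0" "ennreal c = IL / If"
    using If_fin IL_fin If_pos IL_pos
    by (auto simp: c_def enn2real_positive_iff divide_ennreal[symmetric] ennreal_enn2real_if less_top)
  show ?thesis
  proof (intro exI[of _ c] conjI ballI)
    fix g :: "'a \<Rightarrow> ennreal" assume "g \<in> borel_measurable borel"
    from swap[OF this] have "(\<integral>\<^sup>+x. g (L x) \<partial>lborel) * If / If = IL * (\<integral>\<^sup>+y. g y \<partial>lborel) / If" by simp
    then show "(\<integral>\<^sup>+x. g (L x) \<partial>lborel) = ennreal c * (\<integral>\<^sup>+x. g x \<partial>lborel)"
      using If_fin If_pos unfolding c(2)
      by (metis ennreal_mult_divide_eq ennreal_times_divide infinity_ennreal_def mult.commute order_less_irrefl)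
  qed (rule c(1))
qed

lemma lebesgue_integral_affine_image:
  fixes L :: "'a::euclidean_space \<Rightarrow> 'a"
  assumes L: "linear L" "bij L"
  shows "\<exists>D>0. \<forall>g \<in> borel_measurable borel. (\<integral>x. g x \<partial>lborel) = D * (\<integral>x. (g (r + L x) :: real) \<partial>lborel)"
proof -
  obtain c where c: "c > 0" and nn: "\<And>g. g \<in> borel_measurable borel \<Longrightarrow>
      (\<integral>\<^sup>+x. g (L x) \<partial>lborel) = ennreal c * (\<integral>\<^sup>+x. g x \<partial>lborel)"
    using nn_integral_linear_image[OF L] by blast
  have Lm [measurable]: "L \<in> borel_measurable borel"
    using L(1) by (intro borel_measurable_continuous_onI linear_continuous_on) (simp add: linear_conv_bounded_linear)
  have d: "distr lborel borel (\<lambda>x. r + L x) = density lborel (\<lambda>_. ennreal c)"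
  proof (rule measure_eqI)
    fix A assume "A \<in> sets (distr lborel borel (\<lambda>x. r + L x))"
    then have A [measurable]: "A \<in> sets borel" by simp
    have "emeasure (distr lborel borel (\<lambda>x. r + L x)) A = (\<integral>\<^sup>+x. indicator A x \<partial>distr lborel borel (\<lambda>x. r + L x))"
      by simp
    also have "\<dots> = (\<integral>\<^sup>+x. indicator A (r + L x) \<partial>lborel)"
      by (subst nn_integral_distr) auto
    also have "\<dots> = ennreal c * (\<integral>\<^sup>+x. indicator A (r + x) \<partial>lborel)"
      by (rule nn[of "\<lambda>x. indicator A (r + x)"]) measurable
    also have "(\<integral>\<^sup>+x. indicator A (r + x) \<partial>lborel) = (\<integral>\<^sup>+x. indicator A x \<partial>distr lborel borel ((+) r))"
      by (subst nn_integral_distr) auto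
    also have "\<dots> = emeasure lborel A" by (simp add: lborel_distr_plus)
    also have "ennreal c * emeasure lborel A = emeasure (density lborel (\<lambda>_. ennreal c)) A"
      by (simp add: emeasure_density_const)
    finally show "emeasure (distr lborel borel (\<lambda>x. r + L x)) A = emeasure (density lborel (\<lambda>_. ennreal c)) A" .
  qed simp
  show ?thesis
  proof (intro exI[of _ "1 / c"] conjI ballI)
    fix g :: "'a \<Rightarrow> real" assume [measurable]: "g \<in> borel_measurable borel"
    have "(\<integral>x. g (r + L x) \<partial>lborel) = (\<integral>x. g x \<partial>distr lborel borel (\<lambda>x. r + L x))"
      by (subst integral_distr) auto
    also have "\<dots> = c * (\<integral>x. g x \<partial>lborel)"
      unfolding d using c by (subst integral_density) auto
    finally show "(\<integral>x. g x \<partial>lborel) = 1 / c * (\<integral>x. g (r + L x) \<partial>lborel)" using c by simp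
  qed (use c in simp)
qed
definition ref_simplex :: "(real^'d::finite) set" where
  "ref_simplex = {y. (\<forall>i. 0 \<le> y $ i) \<and> (\<Sum>i\<in>UNIV. y $ i) \<le> 1}"

lemma ref_simplex_bound:
  assumes "y \<in> ref_simplex" shows "0 \<le> y $ i" "y $ i \<le> 1"
proof -
  show "0 \<le> y $ i" using assms by (simp add: ref_simplex_def)
  have "y $ i \<le> (\<Sum>i\<in>UNIV. y $ i)"
    using assms by (intro member_le_sum) (auto simp: ref_simplex_def)
  then show "y $ i \<le> 1" using assms by (simp add: ref_simplex_def)
qed

lemma ref_simplex_compact: "compact (ref_simplex :: (real^'d::finite) set)"
  and ref_simplex_convex: "convex (ref_simplex :: (real^'d::finite) set)"
proof -
  have e: "ref_simplex = (\<Inter>i. {y::real^'d. 0 \<le> y $ i}) \<inter> {y. (\<Sum>i\<in>UNIV. y $ i) \<le> 1}"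
    by (auto simp: ref_simplex_def)
  have "closed (ref_simplex :: (real^'d) set)"
    unfolding e by (intro closed_Int closed_INT ballI closed_Collect_le continuous_intros)
  moreover have "bounded (ref_simplex :: (real^'d) set)"
    by (rule bounded_subset[OF bounded_cbox[of 0 1]])
       (auto simp: mem_box_cart ref_simplex_bound)
  ultimately show "compact (ref_simplex :: (real^'d) set)" by (simp add: compact_eq_bounded_closed)
  show "convex (ref_simplex :: (real^'d) set)"
  proof (rule convexI)
    fix x y :: "real^'d" and u v :: real
    assume a: "x \<in> ref_simplex" "y \<in> ref_simplex" "0 \<le> u" "0 \<le> v" "u + v = 1"
    have "(\<Sum>i\<in>UNIV. (u *\<^sub>R x + v *\<^sub>R y) $ i) = u * (\<Sum>i\<in>UNIV. x $ i) + v * (\<Sum>i\<in>UNIV. y $ i)"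
      by (simp add: sum.distrib sum_distrib_left)
    also have "\<dots> \<le> u * 1 + v * 1"
      using a by (intro add_mono mult_left_mono) (auto simp: ref_simplex_def)
    finally show "u *\<^sub>R x + v *\<^sub>R y \<in> ref_simplex" using a by (simp add: ref_simplex_def)
  qed
qed

text \<open>
  The integrand is \<open>\<partial>\<^sub>k H\<close> for \<open>H = (1 - \<Sum>\<^sub>i y\<^sub>i) G\<close>. A line in the direction of the \<open>k\<close>-th axis
  enters the simplex where \<open>y\<^sub>k = 0\<close> and leaves it where \<open>\<Sum>\<^sub>i y\<^sub>i = 1\<close>, and \<open>H\<close> vanishes at both
  places. Hence the extension \<open>X\<close> of \<open>H\<close> by zero is Lipschitz along such lines. The integral of
  each difference quotient of \<open>X\<close> is zero, because Lebesgue measure is translation invariant, and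
  the quotients converge boundedly to \<open>\<partial>\<^sub>k H\<close> off the boundary of the simplex.
\<close>

lemma ref_simplex_divergence:
  fixes G :: "real^'d::finite \<Rightarrow> real" and DG :: "real^'d \<Rightarrow> real^'d"
  assumes dG: "\<And>y. (G has_derivative (\<lambda>h. DG y \<bullet> h)) (at y)" and cDG: "continuous_on UNIV DG"
    and z: "\<And>y. y \<in> ref_simplex \<Longrightarrow> y $ k = 0 \<Longrightarrow> G y = 0"
  shows "(\<integral>y. indicator ref_simplex y *
      ((1 - (\<Sum>i\<in>UNIV. y $ i)) * (DG y \<bullet> axis k 1) - G y) \<partial>lborel) = 0"
proof -
  define e :: "real^'d" where "e = axis k 1"
  define S :: "(real^'d) set" where "S = ref_simplex"
  define l0 :: "real^'d \<Rightarrow> real" where "l0 y = 1 - (\<Sum>i\<in>UNIV. y $ i)" for y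
  define H where "H y = l0 y * G y" for y
  define H' where "H' y = l0 y * (DG y \<bullet> e) - G y" for y
  define X where "X y = indicator S y * H y" for y
  \<comment> \<open>the difference quotients of \<open>X\<close> with step \<open>1 / (n + 1)\<close>, which is at most \<open>1\<close>, so that
     their supports stay in one fixed cube\<close>
  define dq where "dq n y = (X (y + (1 / Suc n) *\<^sub>R e) - X y) * Suc n" for n :: nat and y
  have e_nth: "e $ i = (if i = k then 1 else 0)" for i by (simp add: e_def axis_def)
  have cpS: "compact S" and cvS: "convex S"
    unfolding S_def by (rule ref_simplex_compact ref_simplex_convex)+
  have l0_shift: "l0 (y + t *\<^sub>R e) = l0 y - t" for y t
    by (simp add: l0_def sum.distrib e_nth sum_distrib_left[symmetric] if_distrib[of "\<lambda>u. _ * u"] cong: if_cong)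
  have S_iff: "y \<in> S \<longleftrightarrow> (\<forall>i. 0 \<le> y $ i) \<and> 0 \<le> l0 y" for y
    by (simp add: S_def ref_simplex_def l0_def)
  have cG: "continuous_on UNIV G"
    using dG by (meson continuous_at_imp_continuous_on has_derivative_continuous)
  have cH: "continuous_on UNIV H" and cH': "continuous_on UNIV H'"
    unfolding H_def H'_def l0_def by (intro continuous_intros cG cDG)+
  have line: "((\<lambda>t. H (y + t *\<^sub>R e)) has_real_derivative H' (y + t *\<^sub>R e)) (at t)" for y t
  proof -
    have "((\<lambda>t. G (y + t *\<^sub>R e)) has_derivative (\<lambda>s. DG (y + t *\<^sub>R e) \<bullet> (s *\<^sub>R e))) (at t)"
      by (rule has_derivative_compose[of "\<lambda>t. y + t *\<^sub>R e" "\<lambda>s. s *\<^sub>R e" t UNIV G]) (auto intro!: derivative_eq_intros dG)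
    then have g: "((\<lambda>t. G (y + t *\<^sub>R e)) has_real_derivative DG (y + t *\<^sub>R e) \<bullet> e) (at t)"
      by (simp add: has_field_derivative_def mult.commute[of _ "DG (y + t *\<^sub>R e) \<bullet> e"])
    show ?thesis unfolding H_def H'_def l0_shift
      by (rule derivative_eq_intros g refl | simp add: algebra_simps)+
  qed
  have "bounded (H' ` S)"
    using cpS cH' by (intro compact_imp_bounded compact_continuous_image) (auto intro: continuous_on_subset)
  then obtain B where B: "B > 0" "\<And>y. y \<in> S \<Longrightarrow> \<bar>H' y\<bar> \<le> B"
    unfolding bounded_pos by auto
  have seg: "\<bar>H (y + t *\<^sub>R e) - H y\<bar> \<le> B * t" if "y \<in> S" "y + t *\<^sub>R e \<in> S" "0 \<le> t" for y t
  proof (cases "t = 0")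
    case False
    then have "0 < t" using that by simp
    from MVT2[OF this, of "\<lambda>t. H (y + t *\<^sub>R e)" "\<lambda>t. H' (y + t *\<^sub>R e)"] line
    obtain s where s: "0 < s" "s < t" "H (y + t *\<^sub>R e) - H y = t * H' (y + s *\<^sub>R e)" by auto
    have "y + s *\<^sub>R e \<in> S" using that s by (auto simp: S_iff e_nth l0_shift)
    then have "\<bar>t * H' (y + s *\<^sub>R e)\<bar> \<le> t * B"
      using B(2) \<open>0 < t\<close> by (simp add: abs_mult)
    then show ?thesis by (simp add: s(3) mult.commute)
  qed simp
  have lip: "\<bar>X (y + t *\<^sub>R e) - X y\<bar> \<le> B * t" if t: "0 < t" for y t
  proof (cases "y \<in> S"; cases "y + t *\<^sub>R e \<in> S")
    assume "y \<in> S" "y + t *\<^sub>R e \<in> S"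
    then show ?thesis using seg t by (simp add: X_def)
  next
    assume y: "y \<in> S" "y + t *\<^sub>R e \<notin> S"
    have "0 \<le> (y + t *\<^sub>R e) $ i" for i using y(1) t by (simp add: S_iff e_nth)
    then have l: "l0 y < t" using y(2) by (auto simp: S_iff l0_shift)
    \<comment> \<open>the exit point of the line through \<open>y\<close>\<close>
    have "y + l0 y *\<^sub>R e \<in> S" using y(1) by (auto simp: S_iff l0_shift e_nth)
    from seg[OF y(1) this] have "\<bar>H (y + l0 y *\<^sub>R e) - H y\<bar> \<le> B * l0 y" using y(1) by (simp add: S_iff)
    moreover have "H (y + l0 y *\<^sub>R e) = 0" by (simp add: H_def l0_shift)
    moreover have "B * l0 y \<le> B * t" using l B(1) by simp
    ultimately show ?thesis using y by (simp add: X_def)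
  next
    assume y: "y \<notin> S" "y + t *\<^sub>R e \<in> S"
    define s where "s = (y + t *\<^sub>R e) $ k"
    \<comment> \<open>the entry point of the line through \<open>y\<close>\<close>
    define y' where "y' = y + (t - s) *\<^sub>R e"
    have st: "y + t *\<^sub>R e = y' + s *\<^sub>R e" by (simp add: y'_def algebra_simps)
    have "\<not> t \<le> s"
    proof
      assume "t \<le> s"
      then have "0 \<le> y $ i" for i using y(2) by (cases "i = k") (auto simp: S_iff e_nth s_def dest!: spec[of _ i])
      moreover have "0 \<le> l0 y" using y(2) t by (simp add: S_iff l0_shift)
      ultimately show False using y(1) by (simp add: S_iff)
    qed
    have y'k: "y' $ k = 0" by (simp add: y'_def s_def e_nth)
    have s0: "0 \<le> s" using y(2) by (simp add: S_iff s_def del: vector_add_component)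
    have "0 \<le> y' $ i" for i
      using y(2) y'k by (cases "i = k") (auto simp: S_iff e_nth y'_def dest!: spec[of _ i])
    moreover have "0 \<le> l0 y'"
      using y(2) s0 unfolding st S_iff l0_shift by simp
    ultimately have y'S: "y' \<in> S" by (simp add: S_iff)
    have "\<bar>H (y' + s *\<^sub>R e) - H y'\<bar> \<le> B * s" using seg y'S y(2) s0 unfolding st by simp
    moreover have "H y' = 0" using z[of y'] y'S y'k by (simp add: H_def S_def)
    moreover have "B * s \<le> B * t" using \<open>\<not> t \<le> s\<close> B(1) by simp
    ultimately show ?thesis using y(1) y(2) unfolding st by (simp add: X_def)
  next
    assume "y \<notin> S" "y + t *\<^sub>R e \<notin> S"
    then show ?thesis using t B by (simp add: X_def)
  qed
  have [measurable]: "S \<in> sets borel" using cpS by (simp add: borel_compact)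
  have [measurable]: "H \<in> borel_measurable borel" "H' \<in> borel_measurable borel"
    using cH cH' by (auto intro: borel_measurable_continuous_onI)
  have [measurable]: "X \<in> borel_measurable borel" unfolding X_def by measurable
  have iX: "integrable lborel X"
    unfolding X_def using borel_integrable_compact[OF cpS, of H] cH
    by (auto intro: continuous_on_subset simp: set_integrable_def mult.commute indicator_def if_distrib cong: if_cong)
  have dq0: "(\<integral>y. dq n y \<partial>lborel) = 0" and dqm [measurable]: "dq n \<in> borel_measurable borel" for n
  proof -
    let ?a = "(1 / Suc n) *\<^sub>R e"
    have i: "integrable lborel (\<lambda>y. X (y + ?a))" and eq: "(\<integral>y. X (y + ?a) \<partial>lborel) = (\<integral>y. X y \<partial>lborel)"
      using iX integrable_distr_eq[of "(+) ?a" lborel borel X] integral_distr[of "(+) ?a" lborel borel X]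
      by (auto simp: lborel_distr_plus add.commute)
    then show "(\<integral>y. dq n y \<partial>lborel) = 0" using iX i unfolding dq_def by simp
    show "dq n \<in> borel_measurable borel" unfolding dq_def by measurable
  qed
  have "(\<lambda>n. \<integral>y. dq n y \<partial>lborel) \<longlonglongrightarrow> (\<integral>y. indicator S y * H' y \<partial>lborel)"
  proof (rule integral_dominated_convergence[where w = "\<lambda>y. B * indicator (cbox (- 1) 1) y"])
    show "integrable lborel (\<lambda>y. B * indicator (cbox (- 1) (1::real^'d)) y)"
      by (intro integrable_mult_right integrable_real_indicator) (auto simp: emeasure_compact_finite[unfolded infinity_ennreal_def top_ennreal_def[symmetric]] less_top[symmetric] emeasure_lborel_cbox_eq)
    show "AE y in lborel. norm (dq n y) \<le> B * indicator (cbox (- 1) 1) y" for n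
    proof (rule AE_I2)
      fix y
      define t where "t = 1 / real (Suc n)"
      have t: "0 < t" "t \<le> 1" "t * Suc n = 1" by (auto simp: t_def)
      have dq: "dq n y = (X (y + t *\<^sub>R e) - X y) * Suc n" by (simp add: dq_def t_def)
      show "norm (dq n y) \<le> B * indicator (cbox (- 1) 1) y"
      proof (cases "y \<in> cbox (- 1) 1")
        case True
        have "\<bar>X (y + t *\<^sub>R e) - X y\<bar> * Suc n \<le> B * t * Suc n"
          by (intro mult_right_mono lip t) auto
        also have "\<dots> = B" using t(3) by (metis mult.assoc mult.right_neutral)
        finally show ?thesis using True by (simp add: dq abs_mult)
      next
        case False
        then obtain i where i: "\<not> (- 1 \<le> y $ i \<and> y $ i \<le> 1)" by (auto simp: mem_box_cart)
        have "y \<notin> S" using i ref_simplex_bound[of y i] by (auto simp: S_def)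
        moreover have "y + t *\<^sub>R e \<notin> S"
        proof
          assume "y + t *\<^sub>R e \<in> S"
          then have "0 \<le> (y + t *\<^sub>R e) $ i" "(y + t *\<^sub>R e) $ i \<le> 1"
            unfolding S_def by (rule ref_simplex_bound)+
          then show False using i t by (simp add: e_nth split: if_splits)
        qed
        ultimately show ?thesis using False by (simp add: dq X_def)
      qed
    qed
    show "AE y in lborel. (\<lambda>n. dq n y) \<longlonglongrightarrow> indicator S y * H' y"
    proof (rule AE_I')
      show "frontier S \<in> null_sets lborel"
        using negligible_convex_frontier[OF cvS] cpS
        by (simp add: negligible_iff_null_sets null_sets_completion_iff compact_imp_closed borel_closed)
      show "{y \<in> space lborel. \<not> (\<lambda>n. dq n y) \<longlonglongrightarrow> indicator S y * H' y} \<subseteq> frontier S"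
      proof (rule subsetI, rule ccontr)
        fix y assume y: "y \<in> {y \<in> space lborel. \<not> (\<lambda>n. dq n y) \<longlonglongrightarrow> indicator S y * H' y}" "y \<notin> frontier S"
        have t0: "(\<lambda>n. 1 / real (Suc n)) \<longlonglongrightarrow> 0" using LIMSEQ_inverse_real_of_nat by (simp add: inverse_eq_divide)
        then have "(\<lambda>n. y + (1 / real (Suc n)) *\<^sub>R e) \<longlonglongrightarrow> y + 0 *\<^sub>R e" by (intro tendsto_intros)
        then have lim: "(\<lambda>n. y + (1 / real (Suc n)) *\<^sub>R e) \<longlonglongrightarrow> y" by simp
        show False
        proof (cases "y \<in> S")
          case True
          then have "y \<in> interior S" using y(2) cpS by (simp add: frontier_def compact_imp_closed)
          then have "\<forall>\<^sub>F n in sequentially. y + (1 / real (Suc n)) *\<^sub>R e \<in> interior S"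
            using lim open_interior topological_tendstoD by blast
          then have "\<forall>\<^sub>F n in sequentially. (H (y + (1 / real (Suc n)) *\<^sub>R e) - H y) / (1 / real (Suc n)) = dq n y"
            by eventually_elim (use True interior_subset[of S] in \<open>auto simp: dq_def X_def field_simps\<close>)
          moreover have "(\<lambda>n. (H (y + (1 / real (Suc n)) *\<^sub>R e) - H y) / (1 / real (Suc n))) \<longlonglongrightarrow> H' y"
          proof (rule filterlim_compose[of "\<lambda>t. (H (y + t *\<^sub>R e) - H y) / t" _ "at 0"])
            show "((\<lambda>t. (H (y + t *\<^sub>R e) - H y) / t) \<longlongrightarrow> H' y) (at 0)"
              using line[of y 0] by (simp add: DERIV_def)
            show "filterlim (\<lambda>n. 1 / real (Suc n)) (at 0) sequentially"
              using t0 by (auto simp: filterlim_at simp del: of_nat_Suc)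
          qed
          ultimately have "(\<lambda>n. dq n y) \<longlonglongrightarrow> H' y" by (rule Lim_transform_eventually[rotated])
          then show False using y(1) True by simp
        next
          case False
          then have "y \<in> - S" by simp
          then have "\<forall>\<^sub>F n in sequentially. y + (1 / real (Suc n)) *\<^sub>R e \<in> - S"
            using lim cpS topological_tendstoD[OF lim, of "- S"] by (auto simp: compact_imp_closed open_Compl)
          then have "\<forall>\<^sub>F n in sequentially. 0 = dq n y"
            by eventually_elim (use False in \<open>auto simp: dq_def X_def\<close>)
          then have "(\<lambda>n. dq n y) \<longlonglongrightarrow> 0" by (rule Lim_transform_eventually[OF tendsto_const])
          then show False using y(1) False by simp
        qed
      qed
    qed
  qed measurable
  then have "(\<integral>y. indicator S y * H' y \<partial>lborel) = 0" unfolding dq0 by (simp add: LIMSEQ_const_iff)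
  then show ?thesis by (simp add: S_def H'_def l0_def e_def)
qed

section \<open>Fluxes through the facets of an element\<close>

text \<open>
  The affine map of the reference simplex onto the element with vertices \<open>r\<close> and \<open>b i\<close>. It takes
  the face \<open>y\<^sub>k = 0\<close> to the facet opposite \<open>b k\<close>, in a way that does not depend on \<open>b k\<close>.
\<close>

definition elem_map :: "real^'d \<Rightarrow> ('d \<Rightarrow> real^'d) \<Rightarrow> real^'d \<Rightarrow> real^'d::finite" where
  "elem_map r b y = r + (\<Sum>i\<in>UNIV. y $ i *\<^sub>R (b i - r))"

lemma elem_map_bary:
  assumes V: "affine_frame V" and r: "r \<in> V" and b: "bij_betw b UNIV (V - {r})"
  shows "bary V (b i) (elem_map r b y) = y $ i"
    and "bary V r (elem_map r b y) = 1 - (\<Sum>i\<in>UNIV. y $ i)"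
proof -
  have bV: "b i \<in> V" "b i \<noteq> r" for i using b by (auto simp: bij_betw_def)
  have inj: "b i = b j \<longleftrightarrow> i = j" for i j using b by (auto simp: bij_betw_def inj_def)
  have s: "bary V q (elem_map r b y) = bary V q r + (\<Sum>i\<in>UNIV. y $ i * (bary_grad V q \<bullet> (b i - r)))" for q
    by (subst bary_diff[of V q _ r]) (simp add: elem_map_def inner_sum_right)
  show "bary V (b i) (elem_map r b y) = y $ i"
    unfolding s using bV[of i] by (simp add: bary_vertex[OF V] bary_grad_vertex[OF V] r bV inj if_distrib[of "\<lambda>u. _ * u"] cong: if_cong)
  show "bary V r (elem_map r b y) = 1 - (\<Sum>i\<in>UNIV. y $ i)"
    unfolding s using bV by (simp add: bary_vertex[OF V] bary_grad_vertex[OF V] r bV bV(2)[symmetric] sum_negf)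
qed

lemma elem_map_mem:
  assumes V: "affine_frame V" and r: "r \<in> V" and b: "bij_betw b UNIV (V - {r})"
  shows "elem_map r b y \<in> convex hull V \<longleftrightarrow> y \<in> ref_simplex"
proof -
  have "V = insert r (range b)" using b r by (auto simp: bij_betw_def)
  then have "(\<forall>q\<in>V. P q) \<longleftrightarrow> P r \<and> (\<forall>i. P (b i))" for P by auto
  then show ?thesis
    unfolding bary_mem_hull[OF V] ref_simplex_def by (auto simp: elem_map_bary[OF V r b])
qed

text \<open>
  The modulus of the determinant of the linear part of the element map.
\<close>

definition elem_scale :: "real^'d \<Rightarrow> ('d \<Rightarrow> real^'d) \<Rightarrow> real" where
  "elem_scale r (b :: 'd::finite \<Rightarrow> real^'d) = (SOME D. D > 0 \<and> (\<forall>g \<in> borel_measurable borel.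
     (\<integral>x. g x \<partial>lborel) = D * (\<integral>y. g (elem_map r b y) \<partial>lborel)))"

lemma
  assumes V: "affine_frame V" and r: "r \<in> V" and b: "bij_betw b UNIV (V - {r})"
  shows elem_scale_pos: "elem_scale r b > 0"
    and elem_scale: "g \<in> borel_measurable borel \<Longrightarrow>
      (\<integral>x. indicator (convex hull V) x * g x \<partial>lborel) =
       elem_scale r b * (\<integral>y. indicator ref_simplex y * g (elem_map r b y) \<partial>lborel)"
proof -
  define L where "L y = (\<Sum>i\<in>UNIV. y $ i *\<^sub>R (b i - r))" for y
  have lin: "linear L" unfolding L_def
    by (intro linear_compose_sum ballI) (auto intro!: linearI simp: scaleR_left_distrib)
  have "inj L"
  proof (rule injI)
    fix x y assume "L x = L y"
    then have "elem_map r b x = elem_map r b y" by (simp add: elem_map_def L_def)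
    then show "x = y" by (metis elem_map_bary(1)[OF V r b] vec_eq_iff)
  qed
  then have bij: "bij L" using lin linear_injective_imp_surjective bij_def by blast
  have eq: "elem_map r b y = r + L y" for y by (simp add: elem_map_def L_def)
  have ex: "\<exists>D::real. D > 0 \<and> (\<forall>g \<in> borel_measurable borel.
     (\<integral>x. g x \<partial>lborel) = D * (\<integral>y. g (elem_map r b y) \<partial>lborel))"
    unfolding eq by (rule lebesgue_integral_affine_image[OF lin bij])
  show "elem_scale r b > 0" using someI_ex[OF ex] unfolding elem_scale_def by blast
  assume g: "g \<in> borel_measurable borel"
  have "compact (convex hull V)"
    using affine_frame_finite[OF V] by (simp add: compact_convex_hull finite_imp_compact)
  then have "(\<lambda>x. indicator (convex hull V) x * g x) \<in> borel_measurable borel"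
    using g by (intro borel_measurable_times borel_measurable_indicator) (auto simp: borel_compact)
  then have "(\<integral>x. indicator (convex hull V) x * g x \<partial>lborel) = elem_scale r b *
      (\<integral>y. indicator (convex hull V) (elem_map r b y) * g (elem_map r b y) \<partial>lborel)"
    using someI_ex[OF ex] unfolding elem_scale_def by blast
  then show "(\<integral>x. indicator (convex hull V) x * g x \<partial>lborel) =
       elem_scale r b * (\<integral>y. indicator ref_simplex y * g (elem_map r b y) \<partial>lborel)"
    by (simp add: indicator_def elem_map_mem[OF V r b])
qed

definition ref_volume :: "'d::finite itself \<Rightarrow> real" where
  "ref_volume _ = (\<integral>y. indicator (ref_simplex :: (real^'d) set) y \<partial>lborel)"

text \<open>
  By affine invariance, the mean of every barycentric coordinate over every element is the
  quotient of this moment and the reference volume.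
\<close>

definition ref_moment :: "'d::finite itself \<Rightarrow> real" where
  "ref_moment _ = (\<integral>y. indicator (ref_simplex :: (real^'d) set) y * (1 - (\<Sum>i\<in>UNIV. y $ i)) \<partial>lborel)"

lemma ref_integrable:
  assumes "continuous_on UNIV (f :: real^'d::finite \<Rightarrow> real)"
  shows "integrable lborel (\<lambda>y. indicator ref_simplex y * f y)"
  using borel_integrable_compact[OF ref_simplex_compact, of f] assms
  by (auto intro: continuous_on_subset simp: set_integrable_def mult.commute indicator_def if_distrib cong: if_cong)

lemma ref_moment_pos: "ref_moment TYPE('d::finite) > 0"
proof -
  define c where "c = 1 / (2 * real CARD('d))"
  have c: "c > 0" by (simp add: c_def)
  \<comment> \<open>a cube so small that the coordinates of its points sum up to at most \<open>1/2\<close>\<close>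
  define Q :: "(real^'d) set" where "Q = cbox 0 (vec c)"
  have Q: "y \<in> ref_simplex \<and> (\<Sum>i\<in>UNIV. y $ i) \<le> 1 / 2" if "y \<in> Q" for y
  proof -
    have "(\<Sum>i\<in>UNIV. y $ i) \<le> (\<Sum>i\<in>(UNIV::'d set). c)"
      using that by (intro sum_mono) (auto simp: Q_def mem_box_cart)
    also have "\<dots> = 1 / 2" by (simp add: c_def)
    finally show ?thesis using that by (auto simp: Q_def mem_box_cart ref_simplex_def)
  qed
  have "0 < measure lborel Q"
    unfolding Q_def by (rule content_pos_lt) (use c in \<open>auto simp: Basis_vec_def inner_axis\<close>)
  also have "measure lborel Q = 2 * (\<integral>y. indicator Q y * (1 / 2) \<partial>lborel)" by (simp add: Q_def)
  also have "(\<integral>y. indicator Q y * (1 / 2) \<partial>lborel) \<le> ref_moment TYPE('d)"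
    unfolding ref_moment_def
  proof (rule integral_mono)
    show "integrable lborel (\<lambda>y. indicator Q y * (1 / 2 :: real))"
      unfolding Q_def by (intro integrable_mult_left integrable_real_indicator) (auto simp: emeasure_compact_finite[unfolded infinity_ennreal_def top_ennreal_def[symmetric]] less_top[symmetric] emeasure_lborel_cbox_eq)
    show "integrable lborel (\<lambda>y::real^'d. indicator ref_simplex y * (1 - (\<Sum>i\<in>UNIV. y $ i)))"
      by (intro ref_integrable continuous_intros)
    show "indicator Q y * (1 / 2) \<le> indicator ref_simplex y * (1 - (\<Sum>i\<in>UNIV. y $ i))" for y
      using Q[of y] by (auto simp: indicator_def ref_simplex_def)
  qed
  finally show ?thesis by simp
qed

lemma ref_volume_pos: "ref_volume TYPE('d::finite) > 0"
proof -
  have "ref_moment TYPE('d) \<le> ref_volume TYPE('d)"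
    unfolding ref_moment_def ref_volume_def
  proof (rule integral_mono)
    show "integrable lborel (\<lambda>y::real^'d. indicator ref_simplex y * (1 - (\<Sum>i\<in>UNIV. y $ i)))"
      by (intro ref_integrable continuous_intros)
    show "integrable lborel (indicator ref_simplex :: real^'d \<Rightarrow> real)"
      using ref_integrable[of "\<lambda>_. 1"] by simp
    show "indicator ref_simplex y * (1 - (\<Sum>i\<in>UNIV. y $ i)) \<le> (indicator ref_simplex y :: real)" for y :: "real^'d"
      by (auto simp: indicator_def ref_simplex_def intro!: sum_nonneg)
  qed
  then show ?thesis using ref_moment_pos[where 'd='d] by simp
qed

lemma element_volume:
  fixes V :: "(real^'d::finite) set"
  assumes V: "affine_frame V" and r: "r \<in> V" and b: "bij_betw b UNIV (V - {r})"
  shows "(\<integral>x. indicator (convex hull V) x \<partial>lborel) = elem_scale r b * ref_volume TYPE('d)"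
  using elem_scale(1)[OF V r b, of "\<lambda>_. 1"] by (simp add: ref_volume_def)

lemma element_moment:
  fixes V :: "(real^'d::finite) set"
  assumes V: "affine_frame V" and r: "r \<in> V" and b: "bij_betw b UNIV (V - {r})"
  shows "(\<integral>x. indicator (convex hull V) x * bary V r x \<partial>lborel) = elem_scale r b * ref_moment TYPE('d)"
  using elem_scale(1)[OF V r b, of "bary V r"]
  by (simp add: ref_moment_def elem_map_bary[OF V r b] borel_measurable_continuous_onI continuous_bary)

text \<open>
  Since \<open>\<lambda>\<^sub>r\<close> decreases at unit rate along the edge from \<open>r\<close> to \<open>p\<close>, the integrand is the
  derivative of \<open>\<lambda>\<^sub>r f\<close> in the direction \<open>p - r\<close>, if \<open>Df\<close> is the gradient of \<open>f\<close>. The integral is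
  therefore the boundary integral of \<open>\<lambda>\<^sub>r f (p - r) \<cdot> n\<close>, to which only the facet opposite \<open>p\<close>
  contributes.
\<close>

definition element_flux ::
    "(real^'d::finite) set \<Rightarrow> real^'d \<Rightarrow> real^'d \<Rightarrow> (real^'d \<Rightarrow> real) \<Rightarrow> (real^'d \<Rightarrow> real^'d) \<Rightarrow> real" where
  "element_flux V r p f Df =
     (\<integral>x. indicator (convex hull V) x * (bary V r x * (Df x \<bullet> (p - r)) - f x) \<partial>lborel)"

lemma elem_map_continuous: "continuous_on UNIV (elem_map r b)"
  unfolding elem_map_def by (intro continuous_intros)

lemma element_flux_ref:
  assumes V: "affine_frame V" and r: "r \<in> V" and b: "bij_betw b UNIV (V - {r})"
    and cf: "continuous_on UNIV f" and cDf: "continuous_on UNIV Df"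
  shows "element_flux V r p f Df = elem_scale r b * (\<integral>y. indicator ref_simplex y *
      ((1 - (\<Sum>i\<in>UNIV. y $ i)) * (Df (elem_map r b y) \<bullet> (p - r)) - f (elem_map r b y)) \<partial>lborel)"
  unfolding element_flux_def
  by (subst elem_scale[OF V r b])
     (auto simp: elem_map_bary[OF V r b] intro!: borel_measurable_continuous_onI continuous_intros cf cDf)

lemma elem_map_derivative:
  fixes Df :: "real^'d::finite \<Rightarrow> real^'d"
  assumes df: "\<And>x. (f has_derivative (\<lambda>h. Df x \<bullet> h)) (at x)"
  shows "((\<lambda>y. f (elem_map r b y)) has_derivative
     (\<lambda>h. (\<chi> i. Df (elem_map r b y) \<bullet> (b i - r)) \<bullet> h)) (at y)"
proof -
  have 1: "(elem_map r b has_derivative (\<lambda>h. \<Sum>i\<in>UNIV. h $ i *\<^sub>R (b i - r))) (at y)"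
    unfolding elem_map_def by (auto intro!: derivative_eq_intros bounded_linear_imp_has_derivative bounded_linear_vec_nth)
  have "((\<lambda>y. f (elem_map r b y)) has_derivative
     (\<lambda>h. Df (elem_map r b y) \<bullet> (\<Sum>i\<in>UNIV. h $ i *\<^sub>R (b i - r)))) (at y)"
    using has_derivative_compose[OF 1 df] by simp
  moreover have "Df (elem_map r b y) \<bullet> (\<Sum>i\<in>UNIV. h $ i *\<^sub>R (b i - r)) =
      (\<chi> i. Df (elem_map r b y) \<bullet> (b i - r)) \<bullet> h" for h
    by (simp add: inner_sum_right inner_vec_def[of _ h] mult.commute)
  ultimately show ?thesis by simp
qed

text \<open>
  The two element maps agree on the face \<open>y\<^sub>k = 0\<close> of the reference simplex, which is mapped to
  the common facet. The difference of the two pull-backs of \<open>f\<close> vanishes there, and the divergence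
  identity applies to it.
\<close>

lemma element_flux_interior:
  fixes V V' :: "(real^'d::finite) set"
  assumes V: "affine_frame V" and r: "r \<in> V" and b: "bij_betw b UNIV (V - {r})"
    and V': "affine_frame V'" and r': "r \<in> V'" and b': "bij_betw b' UNIV (V' - {r})"
    and bb': "\<And>i. i \<noteq> k \<Longrightarrow> b' i = b i"
    and df: "\<And>x. (f has_derivative (\<lambda>h. Df x \<bullet> h)) (at x)" and cDf: "continuous_on UNIV Df"
  shows "element_flux V r (b k) f Df / elem_scale r b = element_flux V' r (b' k) f Df / elem_scale r b'"
proof -
  let ?\<Phi> = "elem_map r b" and ?\<Phi>' = "elem_map r b'"
  let ?l = "\<lambda>y::real^'d. 1 - (\<Sum>i\<in>UNIV. y $ i)"
  let ?g = "\<lambda>\<Phi> b y. ?l y * (Df (\<Phi> y) \<bullet> (b k - r)) - f (\<Phi> y)"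
  let ?DG = "\<lambda>y. (\<chi> i. Df (?\<Phi> y) \<bullet> (b i - r)) - (\<chi> i. Df (?\<Phi>' y) \<bullet> (b' i - r))"
  have cf: "continuous_on UNIV f"
    using df by (meson continuous_at_imp_continuous_on has_derivative_continuous)
  have cc: "continuous_on UNIV (\<lambda>y. f (elem_map r c y))" "continuous_on UNIV (\<lambda>y. Df (elem_map r c y))" for c
    by (rule continuous_on_compose2[OF cf elem_map_continuous] continuous_on_compose2[OF cDf elem_map_continuous], simp)+
  have i: "integrable lborel (\<lambda>y. indicator ref_simplex y * ?g (elem_map r c) c y)" for c
    by (intro ref_integrable continuous_intros cc)
  have "(\<integral>y. indicator ref_simplex y * (?l y *
      (?DG y \<bullet> axis k 1) - (f (?\<Phi> y) - f (?\<Phi>' y))) \<partial>lborel) = 0"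
  proof (rule ref_simplex_divergence)
    show "((\<lambda>y. f (?\<Phi> y) - f (?\<Phi>' y)) has_derivative
       (\<lambda>h. ?DG y \<bullet> h)) (at y)" for y
      unfolding inner_diff_left by (intro has_derivative_diff elem_map_derivative df)
    show "continuous_on UNIV ?DG"
      by (intro continuous_intros cc)
    fix y :: "real^'d" assume "y $ k = 0"
    then have "y $ i *\<^sub>R (b i - r) = y $ i *\<^sub>R (b' i - r)" for i
      using bb'[of i] by (cases "i = k") auto
    then have "?\<Phi> y = ?\<Phi>' y" unfolding elem_map_def by (intro arg_cong2[of _ _ _ _ "(+)"] sum.cong refl)
    then show "f (?\<Phi> y) - f (?\<Phi>' y) = 0" by simp
  qed
  also have "(\<integral>y. indicator ref_simplex y * (?l y *
      (?DG y \<bullet> axis k 1) - (f (?\<Phi> y) - f (?\<Phi>' y))) \<partial>lborel)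
    = (\<integral>y. indicator ref_simplex y * ?g ?\<Phi> b y - indicator ref_simplex y * ?g ?\<Phi>' b' y \<partial>lborel)"
    by (intro Bochner_Integration.integral_cong refl) (simp add: inner_axis algebra_simps)
  also have "\<dots> = (\<integral>y. indicator ref_simplex y * ?g ?\<Phi> b y \<partial>lborel) - (\<integral>y. indicator ref_simplex y * ?g ?\<Phi>' b' y \<partial>lborel)"
    by (intro Bochner_Integration.integral_diff i)
  finally show ?thesis
    using elem_scale_pos[OF V r b] elem_scale_pos[OF V' r' b']
    by (simp add: element_flux_ref[OF V r b cf cDf] element_flux_ref[OF V' r' b' cf cDf])
qed

lemma element_flux_boundary:
  fixes V :: "(real^'d::finite) set"
    and b :: "'d \<Rightarrow> real^'d"
  assumes V: "affine_frame V" and r: "r \<in> V" and b: "bij_betw b UNIV (V - {r})"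
    and df: "\<And>x. (f has_derivative (\<lambda>h. Df x \<bullet> h)) (at x)" and cDf: "continuous_on UNIV Df"
    and z: "\<And>x. x \<in> convex hull (V - {b k}) \<Longrightarrow> f x = 0"
  shows "element_flux V r (b k) f Df = 0"
proof -
  have cf: "continuous_on UNIV f"
    using df by (meson continuous_at_imp_continuous_on has_derivative_continuous)
  have cc: "continuous_on UNIV (\<lambda>y. Df (elem_map r c y))" for c
    by (rule continuous_on_compose2[OF cDf elem_map_continuous]) simp
  have bk: "b k \<in> V" using b by (auto simp: bij_betw_def)
  have "(\<integral>y. indicator ref_simplex y * ((1 - (\<Sum>i\<in>UNIV. y $ i)) *
      ((\<chi> i. Df (elem_map r b y) \<bullet> (b i - r)) \<bullet> axis k 1) - f (elem_map r b y)) \<partial>lborel) = 0"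
  proof (rule ref_simplex_divergence)
    show "((\<lambda>y. f (elem_map r b y)) has_derivative
       (\<lambda>h. (\<chi> i. Df (elem_map r b y) \<bullet> (b i - r)) \<bullet> h)) (at y)" for y
      by (intro elem_map_derivative df)
    show "continuous_on UNIV (\<lambda>y. (\<chi> i. Df (elem_map r b y) \<bullet> (b i - r)))"
      by (intro continuous_intros cc)
    fix y :: "real^'d" assume "y \<in> ref_simplex" "y $ k = 0"
    then show "f (elem_map r b y) = 0"
      by (intro z) (simp add: bary_mem_facet[OF V bk] elem_map_mem[OF V r b] elem_map_bary[OF V r b])
  qed
  then show ?thesis by (simp add: element_flux_ref[OF V r b cf cDf] inner_axis)
qed

section \<open>Continuously differentiable test fields\<close>

lemma C1_field_derivative:
  assumes "C1_field w"
  shows "(w has_derivative (\<lambda>h. jacobian w (at x) *v h)) (at x)"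
  using assms by (simp add: C1_field_def jacobian_works)

lemma C1_field_continuous: "C1_field w \<Longrightarrow> continuous_on S w"
  by (meson C1_field_derivative continuous_at_imp_continuous_on has_derivative_continuous)

lemma C1_fieldI:
  fixes w :: "real^'d::finite \<Rightarrow> real^'d"
  assumes d: "\<And>x. (w has_derivative (\<lambda>h. M x *v h)) (at x)" and c: "continuous_on UNIV M"
  shows "C1_field w" "jacobian w (at x) = M x"
proof -
  show j: "jacobian w (at x) = M x" for x
    unfolding jacobian_def frechet_derivative_at[OF d, symmetric] by (rule matrix_of_matrix_vector_mul)
  show "C1_field w"
    unfolding C1_field_def j using d c by (auto simp: differentiable_def)
qed

lemma C1_field_const: "C1_field (\<lambda>x. c :: real^'d::finite)"
  by (rule C1_fieldI(1)[of _ "\<lambda>_. 0"]) simp_all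

definition C1_scalar :: "(real^'d::finite \<Rightarrow> real) \<Rightarrow> bool" where
  "C1_scalar f \<longleftrightarrow> (\<exists>Df. (\<forall>x. (f has_derivative (\<lambda>h. Df x \<bullet> h)) (at x)) \<and> continuous_on UNIV Df)"

lemma C1_scalar_mult:
  assumes "C1_scalar f" "C1_scalar g"
  shows "C1_scalar (\<lambda>x. f x * g x)"
proof -
  obtain Df Dg where d: "\<And>x. (f has_derivative (\<lambda>h. Df x \<bullet> h)) (at x)" "continuous_on UNIV Df"
    "\<And>x. (g has_derivative (\<lambda>h. Dg x \<bullet> h)) (at x)" "continuous_on UNIV Dg"
    using assms unfolding C1_scalar_def by blast
  have c: "continuous_on UNIV f" "continuous_on UNIV g"
    using d(1,3) by (meson continuous_at_imp_continuous_on has_derivative_continuous)+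
  show ?thesis unfolding C1_scalar_def
  proof (intro exI[of _ "\<lambda>x. f x *\<^sub>R Dg x + g x *\<^sub>R Df x"] conjI allI)
    show "((\<lambda>x. f x * g x) has_derivative (\<lambda>h. (f x *\<^sub>R Dg x + g x *\<^sub>R Df x) \<bullet> h)) (at x)" for x
      using has_derivative_mult[OF d(1)[of x] d(3)[of x]] by (simp add: inner_simps mult.commute)
  qed (intro continuous_intros c d)
qed

lemma C1_scalar_prod:
  assumes "\<And>q. q \<in> V \<Longrightarrow> C1_scalar (f q)"
  shows "C1_scalar (\<lambda>x. \<Prod>q\<in>V. f q x)"
  using assms
proof (induction V rule: infinite_finite_induct)
  case (insert q V)
  then show ?case by (simp add: C1_scalar_mult)
qed (auto simp: C1_scalar_def intro!: exI[of _ "\<lambda>_. 0"] has_derivative_eq_rhs[OF has_derivative_const])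

lemma C1_field_scaleR:
  fixes w :: "real^'d::finite \<Rightarrow> real^'d"
  assumes "C1_scalar f" and w: "C1_field w"
  shows "C1_field (\<lambda>x. f x *\<^sub>R w x)"
proof -
  obtain Df where d: "\<And>x. (f has_derivative (\<lambda>h. Df x \<bullet> h)) (at x)" "continuous_on UNIV Df"
    using assms unfolding C1_scalar_def by blast
  have c: "continuous_on UNIV f" "continuous_on UNIV w" "continuous_on UNIV (\<lambda>x. jacobian w (at x))"
    using d(1) w C1_field_continuous[OF w] unfolding C1_field_def
    by (auto intro!: continuous_at_imp_continuous_on dest: has_derivative_continuous)
  show ?thesis
  proof (rule C1_fieldI(1))
    show "((\<lambda>x. f x *\<^sub>R w x) has_derivative
        (\<lambda>h. (f x *\<^sub>R jacobian w (at x) + (\<chi> i j. w x $ i * Df x $ j)) *v h)) (at x)" for x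
    proof -
      have "(\<chi> i j. w x $ i * Df x $ j) *v h = (Df x \<bullet> h) *\<^sub>R w x" for h
        by (simp add: matrix_vector_mult_def vec_eq_iff inner_vec_def sum_distrib_left sum_distrib_right ac_simps)
      then show ?thesis
        using has_derivative_scaleR[OF d(1)[of x] C1_field_derivative[OF w, of x]]
        by (simp add: matrix_vector_mult_add_rdistrib scaleR_matrix_vector_assoc)
    qed
    show "continuous_on UNIV (\<lambda>x. f x *\<^sub>R jacobian w (at x) + (\<chi> i j. w x $ i * Df x $ j))"
      by (intro continuous_intros c d)
  qed
qed

text \<open>
  A continuously differentiable step: zero up to \<open>1\<close>, and tending to \<open>1\<close> at infinity.
\<close>

definition ramp :: "real \<Rightarrow> real" where
  "ramp t = (max 0 (t - 1))\<^sup>2 / (1 + (max 0 (t - 1))\<^sup>2)"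

lemma ramp_range: "0 \<le> ramp t" "ramp t \<le> 1" and ramp_eq_0: "t \<le> 1 \<Longrightarrow> ramp t = 0"
  by (auto simp: ramp_def divide_le_eq_1 add_pos_nonneg)

lemma ramp_tendsto: "(ramp \<longlongrightarrow> 1) at_top"
proof -
  have "((\<lambda>t. (t - 1)\<^sup>2 / (1 + (t - 1)\<^sup>2)) \<longlongrightarrow> (1::real)) at_top" by real_asymp
  moreover have "\<forall>\<^sub>F t in at_top. (t - 1)\<^sup>2 / (1 + (t - 1)\<^sup>2) = ramp t"
    using eventually_ge_at_top[of 1] by eventually_elim (simp add: ramp_def)
  ultimately show ?thesis by (rule Lim_transform_eventually)
qed

text \<open>
  The increments differ from their linearization by at most \<open>h\<^sup>2\<close>, also across the kink.
\<close>

lemma has_derivative_square_max: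
  "((\<lambda>t. (max 0 (t - 1))\<^sup>2) has_real_derivative 2 * max 0 (t - 1)) (at t)" for t :: real
proof -
  have "((\<lambda>h. ((max 0 (t + h - 1))\<^sup>2 - (max 0 (t - 1))\<^sup>2) / h - 2 * max 0 (t - 1)) \<longlongrightarrow> 0) (at 0)"
  proof (rule Lim_null_comparison)
    have "norm (((max 0 (t + h - 1))\<^sup>2 - (max 0 (t - 1))\<^sup>2) / h - 2 * max 0 (t - 1)) \<le> \<bar>h\<bar>" if "h \<noteq> 0" for h
    proof -
      define a where "a = t - 1"
      have "\<bar>(max 0 (a + h))\<^sup>2 - (max 0 a)\<^sup>2 - 2 * max 0 a * h\<bar> \<le> h\<^sup>2"
      proof (cases "0 \<le> a"; cases "0 \<le> a + h")
        assume "0 \<le> a" "0 \<le> a + h"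
        then show ?thesis by (simp add: power2_eq_square algebra_simps)
      next
        assume a: "0 \<le> a" "\<not> 0 \<le> a + h"
        then have "0 \<le> a * (- h - (a + h))" by (intro mult_nonneg_nonneg) auto
        moreover have "0 \<le> (a + h)\<^sup>2" by simp
        ultimately show ?thesis using a by (simp add: power2_eq_square algebra_simps abs_le_iff)
      next
        assume a: "\<not> 0 \<le> a" "0 \<le> a + h"
        then have "(a + h)\<^sup>2 \<le> h\<^sup>2" by (intro power_mono) auto
        then show ?thesis using a by simp
      qed auto
      then have "\<bar>(max 0 (a + h))\<^sup>2 - (max 0 a)\<^sup>2 - 2 * max 0 a * h\<bar> / \<bar>h\<bar> \<le> h\<^sup>2 / \<bar>h\<bar>"
        by (intro divide_right_mono) auto
      also have "h\<^sup>2 / \<bar>h\<bar> = \<bar>h\<bar>" by (simp add: power2_eq_square abs_if)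
      also have "\<bar>(max 0 (a + h))\<^sup>2 - (max 0 a)\<^sup>2 - 2 * max 0 a * h\<bar> / \<bar>h\<bar> =
          norm (((max 0 (a + h))\<^sup>2 - (max 0 a)\<^sup>2) / h - 2 * max 0 a)"
        unfolding real_norm_def abs_divide[symmetric] using that by (simp add: diff_divide_distrib)
      finally show ?thesis by (simp add: a_def algebra_simps)
    qed
    then show "\<forall>\<^sub>F h in at 0. norm (((max 0 (t + h - 1))\<^sup>2 - (max 0 (t - 1))\<^sup>2) / h - 2 * max 0 (t - 1)) \<le> \<bar>h\<bar>"
      by (auto simp: eventually_at_filter)
    show "((\<lambda>h::real. \<bar>h\<bar>) \<longlongrightarrow> 0) (at 0)" by real_asymp
  qed
  then show ?thesis unfolding DERIV_def by (simp add: LIM_zero_iff)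
qed

lemma ramp_C1:
  "(ramp has_real_derivative (2 * max 0 (t - 1) / (1 + (max 0 (t - 1))\<^sup>2)\<^sup>2)) (at t)"
proof -
  have n: "1 + (max 0 (t - 1))\<^sup>2 \<noteq> 0" for t :: real
    by (metis add_pos_nonneg order_less_irrefl zero_le_power2 zero_less_one)
  have "(ramp has_real_derivative
     (2 * max 0 (t - 1) * (1 + (max 0 (t - 1))\<^sup>2) - (max 0 (t - 1))\<^sup>2 * (0 + 2 * max 0 (t - 1))) /
      ((1 + (max 0 (t - 1))\<^sup>2) * (1 + (max 0 (t - 1))\<^sup>2))) (at t)"
    unfolding ramp_def[abs_def] by (intro DERIV_divide DERIV_add DERIV_const has_derivative_square_max n)
  then show ?thesis by (simp add: algebra_simps power2_eq_square)
qed

lemma C1_scalar_ramp_bary: "C1_scalar (\<lambda>x. ramp (c * bary V q x))"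
proof -
  let ?m = "\<lambda>x. max 0 (c * bary V q x - 1)"
  let ?D = "\<lambda>x. (2 * ?m x / (1 + (?m x)\<^sup>2)\<^sup>2) *\<^sub>R (c *\<^sub>R bary_grad V q)"
  have "((\<lambda>x. ramp (c * bary V q x)) has_derivative (\<lambda>h. ?D x \<bullet> h)) (at x)" for x
  proof -
    have 1: "((\<lambda>x. c * bary V q x) has_derivative (\<lambda>h. c * (bary_grad V q \<bullet> h))) (at x)"
      unfolding bary_def by (auto intro!: derivative_eq_intros)
    show ?thesis
      using has_derivative_compose[OF 1 ramp_C1[unfolded has_field_derivative_def]] by (simp add: mult.assoc)
  qed
  moreover have "continuous_on UNIV ?D"
    by (intro continuous_intros ballI) (metis add_pos_nonneg order_less_irrefl zero_le_power2 zero_less_one zero_less_power)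
  ultimately show ?thesis unfolding C1_scalar_def by (intro exI[of _ ?D] conjI allI)
qed

text \<open>
  These functions are supported in the interior of the simplex and converge to its indicator
  function as \<open>n\<close> grows, because the barycentric coordinates are positive exactly in the interior.
\<close>

definition cutoff :: "(real^'d::finite) set \<Rightarrow> nat \<Rightarrow> real^'d \<Rightarrow> real" where
  "cutoff V n x = (\<Prod>q\<in>V. ramp (real n * bary V q x))"

lemma cutoff_C1: "C1_scalar (cutoff V n)"
  unfolding cutoff_def by (intro C1_scalar_prod C1_scalar_ramp_bary)

lemma cutoff_range: "0 \<le> cutoff V n x" "cutoff V n x \<le> 1"
  unfolding cutoff_def by (auto intro!: prod_nonneg prod_le_1 simp: ramp_range)

lemma cutoff_support:
  assumes V: "affine_frame V"
  shows "\<exists>K. compact K \<and> K \<subseteq> interior (convex hull V) \<and> (\<forall>x. x \<notin> K \<longrightarrow> cutoff V n x = 0)"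
proof -
  define K where "K = {x. \<forall>q\<in>V. 1 \<le> real n * bary V q x}"
  have fin: "finite V" by (rule affine_frame_finite[OF V])
  have sub: "K \<subseteq> interior (convex hull V)"
  proof
    fix x assume x: "x \<in> K"
    have "0 < bary V q x" if "q \<in> V" for q
    proof (rule ccontr)
      assume "\<not> 0 < bary V q x"
      then have "real n * bary V q x \<le> 0" by (simp add: mult_nonneg_nonpos)
      then show False using x that by (auto simp: K_def dest!: bspec[of _ _ q])
    qed
    then show "x \<in> interior (convex hull V)" by (simp add: bary_mem_interior[OF V])
  qed
  have "K = (\<Inter>q\<in>V. {x. 1 \<le> real n * bary V q x})" by (auto simp: K_def)
  then have "closed K" by (auto intro!: closed_INT closed_Collect_le continuous_intros)
  moreover have "bounded K"
    using sub interior_subset bounded_convex_hull[OF finite_imp_bounded[OF fin]] by (blast intro: bounded_subset)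
  ultimately have "compact K" by (simp add: compact_eq_bounded_closed)
  moreover have "cutoff V n x = 0" if "x \<notin> K" for x
    using that fin by (auto simp: cutoff_def K_def intro!: prod_zero bexI ramp_eq_0)
  ultimately show ?thesis using sub by blast
qed

lemma cutoff_tendsto:
  assumes V: "affine_frame V" and x: "x \<in> interior (convex hull V)"
  shows "(\<lambda>n. cutoff V n x) \<longlonglongrightarrow> 1"
proof -
  have "(\<lambda>n. ramp (real n * bary V q x)) \<longlonglongrightarrow> 1" if "q \<in> V" for q
  proof (rule filterlim_compose[OF ramp_tendsto])
    have "0 < bary V q x" using x that by (simp add: bary_mem_interior[OF V])
    then show "filterlim (\<lambda>n. real n * bary V q x) at_top sequentially"
      using filterlim_tendsto_pos_mult_at_top[OF tendsto_const _ filterlim_real_sequentially, of "bary V q x"]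
      by (simp add: mult.commute)
  qed
  then have "(\<lambda>n. \<Prod>q\<in>V. ramp (real n * bary V q x)) \<longlonglongrightarrow> (\<Prod>q\<in>V. 1)"
    by (intro tendsto_prod) auto
  then show ?thesis by (simp add: cutoff_def)
qed

lemma cutoff_outside:
  assumes V: "affine_frame V" and x: "x \<notin> interior (convex hull V)"
  shows "cutoff V n x = 0"
  using cutoff_support[OF V, of n] x by blast

section \<open>Elements of a mesh\<close>

lemma simplex_affine_frame:
  fixes E :: "(real^'d::finite) set"
  assumes "int CARD('d) simplex E"
  shows "affine_frame (vertices E)" "convex hull (vertices E) = E"
proof -
  obtain C where C: "\<not> affine_dependent C" "int (card C) = int CARD('d) + 1" "E = convex hull C"
    using assms unfolding simplex_def by auto
  have "vertices E = C"
    unfolding vertices_def C(3) extreme_point_of_convex_hull_affine_independent[OF C(1)] by simp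
  then show "affine_frame (vertices E)" "convex hull (vertices E) = E"
    using C by (auto simp: affine_frame_def)
qed

lemma mesh_finite: "simplicial_mesh \<Omega> \<T> \<Longrightarrow> finite \<T>"
  by (simp add: simplicial_mesh_def triangulation_def)

lemma mesh_element:
  fixes E :: "(real^'d::finite) set"
  assumes "simplicial_mesh \<Omega> \<T>" "E \<in> \<T>"
  shows "affine_frame (vertices E)" "convex hull (vertices E) = E" "compact E" "convex E"
    "aff_dim E = int CARD('d)"
  using assms simplex_affine_frame[of E]
  by (auto simp: simplicial_mesh_def compact_simplex convex_simplex aff_dim_simplex)

lemma mesh_interior_nonempty:
  assumes m: "simplicial_mesh \<Omega> \<T>" and E: "E \<in> \<T>"
  shows "interior E \<noteq> {}"
proof -
  have "E \<noteq> {}" using mesh_element(5)[OF m E] by auto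
  moreover have "interior E = rel_interior E"
    using mesh_element(5)[OF m E] by (simp add: interior_rel_interior_gen)
  ultimately show ?thesis using mesh_element(4)[OF m E] by (simp add: rel_interior_eq_empty)
qed

lemma mesh_face: "simplicial_mesh \<Omega> \<T> \<Longrightarrow> E \<in> \<T> \<Longrightarrow> E' \<in> \<T> \<Longrightarrow> E \<inter> E' face_of E"
  by (simp add: simplicial_mesh_def triangulation_def)

text \<open>
  A face of \<open>E\<close> that meets the interior of \<open>E\<close> is all of \<open>E\<close>. So \<open>E\<close> is a face of \<open>E'\<close>, of the
  same dimension.
\<close>

lemma mesh_interior_inter:
  assumes m: "simplicial_mesh \<Omega> \<T>" and E: "E \<in> \<T>" "E' \<in> \<T>" and x: "x \<in> interior E" "x \<in> E'"
  shows "E = E'"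
proof -
  have sub: "E \<subseteq> E'"
  proof -
    have "x \<in> (E \<inter> E') \<inter> rel_interior E"
      using x interior_subset_rel_interior[of E] interior_subset[of E] by auto
    then show ?thesis using subset_of_face_of[OF mesh_face[OF m E] order_refl] by auto
  qed
  then have f: "E face_of E'"
    using mesh_face[OF m E(2,1)] by (simp add: Int_absorb1)
  show ?thesis
    using face_of_aff_dim_lt[OF _ f] mesh_element[OF m] E by fastforce
qed

lemma mesh_interior_subset:
  assumes "polyhedral_domain \<Omega>" "simplicial_mesh \<Omega> \<T>" "E \<in> \<T>"
  shows "interior E \<subseteq> \<Omega>"
  using assms interior_mono[of E "closure \<Omega>"]
  by (auto simp: polyhedral_domain_def simplicial_mesh_def)

lemma domain_sets:
  assumes "polyhedral_domain \<Omega>"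
  shows "open \<Omega>" "bounded \<Omega>" "\<Omega> \<in> lmeasurable" "\<Omega> \<in> sets lebesgue"
  using assms by (auto simp: polyhedral_domain_def intro: lmeasurable_open fmeasurableD)

lemma mesh_AE_interior:
  assumes p: "polyhedral_domain \<Omega>" and m: "simplicial_mesh \<Omega> \<T>"
  shows "AE x in lebesgue_on \<Omega>. \<exists>E\<in>\<T>. x \<in> interior E"
proof -
  have N: "negligible (\<Union>E\<in>\<T>. frontier E)"
  proof (rule negligible_Union)
    show "finite (frontier ` \<T>)" using mesh_finite[OF m] by simp
    show "negligible T" if "T \<in> frontier ` \<T>" for T
      using that mesh_element(4)[OF m] negligible_convex_frontier by auto
  qed
  have "AE x in lebesgue. x \<in> \<Omega> \<longrightarrow> (\<exists>E\<in>\<T>. x \<in> interior E)"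
  proof (rule AE_I'[of "\<Union>E\<in>\<T>. frontier E"])
    show "(\<Union>E\<in>\<T>. frontier E) \<in> null_sets lebesgue" using N by (simp add: negligible_iff_null_sets)
    show "{x \<in> space lebesgue. \<not> (x \<in> \<Omega> \<longrightarrow> (\<exists>E\<in>\<T>. x \<in> interior E))} \<subseteq> (\<Union>E\<in>\<T>. frontier E)"
    proof
      fix x assume "x \<in> {x \<in> space lebesgue. \<not> (x \<in> \<Omega> \<longrightarrow> (\<exists>E\<in>\<T>. x \<in> interior E))}"
      then have x: "x \<in> \<Omega>" "\<forall>E\<in>\<T>. x \<notin> interior E" by auto
      then have "x \<in> \<Union>\<T>" using m closure_subset by (auto simp: simplicial_mesh_def)
      then obtain E where "E \<in> \<T>" "x \<in> E" by auto
      then show "x \<in> (\<Union>E\<in>\<T>. frontier E)"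
        using x mesh_element(3)[OF m] by (auto simp: frontier_def compact_imp_closed intro!: bexI[of _ E])
    qed
  qed
  then show ?thesis
    by (subst AE_restrict_space_iff) (auto simp: domain_sets[OF p])
qed

lemma mesh_integral:
  fixes \<Omega> :: "(real^'d::finite) set" and h :: "real^'d \<Rightarrow> real"
  assumes p: "polyhedral_domain \<Omega>" and m: "simplicial_mesh \<Omega> \<T>"
    and h: "integrable (lebesgue_on \<Omega>) h"
  shows "integral\<^sup>L (lebesgue_on \<Omega>) h = (\<Sum>E\<in>\<T>. integral\<^sup>L (lebesgue_on \<Omega>) (\<lambda>x. indicator (interior E) x * h x))"
proof -
  have sets: "interior E \<inter> \<Omega> \<in> sets (lebesgue_on \<Omega>)" for E
    using domain_sets[OF p] by (intro sets_restrict_space_iff[THEN iffD2]) (auto intro!: sets.Int)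
  have i: "integrable (lebesgue_on \<Omega>) (\<lambda>x. indicator (interior E) x * h x)" for E
  proof -
    have "integrable (lebesgue_on \<Omega>) (\<lambda>x. indicator (interior E \<inter> \<Omega>) x *\<^sub>R h x)"
      by (rule integrable_mult_indicator[OF sets h])
    moreover have "integrable (lebesgue_on \<Omega>) (\<lambda>x. indicator (interior E \<inter> \<Omega>) x *\<^sub>R h x) \<longleftrightarrow>
        integrable (lebesgue_on \<Omega>) (\<lambda>x. indicator (interior E) x * h x)"
      by (rule Bochner_Integration.integrable_cong) (auto simp: indicator_def)
    ultimately show ?thesis by blast
  qed
  have "integral\<^sup>L (lebesgue_on \<Omega>) h = integral\<^sup>L (lebesgue_on \<Omega>) (\<lambda>x. \<Sum>E\<in>\<T>. indicator (interior E) x * h x)"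
  proof (rule integral_cong_AE)
    show "AE x in lebesgue_on \<Omega>. h x = (\<Sum>E\<in>\<T>. indicator (interior E) x * h x)"
      using mesh_AE_interior[OF p m]
    proof eventually_elim
      case (elim x)
      then obtain E where E: "E \<in> \<T>" "x \<in> interior E" by auto
      have "x \<in> interior E' \<longleftrightarrow> E' = E" if "E' \<in> \<T>" for E'
        using mesh_interior_inter[OF m E(1) that E(2)] E(2) interior_subset[of E'] by auto
      then have "(\<Sum>E'\<in>\<T>. indicator (interior E') x * h x) = (\<Sum>E'\<in>\<T>. if E' = E then h x else 0)"
        by (intro sum.cong refl) (simp add: indicator_def)
      then show ?case using E mesh_finite[OF m] by simp
    qed
  qed (use h i in \<open>auto intro!: borel_measurable_sum\<close>)
  also have "\<dots> = (\<Sum>E\<in>\<T>. integral\<^sup>L (lebesgue_on \<Omega>) (\<lambda>x. indicator (interior E) x * h x))"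
    using i by (rule Bochner_Integration.integral_sum)
  finally show ?thesis .
qed

section \<open>Square-integrable fields\<close>

lemma L2_inner_integrable:
  assumes "f \<in> L2 \<Omega>" "g \<in> L2 \<Omega>"
  shows "integrable (lebesgue_on \<Omega>) (\<lambda>x. f x \<bullet> g x)"
proof (rule Bochner_Integration.integrable_bound)
  show "integrable (lebesgue_on \<Omega>) (\<lambda>x. (norm (f x))\<^sup>2 + (norm (g x))\<^sup>2)"
    using assms by (auto simp: L2_def)
  show "(\<lambda>x. f x \<bullet> g x) \<in> borel_measurable (lebesgue_on \<Omega>)"
    using assms by (auto simp: L2_def)
  have "\<bar>f x \<bullet> g x\<bar> \<le> (norm (f x))\<^sup>2 + (norm (g x))\<^sup>2" for x
  proof -
    have "\<bar>f x \<bullet> g x\<bar> \<le> norm (f x) * norm (g x)" by (rule Cauchy_Schwarz_ineq2)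
    also have "\<dots> \<le> (norm (f x))\<^sup>2 + (norm (g x))\<^sup>2"
      using sum_squares_bound[of "norm (f x)" "norm (g x)"] mult_nonneg_nonneg[OF norm_ge_zero[of "f x"] norm_ge_zero[of "g x"]]
      by linarith
    finally show ?thesis .
  qed
  then show "AE x in lebesgue_on \<Omega>. norm (f x \<bullet> g x) \<le> norm ((norm (f x))\<^sup>2 + (norm (g x))\<^sup>2)" by auto
qed

lemma L2_add:
  assumes "f \<in> L2 \<Omega>" "g \<in> L2 \<Omega>"
  shows "(\<lambda>x. f x + g x) \<in> L2 \<Omega>"
proof -
  have "integrable (lebesgue_on \<Omega>) (\<lambda>x. f x \<bullet> f x + g x \<bullet> g x + 2 * (f x \<bullet> g x))"
    using L2_inner_integrable assms by (intro Bochner_Integration.integrable_add integrable_mult_right) auto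
  then show ?thesis using assms
    by (auto simp: L2_def power2_norm_eq_inner inner_simps inner_commute algebra_simps)
qed

lemma L2_scaleR: "f \<in> L2 \<Omega> \<Longrightarrow> (\<lambda>x. c *\<^sub>R f x) \<in> L2 \<Omega>"
  by (auto simp: L2_def power_mult_distrib)

lemma L2_zero: "(\<lambda>x. 0) \<in> L2 \<Omega>" by (simp add: L2_def)

lemma L2_sum: "(\<And>i. i \<in> I \<Longrightarrow> f i \<in> L2 \<Omega>) \<Longrightarrow> (\<lambda>x. \<Sum>i\<in>I. f i x) \<in> L2 \<Omega>"
  by (induction I rule: infinite_finite_induct) (auto simp: L2_zero L2_add)

lemma L2_diff: "f \<in> L2 \<Omega> \<Longrightarrow> g \<in> L2 \<Omega> \<Longrightarrow> (\<lambda>x. f x - g x) \<in> L2 \<Omega>"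
  using L2_add[of f \<Omega> "\<lambda>x. - 1 *\<^sub>R g x"] L2_scaleR[of g \<Omega> "- 1"] by simp

lemma L2_bounded:
  assumes "\<Omega> \<in> lmeasurable" "f \<in> borel_measurable (lebesgue_on \<Omega>)" "\<And>x. x \<in> \<Omega> \<Longrightarrow> norm (f x) \<le> B"
  shows "f \<in> L2 \<Omega>"
proof -
  have "finite_measure (lebesgue_on \<Omega>)"
    using assms(1) by (auto intro!: finite_measureI simp: emeasure_restrict_space fmeasurable_def)
  then have "integrable (lebesgue_on \<Omega>) (\<lambda>x. (norm (f x))\<^sup>2)"
    using assms by (intro finite_measure.integrable_const_bound[where B = "B\<^sup>2"])
      (auto intro!: AE_I2 power_mono simp: abs_square_le_1 power_abs[symmetric])
  then show ?thesis using assms by (simp add: L2_def)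
qed

lemma L2_continuous:
  assumes "open \<Omega>" "bounded \<Omega>" "continuous_on UNIV f"
  shows "f \<in> L2 \<Omega>"
proof -
  have "compact (f ` closure \<Omega>)"
    using assms by (intro compact_continuous_image) (auto intro: continuous_on_subset)
  then have "bounded (f ` closure \<Omega>)" by (rule compact_imp_bounded)
  then obtain B where "\<And>x. x \<in> closure \<Omega> \<Longrightarrow> norm (f x) \<le> B" unfolding bounded_iff by auto
  then show ?thesis
    using assms closure_subset[of \<Omega>]
    by (intro L2_bounded[where B = B])
       (auto intro!: lmeasurable_open continuous_imp_measurable_on_sets_lebesgue intro: continuous_on_subset)
qed

lemma L2_inner_cong_AE:
  assumes "AE x in lebesgue_on \<Omega>. f x = f' x" "AE x in lebesgue_on \<Omega>. g x = g' x"
    "f \<in> L2 \<Omega>" "f' \<in> L2 \<Omega>" "g \<in> L2 \<Omega>" "g' \<in> L2 \<Omega>"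
  shows "L2_inner \<Omega> f g = L2_inner \<Omega> f' g'"
  unfolding L2_inner_def
proof (rule integral_cong_AE)
  show "AE x in lebesgue_on \<Omega>. f x \<bullet> g x = f' x \<bullet> g' x" using assms(1,2) by eventually_elim simp
qed (use L2_inner_integrable assms in \<open>blast intro: borel_measurable_integrable\<close>)+

lemma L2_inner_diff_left:
  assumes "f \<in> L2 \<Omega>" "f' \<in> L2 \<Omega>" "g \<in> L2 \<Omega>"
  shows "L2_inner \<Omega> (\<lambda>x. f x - f' x) g = L2_inner \<Omega> f g - L2_inner \<Omega> f' g"
  unfolding L2_inner_def inner_diff_left
  by (intro Bochner_Integration.integral_diff L2_inner_integrable assms)

lemma L2_inner_sum_left:
  assumes "\<And>i. i \<in> I \<Longrightarrow> f i \<in> L2 \<Omega>" "g \<in> L2 \<Omega>"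
  shows "L2_inner \<Omega> (\<lambda>x. \<Sum>i\<in>I. c i *\<^sub>R f i x) g = (\<Sum>i\<in>I. c i * L2_inner \<Omega> (f i) g)"
  unfolding L2_inner_def inner_sum_left
  using assms by (subst Bochner_Integration.integral_sum) (auto intro!: integrable_mult_right L2_inner_integrable)

lemma L2_inner_commute: "L2_inner \<Omega> f g = L2_inner \<Omega> g f"
  by (simp add: L2_inner_def inner_commute)

section \<open>Uniqueness of the weak divergence\<close>

text \<open>
  The cut-off of \<open>w\<close> to the interior of the element is a test field, and dominated convergence
  removes the cut-off.
\<close>

lemma orthogonal_to_tests_on_element:
  assumes p: "polyhedral_domain \<Omega>" and m: "simplicial_mesh \<Omega> \<T>" and E: "E \<in> \<T>"
    and g: "g \<in> L2 \<Omega>"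
    and orth: "\<And>\<phi>. C1_field \<phi> \<Longrightarrow> \<exists>K. compact K \<and> K \<subseteq> \<Omega> \<and> (\<forall>x. x \<notin> K \<longrightarrow> \<phi> x = 0) \<Longrightarrow> L2_inner \<Omega> g \<phi> = 0"
    and w: "C1_field w"
  shows "integral\<^sup>L (lebesgue_on \<Omega>) (\<lambda>x. indicator (interior E) x * (g x \<bullet> w x)) = 0"
proof -
  note V = mesh_element(1)[OF m E] and hull = mesh_element(2)[OF m E]
  have wL2: "w \<in> L2 \<Omega>" using domain_sets[OF p] C1_field_continuous[OF w] by (intro L2_continuous) auto
  have i: "integrable (lebesgue_on \<Omega>) (\<lambda>x. g x \<bullet> w x)" by (rule L2_inner_integrable[OF g wL2])
  have z: "L2_inner \<Omega> g (\<lambda>x. cutoff (vertices E) n x *\<^sub>R w x) = 0" for n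
  proof (rule orth)
    show "C1_field (\<lambda>x. cutoff (vertices E) n x *\<^sub>R w x)" by (rule C1_field_scaleR[OF cutoff_C1 w])
    obtain K where "compact K" "K \<subseteq> interior E" "\<forall>x. x \<notin> K \<longrightarrow> cutoff (vertices E) n x = 0"
      using cutoff_support[OF V, of n] hull by auto
    then show "\<exists>K. compact K \<and> K \<subseteq> \<Omega> \<and> (\<forall>x. x \<notin> K \<longrightarrow> cutoff (vertices E) n x *\<^sub>R w x = 0)"
      using mesh_interior_subset[OF p m E] by (intro exI[of _ K]) auto
  qed
  have "(\<lambda>n. L2_inner \<Omega> g (\<lambda>x. cutoff (vertices E) n x *\<^sub>R w x)) \<longlonglongrightarrow>
      integral\<^sup>L (lebesgue_on \<Omega>) (\<lambda>x. indicator (interior E) x * (g x \<bullet> w x))"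
    unfolding L2_inner_def
  proof (rule integral_dominated_convergence[where w = "\<lambda>x. norm (g x \<bullet> w x)"])
    show "integrable (lebesgue_on \<Omega>) (\<lambda>x. norm (g x \<bullet> w x))" using i by (rule integrable_norm)
    show "(\<lambda>x. g x \<bullet> cutoff (vertices E) n x *\<^sub>R w x) \<in> borel_measurable (lebesgue_on \<Omega>)" for n
    proof -
      have "cutoff (vertices E) n \<in> borel_measurable (lebesgue_on \<Omega>)"
        using domain_sets[OF p] cutoff_C1[of "vertices E" n] unfolding C1_scalar_def
        by (auto intro!: continuous_imp_measurable_on_sets_lebesgue continuous_at_imp_continuous_on dest: has_derivative_continuous)
      then have "(\<lambda>x. cutoff (vertices E) n x * (g x \<bullet> w x)) \<in> borel_measurable (lebesgue_on \<Omega>)"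
        using i by (intro borel_measurable_times) auto
      then show ?thesis by simp
    qed
    have "(\<lambda>x. indicator (interior E) x :: real) \<in> borel_measurable (lebesgue_on \<Omega>)"
      by (rule measurable_restrict_space1) (auto intro!: borel_measurable_indicator)
    then show "(\<lambda>x. indicator (interior E) x * (g x \<bullet> w x)) \<in> borel_measurable (lebesgue_on \<Omega>)"
      using i by (intro borel_measurable_times) auto
    show "AE x in lebesgue_on \<Omega>. norm (g x \<bullet> cutoff (vertices E) n x *\<^sub>R w x) \<le> norm (g x \<bullet> w x)" for n
      using cutoff_range[of "vertices E" n] by (intro AE_I2) (auto simp: abs_mult intro!: mult_left_le_one_le)
    show "AE x in lebesgue_on \<Omega>. (\<lambda>n. g x \<bullet> cutoff (vertices E) n x *\<^sub>R w x) \<longlonglongrightarrow> indicator (interior E) x * (g x \<bullet> w x)"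
    proof (rule AE_I2)
      fix x
      show "(\<lambda>n. g x \<bullet> cutoff (vertices E) n x *\<^sub>R w x) \<longlonglongrightarrow> indicator (interior E) x * (g x \<bullet> w x)"
      proof (cases "x \<in> interior E")
        case True
        then have "(\<lambda>n. cutoff (vertices E) n x) \<longlonglongrightarrow> 1" using cutoff_tendsto[OF V] hull by simp
        then have "(\<lambda>n. cutoff (vertices E) n x * (g x \<bullet> w x)) \<longlonglongrightarrow> 1 * (g x \<bullet> w x)" by (intro tendsto_intros)
        then show ?thesis using True by simp
      next
        case False
        then show ?thesis using cutoff_outside[OF V] hull by simp
      qed
    qed
  qed
  then show ?thesis by (simp add: z LIMSEQ_const_iff)
qed

text \<open>
  These fields include the test fields in the definition of the normal trace, which need not
  vanish on the boundary, and the discrete displacements, which jump between elements.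
\<close>

definition piecewise_C1 :: "(real^'d::finite) set \<Rightarrow> (real^'d) set set \<Rightarrow> (real^'d \<Rightarrow> real^'d) \<Rightarrow> bool" where
  "piecewise_C1 \<Omega> \<T> v \<longleftrightarrow> v \<in> L2 \<Omega> \<and> (\<forall>E\<in>\<T>. \<exists>w. C1_field w \<and> (\<forall>x\<in>interior E. v x = w x))"

lemma C1_field_piecewise:
  "polyhedral_domain \<Omega> \<Longrightarrow> C1_field w \<Longrightarrow> piecewise_C1 \<Omega> \<T> w"
  unfolding piecewise_C1_def by (auto intro!: L2_continuous C1_field_continuous domain_sets)

lemma Vh_piecewise:
  assumes "v \<in> Vh \<Omega> \<T>" shows "piecewise_C1 \<Omega> \<T> v"
  unfolding piecewise_C1_def
proof (intro conjI ballI)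
  show "v \<in> L2 \<Omega>" using assms by (simp add: Vh_def V_space_def)
  fix E assume "E \<in> \<T>"
  then obtain c where "\<forall>x\<in>interior E. v x = c" using assms by (auto simp: Vh_def)
  then show "\<exists>w. C1_field w \<and> (\<forall>x\<in>interior E. v x = w x)"
    by (intro exI[of _ "\<lambda>_. c"] conjI C1_field_const) simp
qed

text \<open>
  The chosen weak divergence enters the matrices and the normal trace only through such pairings,
  so it may be replaced by any explicit weak divergence.
\<close>

lemma weak_div_unique:
  assumes p: "polyhedral_domain \<Omega>" and m: "simplicial_mesh \<Omega> \<T>"
    and \<tau>: "\<tau> \<in> L2 \<Omega>" "\<tau>' \<in> L2 \<Omega>" "AE x in lebesgue_on \<Omega>. \<tau> x = \<tau>' x"
    and g: "g \<in> L2 \<Omega>" "g' \<in> L2 \<Omega>" and div: "has_weak_div \<Omega> \<tau> g" "has_weak_div \<Omega> \<tau>' g'"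
    and v: "piecewise_C1 \<Omega> \<T> v"
  shows "L2_inner \<Omega> g v = L2_inner \<Omega> g' v"
proof -
  have vL2: "v \<in> L2 \<Omega>" using v by (simp add: piecewise_C1_def)
  have dL2: "(\<lambda>x. g x - g' x) \<in> L2 \<Omega>" by (rule L2_diff[OF g])
  have orth: "L2_inner \<Omega> (\<lambda>x. g x - g' x) \<phi> = 0"
    if \<phi>: "C1_field \<phi>" "\<exists>K. compact K \<and> K \<subseteq> \<Omega> \<and> (\<forall>x. x \<notin> K \<longrightarrow> \<phi> x = 0)" for \<phi>
  proof -
    have JL2: "(\<lambda>x. jacobian \<phi> (at x)) \<in> L2 \<Omega>"
      using \<phi>(1) domain_sets[OF p] by (intro L2_continuous) (auto simp: C1_field_def)
    have "\<phi> \<in> L2 \<Omega>" using domain_sets[OF p] C1_field_continuous[OF \<phi>(1)] by (intro L2_continuous) auto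
    then have "L2_inner \<Omega> (\<lambda>x. g x - g' x) \<phi> = L2_inner \<Omega> g \<phi> - L2_inner \<Omega> g' \<phi>"
      by (intro L2_inner_diff_left g)
    also have "\<dots> = - L2_inner \<Omega> \<tau> (\<lambda>x. jacobian \<phi> (at x)) + L2_inner \<Omega> \<tau>' (\<lambda>x. jacobian \<phi> (at x))"
      using div \<phi> by (simp add: has_weak_div_def)
    also have "L2_inner \<Omega> \<tau> (\<lambda>x. jacobian \<phi> (at x)) = L2_inner \<Omega> \<tau>' (\<lambda>x. jacobian \<phi> (at x))"
      using \<tau> JL2 by (intro L2_inner_cong_AE) auto
    finally show ?thesis by simp
  qed
  have "L2_inner \<Omega> (\<lambda>x. g x - g' x) v = 0"
    unfolding L2_inner_def mesh_integral[OF p m L2_inner_integrable[OF dL2 vL2]]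
  proof (rule sum.neutral, rule ballI)
    fix E assume E: "E \<in> \<T>"
    then obtain w where w: "C1_field w" "\<forall>x\<in>interior E. v x = w x" using v by (auto simp: piecewise_C1_def)
    have "integral\<^sup>L (lebesgue_on \<Omega>) (\<lambda>x. indicator (interior E) x * ((g x - g' x) \<bullet> v x)) =
        integral\<^sup>L (lebesgue_on \<Omega>) (\<lambda>x. indicator (interior E) x * ((g x - g' x) \<bullet> w x))"
      using w(2) by (intro Bochner_Integration.integral_cong) (auto simp: indicator_def)
    also have "\<dots> = 0" by (rule orthogonal_to_tests_on_element[OF p m E dL2 orth w(1)])
    finally show "integral\<^sup>L (lebesgue_on \<Omega>) (\<lambda>x. indicator (interior E) x * ((g x - g' x) \<bullet> v x)) = 0" .
  qed
  then show ?thesis using L2_inner_diff_left[OF g vL2] by simp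
qed

lemma wdiv_works:
  assumes "\<tau> \<in> Hdiv \<Omega>"
  shows "wdiv \<Omega> \<tau> \<in> L2 \<Omega>" "has_weak_div \<Omega> \<tau> (wdiv \<Omega> \<tau>)"
proof -
  have "wdiv \<Omega> \<tau> \<in> L2 \<Omega> \<and> has_weak_div \<Omega> \<tau> (wdiv \<Omega> \<tau>)"
    using someI_ex[of "\<lambda>g. g \<in> L2 \<Omega> \<and> has_weak_div \<Omega> \<tau> g"] assms
    unfolding wdiv_def Hdiv_def by blast
  then show "wdiv \<Omega> \<tau> \<in> L2 \<Omega>" "has_weak_div \<Omega> \<tau> (wdiv \<Omega> \<tau>)" by auto
qed

text \<open>
  One Green identity yields both the weak divergence and the vanishing normal trace, since a test
  field with compact support in the open set \<open>\<Omega>\<close> vanishes on the whole frontier.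
\<close>

lemma X_spaceI_Green:
  assumes p: "polyhedral_domain \<Omega>" and m: "simplicial_mesh \<Omega> \<T>"
    and \<tau>: "\<tau> \<in> L2 \<Omega>" and \<delta>: "\<delta> \<in> L2 \<Omega>"
    and green: "\<And>w. C1_field w \<Longrightarrow> (\<forall>x\<in>frontier \<Omega> - \<Gamma>. w x = 0) \<Longrightarrow>
      L2_inner \<Omega> \<tau> (\<lambda>x. jacobian w (at x)) + L2_inner \<Omega> \<delta> w = 0"
  shows "\<tau> \<in> X_space \<Omega> \<Gamma>" and "piecewise_C1 \<Omega> \<T> v \<Longrightarrow> L2_inner \<Omega> (wdiv \<Omega> \<tau>) v = L2_inner \<Omega> \<delta> v"
proof -
  have wd: "has_weak_div \<Omega> \<tau> \<delta>"
    unfolding has_weak_div_def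
  proof (intro allI impI, elim conjE exE)
    fix \<phi> K assume \<phi>: "C1_field \<phi>" "compact K" "K \<subseteq> \<Omega>" "\<forall>x. x \<notin> K \<longrightarrow> \<phi> x = 0"
    then have "\<forall>x\<in>frontier \<Omega> - \<Gamma>. \<phi> x = 0"
      using domain_sets(1)[OF p] by (auto simp: frontier_def interior_open)
    from green[OF \<phi>(1) this] show "L2_inner \<Omega> \<tau> (\<lambda>x. jacobian \<phi> (at x)) = - L2_inner \<Omega> \<delta> \<phi>" by simp
  qed
  then have H: "\<tau> \<in> Hdiv \<Omega>" using \<tau> \<delta> by (auto simp: Hdiv_def)
  have eq: "L2_inner \<Omega> (wdiv \<Omega> \<tau>) v = L2_inner \<Omega> \<delta> v" if "piecewise_C1 \<Omega> \<T> v" for v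
    using weak_div_unique[OF p m \<tau> \<tau> _ wdiv_works(1)[OF H] \<delta> wdiv_works(2)[OF H] wd that] by simp
  then show "piecewise_C1 \<Omega> \<T> v \<Longrightarrow> L2_inner \<Omega> (wdiv \<Omega> \<tau>) v = L2_inner \<Omega> \<delta> v" .
  show "\<tau> \<in> X_space \<Omega> \<Gamma>"
    using H green eq[OF C1_field_piecewise[OF p]]
    by (simp add: X_space_def zero_normal_trace_def)
qed

section \<open>Stress fields attached to a vertex of a facet\<close>

definition outer :: "real^'d::finite \<Rightarrow> real^'d \<Rightarrow> real^'d^'d" where
  "outer a b = (\<chi> i j. a $ i * b $ j)"

lemma inner_outer: "outer a b \<bullet> M = a \<bullet> (M *v b)"
  by (simp add: outer_def inner_vec_def matrix_vector_mult_def sum_distrib_left ac_simps)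

text \<open>
  On the element with vertex set \<open>V\<close>, this is \<open>s \<lambda>\<^sub>r a \<otimes> (p - r)\<close>. Its normal trace is carried by
  the facet opposite \<open>p\<close>. The gradient of \<open>\<lambda>\<^sub>r\<close> has product \<open>-1\<close> with \<open>p - r\<close>, so the divergence
  is \<open>-s a\<close>.
\<close>

definition vertex_field ::
    "(real^'d::finite) set \<Rightarrow> real^'d \<Rightarrow> real^'d \<Rightarrow> real \<Rightarrow> real^'d \<Rightarrow> real^'d \<Rightarrow> real^'d^'d" where
  "vertex_field V r p s a x =
     (if x \<in> interior (convex hull V) then (s * bary V r x) *\<^sub>R outer a (p - r) else 0)"

definition vertex_field_div ::
    "(real^'d::finite) set \<Rightarrow> real \<Rightarrow> real^'d \<Rightarrow> real^'d \<Rightarrow> real^'d" where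
  "vertex_field_div V s a x = (if x \<in> interior (convex hull V) then - s *\<^sub>R a else 0)"

lemma integral_element:
  fixes \<Omega> :: "(real^'d::finite) set" and h :: "real^'d \<Rightarrow> real"
  assumes \<Omega>: "open \<Omega>" and E: "compact E" "convex E" "interior E \<subseteq> \<Omega>" and h: "continuous_on UNIV h"
  shows "integral\<^sup>L (lebesgue_on \<Omega>) (\<lambda>x. indicator (interior E) x * h x) = (\<integral>x. indicator E x * h x \<partial>lborel)"
proof -
  have hm [measurable]: "h \<in> borel_measurable borel" by (rule borel_measurable_continuous_onI[OF h])
  have [measurable]: "E \<in> sets borel" "interior E \<in> sets borel" using E by (auto simp: borel_compact)
  have "integral\<^sup>L (lebesgue_on \<Omega>) (\<lambda>x. indicator (interior E) x * h x) =
      integral\<^sup>L lebesgue (\<lambda>x. indicator \<Omega> x *\<^sub>R (indicator (interior E) x * h x))"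
    using \<Omega> by (intro integral_restrict_space) auto
  also have "\<dots> = integral\<^sup>L lebesgue (\<lambda>x. indicator (interior E) x * h x)"
    using E(3) by (intro Bochner_Integration.integral_cong refl) (auto simp: indicator_def)
  also have "\<dots> = (\<integral>x. indicator (interior E) x * h x \<partial>lborel)"
    by (rule integral_completion) measurable
  also have "\<dots> = (\<integral>x. indicator E x * h x \<partial>lborel)"
  proof (rule integral_cong_AE)
    have "frontier E \<in> null_sets lborel"
      using negligible_convex_frontier[OF E(2)] E(1)
      by (simp add: negligible_iff_null_sets null_sets_completion_iff borel_closed)
    then show "AE x in lborel. indicator (interior E) x * h x = indicator E x * h x"
      by (rule AE_I') (use E(1) interior_subset[of E] in \<open>auto simp: frontier_def compact_imp_closed indicator_def split: if_splits\<close>)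
  qed measurable
  finally show ?thesis .
qed

context
  fixes \<Omega> V :: "(real^'d::finite) set" and r p a :: "real^'d" and s :: real
  assumes p: "polyhedral_domain \<Omega>" and V: "affine_frame V" and sub: "interior (convex hull V) \<subseteq> \<Omega>"
    and r: "r \<in> V"
begin

lemma convex_hull_V: "compact (convex hull V)" "convex (convex hull V)"
  using affine_frame_finite[OF V] by (auto simp: compact_convex_hull finite_imp_compact)

lemma indicator_interior_measurable:
  "(\<lambda>x. indicator (interior (convex hull V)) x :: real) \<in> borel_measurable (lebesgue_on \<Omega>)"
  by (rule measurable_restrict_space1) (auto intro!: borel_measurable_indicator)

lemma vertex_field_L2: "vertex_field V r p s a \<in> L2 \<Omega>"
proof (rule L2_bounded[OF domain_sets(3)[OF \<open>polyhedral_domain \<Omega>\<close>]])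
  have c: "bary V r \<in> borel_measurable (lebesgue_on \<Omega>)"
    using domain_sets[OF \<open>polyhedral_domain \<Omega>\<close>]
    by (intro continuous_imp_measurable_on_sets_lebesgue continuous_intros) auto
  have "vertex_field V r p s a =
      (\<lambda>x. (indicator (interior (convex hull V)) x * (s * bary V r x)) *\<^sub>R outer a (p - r))"
    by (auto simp: vertex_field_def fun_eq_iff)
  moreover have "(\<lambda>x. (indicator (interior (convex hull V)) x * (s * bary V r x)) *\<^sub>R outer a (p - r))
      \<in> borel_measurable (lebesgue_on \<Omega>)"
    using c indicator_interior_measurable by (intro borel_measurable_scaleR borel_measurable_times) auto
  ultimately show "vertex_field V r p s a \<in> borel_measurable (lebesgue_on \<Omega>)" by simp
  fix x
  have "\<bar>bary V r x\<bar> \<le> 1" if "x \<in> interior (convex hull V)"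
  proof -
    have pos: "\<forall>q\<in>V. 0 < bary V q x" using that bary_mem_interior[OF V] by blast
    then have "bary V r x \<le> (\<Sum>q\<in>V. bary V q x)"
      using r affine_frame_finite[OF V] by (intro member_le_sum) (auto simp: less_imp_le)
    then show ?thesis using pos r bary_sum[OF V] by (auto simp: abs_le_iff intro: order_trans[of _ 0])
  qed
  then show "norm (vertex_field V r p s a x) \<le> \<bar>s\<bar> * norm (outer a (p - r))"
    by (auto simp: vertex_field_def abs_mult intro!: mult_right_mono mult_left_le)
qed

lemma vertex_field_div_L2: "vertex_field_div V s a \<in> L2 \<Omega>"
proof (rule L2_bounded[OF domain_sets(3)[OF \<open>polyhedral_domain \<Omega>\<close>]])
  have "vertex_field_div V s a = (\<lambda>x. indicator (interior (convex hull V)) x *\<^sub>R (- s *\<^sub>R a))"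
    by (auto simp: vertex_field_div_def fun_eq_iff)
  moreover have "(\<lambda>x. indicator (interior (convex hull V)) x *\<^sub>R (- s *\<^sub>R a)) \<in> borel_measurable (lebesgue_on \<Omega>)"
    using indicator_interior_measurable by (intro borel_measurable_scaleR) auto
  ultimately show "vertex_field_div V s a \<in> borel_measurable (lebesgue_on \<Omega>)" by simp
  show "norm (vertex_field_div V s a x) \<le> norm (s *\<^sub>R a)" for x
    by (auto simp: vertex_field_div_def)
qed

text \<open>
  What remains on the right, instead of zero, is the flux of \<open>a \<bullet> w\<close> through the facet opposite
  \<open>p\<close>.
\<close>

lemma vertex_field_Green:
  assumes w: "C1_field w"
  shows "L2_inner \<Omega> (vertex_field V r p s a) (\<lambda>x. jacobian w (at x)) + L2_inner \<Omega> (vertex_field_div V s a) w =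
    s * element_flux V r p (\<lambda>x. a \<bullet> w x) (\<lambda>x. transpose (jacobian w (at x)) *v a)"
proof -
  note d = domain_sets[OF \<open>polyhedral_domain \<Omega>\<close>]
  let ?J = "\<lambda>x. jacobian w (at x)"
  have cw: "continuous_on UNIV w" and cJ: "continuous_on UNIV ?J"
    using w C1_field_continuous by (auto simp: C1_field_def)
  have L: "w \<in> L2 \<Omega>" "?J \<in> L2 \<Omega>" using d by (auto intro!: L2_continuous cw cJ)
  have t: "(transpose M *v a) \<bullet> b = a \<bullet> (M *v b)" for M :: "real^'d^'d" and b
    using dot_lmul_matrix[of a M b] by simp
  let ?h = "\<lambda>x. s * (bary V r x * (a \<bullet> (?J x *v (p - r))) - a \<bullet> w x)"
  have ch: "continuous_on UNIV ?h"
    unfolding matrix_vector_mult_def by (intro continuous_intros cw cJ)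
  have "L2_inner \<Omega> (vertex_field V r p s a) ?J + L2_inner \<Omega> (vertex_field_div V s a) w =
     integral\<^sup>L (lebesgue_on \<Omega>) (\<lambda>x. vertex_field V r p s a x \<bullet> ?J x + vertex_field_div V s a x \<bullet> w x)"
    unfolding L2_inner_def
    by (intro Bochner_Integration.integral_add[symmetric] L2_inner_integrable vertex_field_L2 vertex_field_div_L2 L)
  also have "\<dots> = integral\<^sup>L (lebesgue_on \<Omega>) (\<lambda>x. indicator (interior (convex hull V)) x * ?h x)"
    by (intro Bochner_Integration.integral_cong refl)
       (auto simp: vertex_field_def vertex_field_div_def inner_outer algebra_simps)
  also have "\<dots> = (\<integral>x. indicator (convex hull V) x * ?h x \<partial>lborel)"
    by (rule integral_element[OF d(1) convex_hull_V sub ch])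
  also have "\<dots> = s * element_flux V r p (\<lambda>x. a \<bullet> w x) (\<lambda>x. transpose (?J x) *v a)"
    unfolding element_flux_def t by (simp add: mult.left_commute flip: Bochner_Integration.integral_mult_right_zero)
  finally show ?thesis .
qed

lemma vertex_field_inner:
  assumes b: "bij_betw b UNIV (V - {r})" and K: "\<And>x. x \<in> interior (convex hull V) \<Longrightarrow> \<xi> x = K"
  shows "L2_inner \<Omega> (vertex_field V r p s a) \<xi> = s * elem_scale r b * ref_moment TYPE('d) * (a \<bullet> (K *v (p - r)))"
proof -
  let ?k = "s * (a \<bullet> (K *v (p - r)))"
  have "L2_inner \<Omega> (vertex_field V r p s a) \<xi> =
     integral\<^sup>L (lebesgue_on \<Omega>) (\<lambda>x. indicator (interior (convex hull V)) x * (?k * bary V r x))"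
    unfolding L2_inner_def
    by (intro Bochner_Integration.integral_cong refl) (auto simp: vertex_field_def inner_outer K)
  also have "\<dots> = (\<integral>x. indicator (convex hull V) x * (?k * bary V r x) \<partial>lborel)"
    by (intro integral_element domain_sets(1)[OF \<open>polyhedral_domain \<Omega>\<close>] convex_hull_V sub continuous_intros)
  also have "\<dots> = ?k * (\<integral>x. indicator (convex hull V) x * bary V r x \<partial>lborel)"
    by (subst Bochner_Integration.integral_mult_right_zero[symmetric]) (simp add: ac_simps)
  finally show ?thesis by (simp add: element_moment[OF V r b])
qed

lemma vertex_field_div_inner:
  assumes b: "bij_betw b UNIV (V - {r})" and c: "\<And>x. x \<in> interior (convex hull V) \<Longrightarrow> v x = c"
  shows "L2_inner \<Omega> (vertex_field_div V s a) v = - s * elem_scale r b * ref_volume TYPE('d) * (a \<bullet> c)"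
proof -
  have "L2_inner \<Omega> (vertex_field_div V s a) v =
     integral\<^sup>L (lebesgue_on \<Omega>) (\<lambda>x. indicator (interior (convex hull V)) x * (- s * (a \<bullet> c)))"
    unfolding L2_inner_def
    by (intro Bochner_Integration.integral_cong refl) (auto simp: vertex_field_div_def c)
  also have "\<dots> = (\<integral>x. indicator (convex hull V) x * (- s * (a \<bullet> c)) \<partial>lborel)"
    by (intro integral_element domain_sets(1)[OF \<open>polyhedral_domain \<Omega>\<close>] convex_hull_V sub continuous_intros)
  also have "\<dots> = (\<integral>x. indicator (convex hull V) x \<partial>lborel) * (- s * (a \<bullet> c))"
    by simp
  finally show ?thesis by (simp only: element_volume[OF V r b]) simp
qed

end

section \<open>Facets of the mesh\<close>

lemma at_right_happens:
  assumes "\<forall>\<^sub>F t in at_right (0::real). P t"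
  shows "\<exists>t. 0 < t \<and> t < 1 \<and> P t"
proof -
  have "\<forall>\<^sub>F t in at_right (0::real). t < 1" "\<forall>\<^sub>F t in at_right (0::real). 0 < t"
    by (auto intro: eventually_at_rightI[of 0 1])
  then have "\<forall>\<^sub>F t in at_right (0::real). 0 < t \<and> t < 1 \<and> P t"
    using assms by eventually_elim simp
  then show ?thesis by (intro eventually_happens') auto
qed

text \<open>
  A segment from \<open>x\<close> can meet a set \<open>G\<close> that does not contain \<open>x\<close> only if its other end lies in
  the affine hull of \<open>G\<close> and \<open>x\<close>. This hull is a proper affine subspace, so almost all choices of
  the other end are good.
\<close>

lemma generic_segment:
  fixes U1 U2 :: "'a::euclidean_space set"
  assumes U: "open U1" "U1 \<noteq> {}" "open U2" "U2 \<noteq> {}" and \<G>: "finite \<G>"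
    and dim: "\<And>G. G \<in> \<G> \<Longrightarrow> aff_dim G + 2 \<le> int DIM('a)"
  shows "\<exists>x\<in>U1. \<exists>y\<in>U2. \<forall>G\<in>\<G>. closed_segment x y \<inter> G = {}"
proof -
  have neg: "negligible G" if "aff_dim G < int DIM('a)" for G :: "'a set"
  proof -
    obtain a b where "a \<noteq> 0" "G \<subseteq> {x. a \<bullet> x = b}"
      using aff_lowdim_subset_hyperplane[OF \<open>aff_dim G < _\<close>] by metis
    then show ?thesis using negligible_hyperplane[of a b] negligible_subset by blast
  qed
  have pick: "\<exists>x\<in>U. x \<notin> \<Union>\<H>" if "open U" "U \<noteq> {}" "finite \<H>" "\<And>H. H \<in> \<H> \<Longrightarrow> negligible H"
    for U :: "'a set" and \<H>
  proof (rule ccontr)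
    assume "\<not> (\<exists>x\<in>U. x \<notin> \<Union>\<H>)"
    then have "U \<subseteq> \<Union>\<H>" by auto
    moreover have "negligible (\<Union>\<H>)" by (rule negligible_Union[OF that(3,4)])
    ultimately show False using open_not_negligible[OF that(1,2)] negligible_subset by blast
  qed
  have "negligible G" if "G \<in> \<G>" for G using dim[OF that] by (intro neg) linarith
  then obtain x where x: "x \<in> U1" "x \<notin> \<Union>\<G>" using pick[OF U(1,2) \<G>] by blast
  have "negligible (affine hull (insert x G))" if "G \<in> \<G>" for G
    using dim[OF that] by (intro neg) (auto simp: aff_dim_insert)
  then have "\<exists>y\<in>U2. y \<notin> \<Union>((\<lambda>G. affine hull (insert x G)) ` \<G>)"
    using \<G> by (intro pick[OF U(3,4)]) auto
  then obtain y where y: "y \<in> U2" "\<forall>G\<in>\<G>. y \<notin> affine hull (insert x G)" by auto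
  have "closed_segment x y \<inter> G = {}" if G: "G \<in> \<G>" for G
  proof (rule ccontr)
    assume "closed_segment x y \<inter> G \<noteq> {}"
    then obtain z where z: "z \<in> closed_segment x y" "z \<in> G" by auto
    then obtain u where u: "0 \<le> u" "z = (1 - u) *\<^sub>R x + u *\<^sub>R y" by (auto simp: in_segment)
    have "u \<noteq> 0" using z(2) x(2) G u(2) by auto
    then have "y = (1 - 1 / u) *\<^sub>R x + (1 / u) *\<^sub>R z"
      unfolding u(2) by (simp add: algebra_simps diff_divide_distrib flip: scaleR_add_left)
    moreover have "(1 - 1 / u) *\<^sub>R x + (1 / u) *\<^sub>R z \<in> affine hull (insert x G)"
      using z(2) by (intro mem_affine[OF affine_affine_hull]) (auto intro: hull_inc)
    ultimately show False using y(2) G by auto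
  qed
  then show ?thesis using x(1) y(1) by blast
qed

text \<open>
  The faces of codimension two of all elements.
\<close>

definition skeleton2 :: "(real^'d::finite) set set \<Rightarrow> (real^'d) set set" where
  "skeleton2 \<T> = (\<Union>E\<in>\<T>. \<Union>p\<in>vertices E. \<Union>q\<in>vertices E - {p}. {convex hull (vertices E - {p, q})})"

lemma skeleton2_finite: "simplicial_mesh \<Omega> \<T> \<Longrightarrow> finite (skeleton2 \<T>)"
  unfolding skeleton2_def
  by (intro finite_UN_I mesh_finite finite_Diff finite.intros affine_frame_finite mesh_element(1)) auto

lemma skeleton2_dim:
  fixes \<T> :: "(real^'d::finite) set set"
  assumes m: "simplicial_mesh \<Omega> \<T>" and G: "G \<in> skeleton2 \<T>"
  shows "aff_dim G + 2 \<le> int DIM(real^'d)"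
proof -
  obtain E p q where E: "E \<in> \<T>" "p \<in> vertices E" "q \<in> vertices E" "q \<noteq> p" "G = convex hull (vertices E - {p, q})"
    using G by (auto simp: skeleton2_def)
  note V = mesh_element(1)[OF m E(1)]
  have "\<not> affine_dependent (vertices E - {p, q})"
    using V by (simp add: affine_frame_def affine_independent_Diff)
  then have "aff_dim G = int (card (vertices E - {p, q})) - 1"
    by (simp add: E(5) aff_dim_convex_hull aff_dim_affine_independent)
  also have "card (vertices E - {p, q}) = card (vertices E) - 2"
    using E by (simp add: card_Diff_subset)
  finally show ?thesis using V by (simp add: affine_frame_def of_nat_diff)
qed

lemma off_skeleton_bary:
  assumes m: "simplicial_mesh \<Omega> \<T>" and E: "E \<in> \<T>" and z: "z \<in> E" "z \<notin> \<Union>(skeleton2 \<T>)"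
    and p: "p \<in> vertices E" "bary (vertices E) p z = 0" and q: "q \<in> vertices E" "q \<noteq> p"
  shows "0 < bary (vertices E) q z"
proof (rule ccontr)
  let ?V = "vertices E"
  note V = mesh_element(1)[OF m E] and fin = affine_frame_finite[OF mesh_element(1)[OF m E]]
  have nn: "\<forall>q\<in>?V. 0 \<le> bary ?V q z" using z(1) mesh_element(2)[OF m E] bary_mem_hull[OF V] by auto
  assume "\<not> 0 < bary ?V q z"
  then have q0: "bary ?V q z = 0" using nn q(1) by force
  have f: "finite (?V - {p, q})" using fin by simp
  have "(\<Sum>x\<in>?V. bary ?V x z) = (\<Sum>x\<in>?V - {p, q}. bary ?V x z)"
    by (rule sum.mono_neutral_right) (use fin p(2) q0 in auto)
  moreover have "(\<Sum>x\<in>?V. bary ?V x z *\<^sub>R x) = (\<Sum>x\<in>?V - {p, q}. bary ?V x z *\<^sub>R x)"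
    by (rule sum.mono_neutral_right) (use fin p(2) q0 in auto)
  ultimately have "(\<Sum>x\<in>?V - {p, q}. bary ?V x z) = 1" "(\<Sum>x\<in>?V - {p, q}. bary ?V x z *\<^sub>R x) = z"
    using bary_sum[OF V, of z] bary_combination[OF V, of z] by metis+
  then have "z \<in> convex hull (?V - {p, q})"
    unfolding convex_hull_finite[OF f] using nn by auto
  moreover have "convex hull (?V - {p, q}) \<in> skeleton2 \<T>"
    using E p q by (auto simp: skeleton2_def)
  ultimately show False using z(2) by auto
qed

text \<open>
  The intersection is a face of \<open>E\<close>. It contains a point at which at most the coordinate of \<open>p\<close>
  vanishes, so it contains the facet opposite \<open>p\<close>, and it is not all of \<open>E\<close>. Hence it is that
  facet. As it is also a face of \<open>E'\<close>, its vertices are all but one of those of \<open>E'\<close>.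
\<close>

lemma shared_facet:
  assumes m: "simplicial_mesh \<Omega> \<T>" and E: "E \<in> \<T>" "E' \<in> \<T>" "E \<noteq> E'" and z: "z \<in> E" "z \<in> E'"
    and p: "p \<in> vertices E" and pos: "\<And>q. q \<in> vertices E \<Longrightarrow> q \<noteq> p \<Longrightarrow> 0 < bary (vertices E) q z"
  shows "\<exists>p'\<in>vertices E'. vertices E - {p} = vertices E' - {p'}" "E \<inter> E' = convex hull (vertices E - {p})"
proof -
  let ?V = "vertices E" and ?V' = "vertices E'"
  note V = mesh_element(1)[OF m E(1)] and V' = mesh_element(1)[OF m E(2)]
  have hull: "convex hull ?V = E" "convex hull ?V' = E'" using mesh_element(2)[OF m] E by auto
  have ind: "\<not> affine_dependent ?V" "\<not> affine_dependent ?V'" using V V' by (auto simp: affine_frame_def)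
  have finV: "finite ?V" by (rule affine_frame_finite[OF V])
  have nE: "\<not> E \<subseteq> E'"
  proof
    assume "E \<subseteq> E'"
    moreover obtain x where "x \<in> interior E" using mesh_interior_nonempty[OF m E(1)] by auto
    ultimately show False using mesh_interior_inter[OF m E(1,2)] E(3) interior_subset[of E] by auto
  qed
  have face: "E \<inter> E' face_of convex hull ?V" "E \<inter> E' face_of convex hull ?V'"
    using mesh_face[OF m E(1,2)] mesh_face[OF m E(2,1)] by (simp_all add: hull Int_commute)
  obtain C where C: "C \<subseteq> ?V" "E \<inter> E' = convex hull C"
    using face(1) unfolding face_of_convex_hull_affine_independent[OF ind(1)] by auto
  obtain C' where C': "C' \<subseteq> ?V'" "E \<inter> E' = convex hull C'"
    using face(2) unfolding face_of_convex_hull_affine_independent[OF ind(2)] by auto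
  have iC: "\<not> affine_dependent C" "\<not> affine_dependent C'" using ind C(1) C'(1) affine_independent_subset by auto
  have CC': "C = C'"
  proof -
    have "x \<in> C \<longleftrightarrow> x \<in> C'" for x
      using extreme_point_of_convex_hull_affine_independent[OF iC(1), of x]
        extreme_point_of_convex_hull_affine_independent[OF iC(2), of x] C(2) C'(2) by simp
    then show ?thesis by auto
  qed
  have sub: "?V - {p} \<subseteq> C"
  proof (rule subsetI, rule ccontr)
    fix q assume q: "q \<in> ?V - {p}" "q \<notin> C"
    have "z \<in> convex hull C" using z C(2) by auto
    then have "z \<in> convex hull (?V - {q})" using C(1) q(2) hull_mono[of C "?V - {q}" convex] by auto
    then have "bary ?V q z = 0" using bary_mem_facet[OF V, of q z] q by auto
    then show False using pos[of q] q by auto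
  qed
  have "C \<noteq> ?V" using nE C(2) hull(1) by auto
  then have Cp: "C = ?V - {p}" using sub C(1) by auto
  then show "E \<inter> E' = convex hull (?V - {p})" using C(2) by simp
  have "card (?V' - C) = 1"
    using C'(1) V V' p finV unfolding CC'[symmetric] Cp
    by (subst card_Diff_subset) (auto simp: affine_frame_def)
  then obtain p' where "?V' - C = {p'}" by (auto simp: card_1_singleton_iff)
  then have "p' \<in> ?V'" "C = ?V' - {p'}" using C'(1) CC' by auto
  then show "\<exists>p'\<in>?V'. ?V - {p} = ?V' - {p'}" using Cp by auto
qed

lemma mesh_facet_point:
  assumes m: "simplicial_mesh \<Omega> \<T>" and E: "E \<in> \<T>" and z: "z \<in> E" "z \<notin> interior E" "z \<notin> \<Union>(skeleton2 \<T>)"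
  obtains p where "p \<in> vertices E" "bary (vertices E) p z = 0"
    "\<And>q. q \<in> vertices E \<Longrightarrow> q \<noteq> p \<Longrightarrow> 0 < bary (vertices E) q z"
proof -
  note V = mesh_element(1)[OF m E] and hull = mesh_element(2)[OF m E]
  obtain p where p: "p \<in> vertices E" "\<not> 0 < bary (vertices E) p z"
    using z(2) bary_mem_interior[OF V, of z] hull by auto
  then have "bary (vertices E) p z = 0"
    using z(1) bary_mem_hull[OF V, of z] hull by force
  then show ?thesis using off_skeleton_bary[OF m E z(1,3) p(1)] p(1) that by blast
qed

lemma mesh_element_near:
  assumes m: "simplicial_mesh \<Omega> \<T>" and E: "E \<in> \<T>" and z: "z \<in> E" "open N" "z \<in> N"
  shows "open (interior E \<inter> N) \<and> interior E \<inter> N \<noteq> {}"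
proof -
  have "z \<in> closure (interior E)"
    using convex_closure_interior[OF mesh_element(4)[OF m E] mesh_interior_nonempty[OF m E]] z(1) closure_subset by auto
  then show ?thesis using z by (auto simp: closure_iff_nhds_not_empty open_Int)
qed

text \<open>
  If \<open>\<U>\<close> were not everything, the union of its elements and the union of the others would share a
  point of \<open>\<Omega>\<close>, because \<open>\<Omega>\<close> is connected. In a small ball around it, a generic segment leads from
  one union to the other. The point where it crosses lies on no face of codimension two, so it
  lies on a facet that belongs to both unions, against the closure property of \<open>\<U>\<close>.
\<close>

lemma mesh_facet_connected:
  assumes d: "polyhedral_domain \<Omega>" and m: "simplicial_mesh \<Omega> \<T>"
    and U: "\<U> \<subseteq> \<T>" "\<U> \<noteq> {}"
    and step: "\<And>E E' p p'. E \<in> \<U> \<Longrightarrow> E' \<in> \<T> \<Longrightarrow> E \<noteq> E' \<Longrightarrow> p \<in> vertices E \<Longrightarrow> p' \<in> vertices E' \<Longrightarrow>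
      vertices E - {p} = vertices E' - {p'} \<Longrightarrow> E' \<in> \<U>"
  shows "\<U> = \<T>"
proof (rule ccontr)
  assume "\<U> \<noteq> \<T>"
  have cl: "closed (\<Union>\<A>)" if "\<A> \<subseteq> \<T>" for \<A>
    using that mesh_finite[OF m] mesh_element(3)[OF m]
    by (intro closed_Union) (auto intro: finite_subset compact_imp_closed)
  have cover: "\<Omega> \<subseteq> \<Union>\<U> \<union> \<Union>(\<T> - \<U>)"
  proof -
    have "\<Union>\<U> \<union> \<Union>(\<T> - \<U>) = \<Union>\<T>" using U(1) by auto
    then show ?thesis using m closure_subset[of \<Omega>] by (simp add: simplicial_mesh_def)
  qed
  have meets: "E \<inter> \<Omega> \<noteq> {}" if E: "E \<in> \<T>" for E
  proof -
    obtain x where "x \<in> interior E" using mesh_interior_nonempty[OF m E] by auto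
    then have "x \<in> E \<inter> \<Omega>" using mesh_interior_subset[OF d m E] interior_subset[of E] by auto
    then show ?thesis by auto
  qed
  have clU: "closed (\<Union>\<U>)" "closed (\<Union>(\<T> - \<U>))" using cl U(1) by auto
  have ne: "\<Union>\<U> \<inter> \<Omega> \<noteq> {}" "\<Union>(\<T> - \<U>) \<inter> \<Omega> \<noteq> {}" using meets U \<open>\<U> \<noteq> \<T>\<close> by blast+
  have "connected \<Omega>" using d by (simp add: polyhedral_domain_def)
  then have "\<Union>\<U> \<inter> \<Union>(\<T> - \<U>) \<inter> \<Omega> \<noteq> {}"
    using connected_closedD[OF _ _ cover clU] ne by blast
  then obtain z E E' where z: "z \<in> \<Omega>" "z \<in> E" "z \<in> E'" "E \<in> \<U>" "E' \<in> \<T> - \<U>" by blast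
  obtain e where e: "0 < e" "ball z e \<subseteq> \<Omega>" using domain_sets(1)[OF d] z(1) open_contains_ball by blast
  have "open (interior E \<inter> ball z e) \<and> interior E \<inter> ball z e \<noteq> {}"
    using z U e by (intro mesh_element_near[OF m]) auto
  moreover have "open (interior E' \<inter> ball z e) \<and> interior E' \<inter> ball z e \<noteq> {}"
    using z e by (intro mesh_element_near[OF m]) auto
  ultimately obtain x y where xy: "x \<in> interior E \<inter> ball z e" "y \<in> interior E' \<inter> ball z e"
    "\<forall>G\<in>skeleton2 \<T>. closed_segment x y \<inter> G = {}"
    using generic_segment[of "interior E \<inter> ball z e" "interior E' \<inter> ball z e" "skeleton2 \<T>"]
      skeleton2_finite[OF m] skeleton2_dim[OF m] by blast
  have seg: "closed_segment x y \<subseteq> \<Omega>"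
    using xy e(2) closed_segment_subset[of x "ball z e" y] by auto
  then have cover': "closed_segment x y \<subseteq> \<Union>\<U> \<union> \<Union>(\<T> - \<U>)" using cover by blast
  have "x \<in> \<Union>\<U> \<inter> closed_segment x y" "y \<in> \<Union>(\<T> - \<U>) \<inter> closed_segment x y"
    using xy z interior_subset by auto
  then have "\<Union>\<U> \<inter> \<Union>(\<T> - \<U>) \<inter> closed_segment x y \<noteq> {}"
    using connected_closedD[OF connected_segment(1) _ cover' clU] by blast
  then obtain t F F' where t: "t \<in> closed_segment x y" "t \<in> F" "t \<in> F'" "F \<in> \<U>" "F' \<in> \<T> - \<U>" by blast
  have F: "F \<in> \<T>" "F' \<in> \<T>" "F \<noteq> F'" using t U by auto
  have off: "t \<notin> \<Union>(skeleton2 \<T>)" using t(1) xy(3) by blast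
  have "t \<notin> interior F" using mesh_interior_inter[OF m F(1,2) _ t(3)] F(3) by auto
  then obtain p where p: "p \<in> vertices F" "\<And>q. q \<in> vertices F \<Longrightarrow> q \<noteq> p \<Longrightarrow> 0 < bary (vertices F) q t"
    using mesh_facet_point[OF m F(1) t(2) _ off] by metis
  then obtain p' where "p' \<in> vertices F'" "vertices F - {p} = vertices F' - {p'}"
    using shared_facet(1)[OF m F t(2,3) p] by blast
  then show False using step[OF t(4) F(2,3) p(1)] t(5) by auto
qed

lemma bary_affine:
  assumes V: "affine_frame V"
  shows "bary W p y = (\<Sum>q\<in>V. bary V q y * bary W p q)"
proof -
  have "bary W p y = bary_grad W p \<bullet> (\<Sum>q\<in>V. bary V q y *\<^sub>R q) + (\<Sum>q\<in>V. bary V q y) * snd (bary_coeffs W) p"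
    by (simp add: bary_def[of W] bary_sum[OF V] bary_combination[OF V])
  also have "\<dots> = (\<Sum>q\<in>V. bary V q y * bary W p q)"
    by (simp add: bary_def[of W] inner_sum_right sum_distrib_right sum.distrib distrib_left)
  finally show ?thesis .
qed

text \<open>
  The opposite vertex \<open>p'\<close> lies strictly beyond the facet as seen from \<open>E\<close>; otherwise points of
  \<open>E'\<close> near \<open>z\<close> would belong to \<open>E\<close> without lying on the common facet. So the coordinates of \<open>p\<close>
  and \<open>p'\<close> are negative multiples of each other, and a neighbourhood of \<open>z\<close> is covered by the two
  elements.
\<close>

lemma shared_facet_interior:
  assumes m: "simplicial_mesh \<Omega> \<T>" and E: "E \<in> \<T>" "E' \<in> \<T>" "E \<noteq> E'"
    and p: "p \<in> vertices E" "p' \<in> vertices E'" and F: "vertices E - {p} = vertices E' - {p'}"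
    and EE': "E \<inter> E' = convex hull (vertices E - {p})"
    and z: "bary (vertices E) p z = 0" "\<And>q. q \<in> vertices E \<Longrightarrow> q \<noteq> p \<Longrightarrow> 0 < bary (vertices E) q z"
  shows "z \<in> interior (E \<union> E')"
proof -
  let ?V = "vertices E" and ?V' = "vertices E'"
  note V = mesh_element(1)[OF m E(1)] and V' = mesh_element(1)[OF m E(2)]
  have fin: "finite ?V" "finite ?V'" by (intro affine_frame_finite V V')+
  have hull: "convex hull ?V = E" "convex hull ?V' = E'" using mesh_element(2)[OF m] E by auto
  have R: "q \<in> ?V \<and> q \<noteq> p \<longleftrightarrow> q \<in> ?V' \<and> q \<noteq> p'" for q using F by blast
  have zV': "bary ?V' q z = bary ?V q z" if q: "q \<in> ?V" "q \<noteq> p" for q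
  proof -
    let ?u = "\<lambda>q. if q = p' then 0 else bary ?V q z"
    have "(\<Sum>q\<in>?V'. ?u q) = (\<Sum>q\<in>?V' - {p'}. bary ?V q z)"
      by (rule sum.mono_neutral_cong_right) (use fin in auto)
    also have "\<dots> = (\<Sum>q\<in>?V. bary ?V q z)"
      unfolding F[symmetric] by (rule sum.mono_neutral_left) (use fin z in auto)
    finally have 1: "(\<Sum>q\<in>?V'. ?u q) = 1" by (simp add: bary_sum[OF V])
    have "(\<Sum>q\<in>?V'. ?u q *\<^sub>R q) = (\<Sum>q\<in>?V' - {p'}. bary ?V q z *\<^sub>R q)"
      by (rule sum.mono_neutral_cong_right) (use fin in auto)
    also have "\<dots> = (\<Sum>q\<in>?V. bary ?V q z *\<^sub>R q)"
      unfolding F[symmetric] by (rule sum.mono_neutral_left) (use fin z in auto)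
    finally have 2: "(\<Sum>q\<in>?V'. ?u q *\<^sub>R q) = z" by (simp add: bary_combination[OF V])
    show ?thesis using bary_unique[OF V' 1 2, of q] q R[of q] by auto
  qed
  have zE: "z \<in> E" "z \<in> E'"
  proof -
    have "z \<in> convex hull (?V - {p})"
      unfolding bary_mem_facet[OF V p(1)] bary_mem_hull[OF V] using z by (metis less_imp_le order_refl)
    then show "z \<in> E" "z \<in> E'" using EE' by auto
  qed
  have opp: "bary ?V p p' < 0"
  proof (rule ccontr)
    assume n: "\<not> bary ?V p p' < 0"
    let ?y = "\<lambda>t. (1 - t) *\<^sub>R z + t *\<^sub>R p'"
    have y: "bary W q (?y t) = (1 - t) * bary W q z + t * bary W q p'" for W q t
      by (simp add: bary_def inner_simps algebra_simps)
    have "\<forall>q\<in>?V. \<forall>\<^sub>F t in at_right 0. 0 \<le> bary ?V q (?y t)"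
    proof
      fix q assume q: "q \<in> ?V"
      show "\<forall>\<^sub>F t in at_right 0. 0 \<le> bary ?V q (?y t)"
      proof (cases "q = p")
        case True
        then show ?thesis using n z(1) by (auto simp: y eventually_at_filter intro!: always_eventually)
      next
        case False
        have "((\<lambda>t. bary ?V q (?y t)) \<longlongrightarrow> (1 - 0) * bary ?V q z + 0 * bary ?V q p') (at_right 0)"
          unfolding y by (intro tendsto_intros)
        then have "\<forall>\<^sub>F t in at_right 0. 0 < bary ?V q (?y t)"
          using z(2)[OF q False] by (intro order_tendstoD) auto
        then show ?thesis by eventually_elim simp
      qed
    qed
    then have "\<forall>\<^sub>F t in at_right 0. \<forall>q\<in>?V. 0 \<le> bary ?V q (?y t)" using fin by (simp add: eventually_ball_finite)
    then obtain t where t: "0 < t" "t < 1" "\<forall>q\<in>?V. 0 \<le> bary ?V q (?y t)"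
      using at_right_happens by blast
    have "?y t \<in> E" using t(3) bary_mem_hull[OF V] hull by auto
    moreover have "p' \<in> E'" using p(2) hull(2) hull_inc by metis
    then have "?y t \<in> E'"
      using mesh_element(4)[OF m E(2)] zE(2) t by (intro convexD) auto
    ultimately have "?y t \<in> convex hull (?V' - {p'})" using EE' F by auto
    then have "bary ?V' p' (?y t) = 0" using bary_mem_facet[OF V' p(2)] by blast
    moreover have "z \<in> convex hull (?V' - {p'})" using zE EE' F by auto
    then have "bary ?V' p' z = 0" using bary_mem_facet[OF V' p(2)] by blast
    ultimately show False using t(1) by (simp add: y bary_vertex[OF V' p(2) p(2)])
  qed
  have rel: "bary ?V p y = bary ?V' p' y * bary ?V p p'" for y
  proof -
    have "bary ?V p y = (\<Sum>q\<in>?V'. if q = p' then bary ?V' p' y * bary ?V p p' else 0)"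
    proof (rule trans[OF bary_affine[OF V', of ?V p y]], rule sum.cong[OF refl])
      fix q assume "q \<in> ?V'"
      then show "bary ?V' q y * bary ?V p q = (if q = p' then bary ?V' p' y * bary ?V p p' else 0)"
        using R[of q] by (auto simp: bary_vertex[OF V p(1)])
    qed
    then show ?thesis using fin p by simp
  qed
  define N where "N = (\<Inter>q\<in>?V - {p}. {y. 0 < bary ?V q y} \<inter> {y. 0 < bary ?V' q y})"
  have "open N" unfolding N_def
    using fin by (intro open_INT ballI open_Int open_Collect_less continuous_intros) auto
  moreover have "z \<in> N" using z zV' by (auto simp: N_def)
  moreover have "N \<subseteq> E \<union> E'"
  proof
    fix y assume y: "y \<in> N"
    show "y \<in> E \<union> E'"
    proof (cases "0 \<le> bary ?V p y")
      case True
      then have "0 \<le> bary ?V q y" if "q \<in> ?V" for q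
        using y that by (cases "q = p") (auto simp: N_def less_imp_le)
      then show ?thesis using bary_mem_hull[OF V] hull by auto
    next
      case False
      then have "0 \<le> bary ?V' p' y" using opp rel[of y] by (smt (verit) mult_nonpos_nonpos)
      then have "0 \<le> bary ?V' q y" if "q \<in> ?V'" for q
        using y that R[of q] by (cases "q = p'") (auto simp: N_def less_imp_le)
      then show ?thesis using bary_mem_hull[OF V'] hull by auto
    qed
  qed
  ultimately show ?thesis by (rule interiorI)
qed

text \<open>
  If the facet reached a point \<open>u\<close> of \<open>\<Omega>\<close>, it would also do so at a point \<open>c\<close> of its relative
  interior. Points just beyond \<open>c\<close> lie in \<open>\<Omega>\<close>, hence in another element, which then shares the
  facet. The two elements would cover a neighbourhood of \<open>z\<close>.
\<close>

lemma facet_of_boundary_point: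
  assumes d: "polyhedral_domain \<Omega>" and m: "simplicial_mesh \<Omega> \<T>"
    and E: "E \<in> \<T>" and z: "z \<in> frontier \<Omega>" and p: "p \<in> vertices E" "bary (vertices E) p z = 0"
    and pos: "\<And>q. q \<in> vertices E \<Longrightarrow> q \<noteq> p \<Longrightarrow> 0 < bary (vertices E) q z"
  shows "convex hull (vertices E - {p}) \<subseteq> frontier \<Omega>"
proof (rule ccontr)
  let ?V = "vertices E" and ?F = "convex hull (vertices E - {p})"
  note V = mesh_element(1)[OF m E] and hull = mesh_element(2)[OF m E]
  have un: "\<Union>\<T> = closure \<Omega>" and int: "interior (closure \<Omega>) = \<Omega>"
    using m d unfolding simplicial_mesh_def polyhedral_domain_def by blast+
  have op: "open \<Omega>" by (rule domain_sets(1)[OF d])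
  have "?F \<subseteq> E" using hull hull_mono[of "?V - {p}" ?V convex] by auto
  then have "?F \<subseteq> closure \<Omega>" using un E by auto
  moreover assume "\<not> ?F \<subseteq> frontier \<Omega>"
  ultimately obtain u where u: "u \<in> ?F" "u \<in> \<Omega>" using op by (auto simp: frontier_def interior_open)
  have zn: "z \<notin> \<Omega>" using z op by (auto simp: frontier_def interior_open)
  have ub: "0 \<le> bary ?V q u" if "q \<in> ?V" for q
    using u(1) bary_mem_facet[OF V p(1)] bary_mem_hull[OF V] that by blast
  have up: "bary ?V p u = 0" using u(1) bary_mem_facet[OF V p(1)] by blast
  have comb: "bary ?V q ((1 - t) *\<^sub>R a + t *\<^sub>R b) = (1 - t) * bary ?V q a + t * bary ?V q b" for q t a b
    by (simp add: bary_def inner_simps algebra_simps)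
  have near: "\<forall>\<^sub>F t in at_right 0. (1 - t) *\<^sub>R a + t *\<^sub>R b \<in> \<Omega>" if "a \<in> \<Omega>" for a b
  proof -
    have "((\<lambda>t. (1 - t) *\<^sub>R a + t *\<^sub>R b) \<longlongrightarrow> (1 - 0) *\<^sub>R a + 0 *\<^sub>R b) (at_right 0)" by (intro tendsto_intros)
    then show ?thesis using op that by (intro topological_tendstoD) auto
  qed
  have "\<forall>\<^sub>F t in at_right 0. (1 - t) *\<^sub>R u + t *\<^sub>R z \<in> \<Omega>" by (rule near[OF u(2)])
  then obtain t where t: "0 < t" "t < 1" "(1 - t) *\<^sub>R u + t *\<^sub>R z \<in> \<Omega>"
    using at_right_happens by blast
  define c where "c = (1 - t) *\<^sub>R u + t *\<^sub>R z"
  have c: "c \<in> \<Omega>" using t(3) by (simp add: c_def)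
  have cp: "bary ?V p c = 0" by (simp add: c_def comb up p(2))
  have cq: "0 < bary ?V q c" if "q \<in> ?V" "q \<noteq> p" for q
    using ub[OF that(1)] pos[OF that] t(1,2) by (simp add: c_def comb add_nonneg_pos)
  have cE: "c \<in> E"
  proof -
    have "\<forall>q\<in>?V. 0 \<le> bary ?V q c" using cp cq by (metis less_imp_le order_refl)
    then show ?thesis using bary_mem_hull[OF V] hull by auto
  qed
  have "c \<in> \<Union>(\<T> - {E})"
  proof (rule ccontr)
    assume c': "c \<notin> \<Union>(\<T> - {E})"
    have "closed (\<Union>(\<T> - {E}))"
      using mesh_finite[OF m] mesh_element(3)[OF m] by (intro closed_Union) (auto intro: compact_imp_closed)
    then have op': "open (\<Omega> - \<Union>(\<T> - {E}))" using op by (intro open_Diff)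
    \<comment> \<open>leaving \<open>E\<close> through the facet, in the direction away from \<open>p\<close>\<close>
    have "((\<lambda>s. c + s *\<^sub>R (c - p)) \<longlongrightarrow> c + 0 *\<^sub>R (c - p)) (at_right 0)" by (intro tendsto_intros)
    then have "\<forall>\<^sub>F s in at_right 0. c + s *\<^sub>R (c - p) \<in> \<Omega> - \<Union>(\<T> - {E})"
      using op' c c' by (intro topological_tendstoD) auto
    then obtain s where s: "0 < s" "c + s *\<^sub>R (c - p) \<in> \<Omega> - \<Union>(\<T> - {E})"
      using at_right_happens by blast
    then have "c + s *\<^sub>R (c - p) \<in> E" using un closure_subset[of \<Omega>] by blast
    then have "0 \<le> bary ?V p (c + s *\<^sub>R (c - p))" using bary_mem_hull[OF V] hull p(1) by auto
    also have "bary ?V p (c + s *\<^sub>R (c - p)) = bary ?V p c + s * (bary ?V p c - bary ?V p p)"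
      by (simp add: bary_def inner_simps algebra_simps)
    also have "\<dots> = - s" using cp p(1) by (simp add: bary_vertex[OF V])
    finally show False using s(1) by simp
  qed
  then obtain E' where E': "E' \<in> \<T>" "E \<noteq> E'" "c \<in> E'" by auto
  obtain p' where p': "p' \<in> vertices E'" "?V - {p} = vertices E' - {p'}"
    using shared_facet(1)[OF m E E'(1,2) cE E'(3) p(1) cq] by auto
  have "z \<in> interior (E \<union> E')"
    using shared_facet(2)[OF m E E'(1,2) cE E'(3) p(1) cq]
    by (intro shared_facet_interior[OF m E E'(1,2) p(1) p' _ p(2) pos]) auto
  then have "z \<in> interior (closure \<Omega>)"
    using interior_mono[of "E \<union> E'" "closure \<Omega>"] un E E'(1) by blast
  then show False using zn int by simp
qed

text \<open>
  Near a point of the relatively open part of \<open>\<Gamma>D\<close>, a generic segment leads from \<open>\<Omega>\<close> to the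
  complement of its closure. It crosses the frontier at a point \<open>z\<close> off the faces of codimension
  two, so \<open>z\<close> lies on a facet contained in the frontier. As \<open>z\<close> is not in the closure of \<open>\<Gamma>N\<close>, the
  mesh condition puts this facet into the closure of \<open>\<Gamma>D\<close>.
\<close>

lemma dirichlet_facet:
  assumes d: "polyhedral_domain \<Omega>" and b: "boundary_parts \<Omega> \<Gamma>D \<Gamma>N" and m: "simplicial_mesh \<Omega> \<T>"
    and res: "mesh_resolves_boundary \<Omega> \<Gamma>D \<Gamma>N \<T>"
  shows "\<exists>E\<in>\<T>. \<exists>p\<in>vertices E. convex hull (vertices E - {p}) \<subseteq> closure \<Gamma>D"
proof -
  have un: "\<Union>\<T> = closure \<Omega>" and int: "interior (closure \<Omega>) = \<Omega>"
    using m d unfolding simplicial_mesh_def polyhedral_domain_def by blast+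
  have op: "open \<Omega>" by (rule domain_sets(1)[OF d])
  obtain S where S: "openin (top_of_set (frontier \<Omega>)) S" "S \<subseteq> \<Gamma>D" "\<Gamma>D \<subseteq> closure S"
    using b by (auto simp: boundary_parts_def surface_piece_def)
  have "S \<noteq> {}" using S(3) b by (auto simp: boundary_parts_def)
  then obtain N where N: "open N" "S = frontier \<Omega> \<inter> N" using S(1) by (auto simp: openin_open)
  obtain w where w: "w \<in> frontier \<Omega>" "w \<in> N" using \<open>S \<noteq> {}\<close> N by auto
  obtain e where e: "0 < e" "ball w e \<subseteq> N" using N(1) w(2) open_contains_ball by blast
  have "w \<in> closure \<Omega>" "w \<notin> interior (closure \<Omega>)" using w(1) int op by (auto simp: frontier_def interior_open)
  then have 1: "\<Omega> \<inter> ball w e \<noteq> {}"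
    using open_Int_closure_eq_empty[of "ball w e" \<Omega>] centre_in_ball[of w e] e(1) by blast
  have 2: "ball w e - closure \<Omega> \<noteq> {}"
    using \<open>w \<notin> interior (closure \<Omega>)\<close> e(1) by (auto simp: mem_interior)
  obtain x y where xy: "x \<in> \<Omega> \<inter> ball w e" "y \<in> ball w e - closure \<Omega>"
    "\<forall>G\<in>skeleton2 \<T>. closed_segment x y \<inter> G = {}"
    using generic_segment[OF _ 1 _ 2 skeleton2_finite[OF m] skeleton2_dim[OF m]] op
    by (metis open_Int open_ball open_Diff closed_closure)
  have "closed_segment x y \<inter> closure \<Omega> \<noteq> {}" "closed_segment x y - closure \<Omega> \<noteq> {}"
    using xy closure_subset[of \<Omega>] by auto
  then obtain z where z: "z \<in> closed_segment x y" "z \<in> frontier (closure \<Omega>)"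
    using connected_Int_frontier[OF connected_segment(1), of x y "closure \<Omega>"] by auto
  have zf: "z \<in> frontier \<Omega>" using z(2) by (simp add: frontier_def int interior_open[OF op])
  have "z \<in> N" using z(1) xy e(2) closed_segment_subset[of x "ball w e" y] by auto
  have "z \<in> \<Union>\<T>" using zf un by (auto simp: frontier_def)
  then obtain E where E: "E \<in> \<T>" "z \<in> E" by auto
  have off: "z \<notin> \<Union>(skeleton2 \<T>)" using z(1) xy(3) by blast
  have "z \<notin> interior E" using mesh_interior_subset[OF d m E(1)] zf op by (auto simp: frontier_def interior_open)
  then obtain p where p: "p \<in> vertices E" "bary (vertices E) p z = 0"
    "\<And>q. q \<in> vertices E \<Longrightarrow> q \<noteq> p \<Longrightarrow> 0 < bary (vertices E) q z"
    using mesh_facet_point[OF m E _ off] by metis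
  let ?F = "convex hull (vertices E - {p})"
  note V = mesh_element(1)[OF m E(1)]
  have zF: "z \<in> ?F"
    using bary_mem_facet[OF V p(1), of z] p(2) E(2) mesh_element(2)[OF m E(1)] by auto
  have "?F facet_of convex hull (vertices E)"
    using V p(1) affine_frame_other[OF V, of p]
    by (subst facet_of_convex_hull_affine_independent) (auto simp: affine_frame_def)
  then have "?F facet_of E" by (simp add: mesh_element(2)[OF m E(1)])
  moreover have "?F \<subseteq> frontier \<Omega>" by (rule facet_of_boundary_point[OF d m E(1) zf p])
  ultimately have "?F \<subseteq> closure \<Gamma>D \<or> ?F \<subseteq> closure \<Gamma>N"
    using res E(1) by (auto simp: mesh_resolves_boundary_def)
  moreover have "z \<notin> closure \<Gamma>N"
  proof -
    have "N \<inter> \<Gamma>N = {}" using N(2) S(2) b by (auto simp: boundary_parts_def)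
    then show ?thesis using \<open>z \<in> N\<close> open_Int_closure_eq_empty[OF N(1), of \<Gamma>N] by blast
  qed
  ultimately have "?F \<subseteq> closure \<Gamma>D" using zF by blast
  then show ?thesis using E(1) p(1) by blast
qed

section \<open>The stress matrix\<close>

lemma vertex_value_eq:
  assumes "(\<phi> \<longlongrightarrow> l) (at r within interior E)" "at r within interior E \<noteq> bot"
  shows "vertex_value E \<phi> r = l"
  unfolding vertex_value_def using assms by (intro tendsto_Lim) auto

lemma vertex_islimpt:
  assumes m: "simplicial_mesh \<Omega> \<T>" and E: "E \<in> \<T>" and r: "r \<in> vertices E"
  shows "at r within interior E \<noteq> bot"
proof -
  note V = mesh_element(1)[OF m E] and hull = mesh_element(2)[OF m E]
  have "closure (interior E) = closure E" by (rule convex_closure_interior[OF mesh_element(4)[OF m E] mesh_interior_nonempty[OF m E]])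
  moreover have "r \<in> E" using r hull hull_inc by metis
  ultimately have "r \<in> closure (interior E)" using closure_subset by auto
  moreover have "r \<notin> interior E"
  proof
    assume "r \<in> interior E"
    then have pos: "\<forall>q\<in>vertices E. 0 < bary (vertices E) q r" using bary_mem_interior[OF V] hull by auto
    obtain q where "q \<in> vertices E" "q \<noteq> r" by (rule affine_frame_other[OF V])
    then show False using pos bary_vertex[OF V _ r, of q] by auto
  qed
  ultimately have "r islimpt interior E" by (simp add: closure_def)
  then show ?thesis by (simp add: trivial_limit_within)
qed

context
  fixes \<Omega> :: "(real^'d::finite) set" and A :: "real^'d \<Rightarrow> real^'d^'d \<Rightarrow> real^'d^'d"
    and \<T> :: "(real^'d) set set" and \<tau> :: "'s::finite \<Rightarrow> real^'d \<Rightarrow> real^'d^'d" and \<Gamma>N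
  assumes d: "polyhedral_domain \<Omega>" and A: "material_tensor \<Omega> A" and m: "simplicial_mesh \<Omega> \<T>"
    and vv: "has_vertex_values \<T> A" and \<tau>: "fe_basis \<Omega> (Xh \<Omega> \<Gamma>N \<T>) \<tau>"
begin

lemma vertex_tensor_tendsto:
  assumes "E \<in> \<T>" "r \<in> vertices E"
  shows "((\<lambda>x. A x M) \<longlongrightarrow> vertex_value E (\<lambda>x. A x M) r) (at r within interior E)"
proof -
  obtain l where l: "((\<lambda>x. A x M) \<longlongrightarrow> l) (at r within interior E)"
    using vv assms unfolding has_vertex_values_def by blast
  then show ?thesis using vertex_value_eq[OF l vertex_islimpt[OF m assms]] by simp
qed

lemma eventually_in_domain:
  assumes "E \<in> \<T>"
  shows "\<forall>\<^sub>F x in at r within interior E. x \<in> interior E \<and> x \<in> \<Omega>"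
  using mesh_interior_subset[OF d m assms] by (auto simp: eventually_at_filter intro!: always_eventually)

lemma tendsto_on_element:
  assumes E: "E \<in> \<T>" and f: "(f \<longlongrightarrow> l) (at r within interior E)"
    and eq: "\<And>x. x \<in> interior E \<Longrightarrow> x \<in> \<Omega> \<Longrightarrow> f x = g x"
  shows "(g \<longlongrightarrow> l) (at r within interior E)"
proof (rule Lim_transform_eventually[OF f])
  show "\<forall>\<^sub>F x in at r within interior E. f x = g x"
    using eventually_in_domain[OF E, of r] by eventually_elim (simp add: eq)
qed

text \<open>
  All three properties hold at the points of \<open>\<Omega>\<close> with a uniform coercivity constant and are closed
  under limits.
\<close>

lemma vertex_tensor:
  assumes E: "E \<in> \<T>" and r: "r \<in> vertices E"
  defines "Ar \<equiv> \<lambda>M. vertex_value E (\<lambda>x. A x M) r"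
  shows "linear Ar" and "Ar M \<bullet> N = M \<bullet> Ar N"
    and "M \<noteq> 0 \<Longrightarrow> Ar M \<bullet> M > 0"
proof -
  have lim: "((\<lambda>x. A x M) \<longlongrightarrow> Ar M) (at r within interior E)" for M
    unfolding Ar_def by (rule vertex_tensor_tendsto[OF E r])
  note nb = vertex_islimpt[OF m E r]
  have tl: "\<And>x. x \<in> \<Omega> \<Longrightarrow> linear (A x)" and sym: "\<And>x M N. x \<in> \<Omega> \<Longrightarrow> A x M \<bullet> N = M \<bullet> A x N"
    using A unfolding material_tensor_def by blast+
  obtain \<alpha> where \<alpha>: "\<alpha> > 0" "\<And>x M. x \<in> \<Omega> \<Longrightarrow> A x M \<bullet> M \<ge> \<alpha> * (norm M)\<^sup>2"
    using A unfolding material_tensor_def by blast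
  show "linear Ar"
  proof (rule linearI)
    fix M N c
    have "((\<lambda>x. A x M + A x N) \<longlongrightarrow> Ar (M + N)) (at r within interior E)"
      by (rule tendsto_on_element[OF E lim[of "M + N"]]) (simp add: linear_add[OF tl])
    then show "Ar (M + N) = Ar M + Ar N"
      using tendsto_unique[OF nb _ tendsto_add[OF lim[of M] lim[of N]]] by blast
    have "((\<lambda>x. c *\<^sub>R A x M) \<longlongrightarrow> Ar (c *\<^sub>R M)) (at r within interior E)"
      by (rule tendsto_on_element[OF E lim[of "c *\<^sub>R M"]]) (simp add: linear_scale[OF tl])
    then show "Ar (c *\<^sub>R M) = c *\<^sub>R Ar M"
      using tendsto_unique[OF nb _ tendsto_scaleR[OF tendsto_const[of c] lim[of M]]] by blast
  qed
  have "((\<lambda>x. M \<bullet> A x N) \<longlongrightarrow> Ar M \<bullet> N) (at r within interior E)"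
    by (rule tendsto_on_element[OF E tendsto_inner[OF lim[of M] tendsto_const[of N]]]) (simp add: sym)
  then show "Ar M \<bullet> N = M \<bullet> Ar N"
    using tendsto_unique[OF nb _ tendsto_inner[OF tendsto_const[of M] lim[of N]]] by blast
  have "\<alpha> * (norm M)\<^sup>2 \<le> Ar M \<bullet> M"
  proof (rule tendsto_lowerbound[OF tendsto_inner[OF lim[of M] tendsto_const[of M]] _ nb])
    show "\<forall>\<^sub>F x in at r within interior E. \<alpha> * (norm M)\<^sup>2 \<le> A x M \<bullet> M"
      using eventually_in_domain[OF E, of r] by eventually_elim (simp add: \<alpha>(2))
  qed
  moreover have "M \<noteq> 0 \<Longrightarrow> 0 < \<alpha> * (norm M)\<^sup>2" using \<alpha>(1) by simp
  ultimately show "M \<noteq> 0 \<Longrightarrow> Ar M \<bullet> M > 0" by linarith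
qed

lemma Xh_basis_affine:
  assumes "E \<in> \<T>"
  shows "\<exists>L c. linear L \<and> (\<forall>x\<in>interior E. \<tau> j x = L x + c)"
  using \<tau> assms unfolding fe_basis_def Xh_def by blast

text \<open>
  The limit of \<open>A x (\<tau> x)\<close> reduces to that of \<open>A x\<close> applied to a constant matrix, because \<open>A x\<close> is
  bounded uniformly in \<open>x\<close>.
\<close>

lemma Xh_vertex_value:
  assumes E: "E \<in> \<T>" and r: "r \<in> vertices E" and L: "linear L" "\<forall>x\<in>interior E. \<tau> j x = L x + c"
  shows "vertex_value E (\<tau> j) r = L r + c"
    and "vertex_value E (\<lambda>x. A x (\<tau> j x)) r = vertex_value E (\<lambda>x. A x (L r + c)) r"
proof -
  note nb = vertex_islimpt[OF m E r]
  have "((\<lambda>x. L x + c) \<longlongrightarrow> L r + c) (at r within interior E)"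
    using linear_continuous_at[of L r] L(1)
    by (intro tendsto_intros) (auto simp: linear_conv_bounded_linear isCont_def intro: tendsto_within_subset)
  then have lim: "(\<tau> j \<longlongrightarrow> L r + c) (at r within interior E)"
    by (rule tendsto_on_element[OF E]) (simp add: L(2))
  then show "vertex_value E (\<tau> j) r = L r + c" by (rule vertex_value_eq[OF _ nb])
  obtain C where C: "\<And>x M. x \<in> \<Omega> \<Longrightarrow> norm (A x M) \<le> C * norm M"
    using A unfolding material_tensor_def by blast
  have tl: "\<And>x. x \<in> \<Omega> \<Longrightarrow> linear (A x)" using A unfolding material_tensor_def by blast
  have "((\<lambda>x. A x (\<tau> j x - (L r + c))) \<longlongrightarrow> 0) (at r within interior E)"
  proof (rule Lim_null_comparison)
    show "\<forall>\<^sub>F x in at r within interior E. norm (A x (\<tau> j x - (L r + c))) \<le> C * norm (\<tau> j x - (L r + c))"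
      using eventually_in_domain[OF E, of r] by eventually_elim (simp add: C)
    have "((\<lambda>x. C * norm (\<tau> j x - (L r + c))) \<longlongrightarrow> C * norm ((L r + c) - (L r + c))) (at r within interior E)"
      by (intro tendsto_intros lim)
    then show "((\<lambda>x. C * norm (\<tau> j x - (L r + c))) \<longlongrightarrow> 0) (at r within interior E)" by simp
  qed
  from tendsto_add[OF this vertex_tensor_tendsto[OF E r, of "L r + c"]]
  have "((\<lambda>x. A x (\<tau> j x - (L r + c)) + A x (L r + c)) \<longlongrightarrow> vertex_value E (\<lambda>x. A x (L r + c)) r) (at r within interior E)"
    by simp
  then have "((\<lambda>x. A x (\<tau> j x)) \<longlongrightarrow> vertex_value E (\<lambda>x. A x (L r + c)) r) (at r within interior E)"
    by (rule tendsto_on_element[OF E]) (simp add: linear_diff[OF tl])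
  then show "vertex_value E (\<lambda>x. A x (\<tau> j x)) r = vertex_value E (\<lambda>x. A x (L r + c)) r"
    by (rule vertex_value_eq[OF _ nb])
qed

lemma A_ss_entry:
  "A_ss \<T> A \<tau> $ i $ j = (\<Sum>E\<in>\<T>. measure lebesgue E / real (CARD('d) + 1) *
     (\<Sum>r\<in>vertices E. vertex_value E (\<lambda>x. A x (vertex_value E (\<tau> j) r)) r \<bullet> vertex_value E (\<tau> i) r))"
proof -
  have "vertex_value E (\<lambda>x. A x (\<tau> j x)) r = vertex_value E (\<lambda>x. A x (vertex_value E (\<tau> j) r)) r"
    if E: "E \<in> \<T>" and r: "r \<in> vertices E" for E r
  proof -
    obtain L c where L: "linear L" "\<forall>x\<in>interior E. \<tau> j x = L x + c" using Xh_basis_affine[OF E] by blast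
    show ?thesis using Xh_vertex_value[OF E r L] by simp
  qed
  then show ?thesis
    unfolding A_ss_def quad_def quad_elem_def
    by (simp cong: sum.cong)
qed

lemma A_ss_symmetric: "transpose (A_ss \<T> A \<tau>) = A_ss \<T> A \<tau>"
proof -
  have "A_ss \<T> A \<tau> $ i $ j = A_ss \<T> A \<tau> $ j $ i" for i j
    unfolding A_ss_entry
  proof (intro sum.cong refl arg_cong2[of _ _ _ _ "(*)"])
    fix E r assume "E \<in> \<T>" "r \<in> vertices E"
    from vertex_tensor(2)[OF this, of "vertex_value E (\<tau> j) r" "vertex_value E (\<tau> i) r"]
    show "vertex_value E (\<lambda>x. A x (vertex_value E (\<tau> j) r)) r \<bullet> vertex_value E (\<tau> i) r =
        vertex_value E (\<lambda>x. A x (vertex_value E (\<tau> i) r)) r \<bullet> vertex_value E (\<tau> j) r"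
      by (simp only: inner_commute)
  qed
  then show ?thesis by (simp add: transpose_def vec_eq_iff)
qed

lemma A_ss_quadratic_form:
  "x \<bullet> (A_ss \<T> A \<tau> *v x) = (\<Sum>E\<in>\<T>. measure lebesgue E / real (CARD('d) + 1) *
     (\<Sum>r\<in>vertices E. vertex_value E (\<lambda>y. A y (\<Sum>j\<in>UNIV. x $ j *\<^sub>R vertex_value E (\<tau> j) r)) r
        \<bullet> (\<Sum>i\<in>UNIV. x $ i *\<^sub>R vertex_value E (\<tau> i) r)))"
proof -
  let ?w = "\<lambda>E. measure lebesgue E / real (CARD('d) + 1)"
  let ?t = "\<lambda>E r i j. vertex_value E (\<lambda>x. A x (vertex_value E (\<tau> j) r)) r \<bullet> vertex_value E (\<tau> i) r"
  let ?q = "\<lambda>E r. vertex_value E (\<lambda>y. A y (\<Sum>j\<in>UNIV. x $ j *\<^sub>R vertex_value E (\<tau> j) r)) r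
      \<bullet> (\<Sum>i\<in>UNIV. x $ i *\<^sub>R vertex_value E (\<tau> i) r)"
  let ?s = "\<lambda>E r i j. x $ i * x $ j * ?t E r i j"
  have "x \<bullet> (A_ss \<T> A \<tau> *v x) = (\<Sum>i\<in>UNIV. \<Sum>j\<in>UNIV. x $ i * x $ j * (\<Sum>E\<in>\<T>. ?w E * (\<Sum>r\<in>vertices E. ?t E r i j)))"
    by (simp add: inner_vec_def matrix_vector_mult_def A_ss_entry sum_distrib_left ac_simps)
  also have "\<dots> = (\<Sum>i\<in>UNIV. \<Sum>j\<in>UNIV. \<Sum>E\<in>\<T>. ?w E * (\<Sum>r\<in>vertices E. ?s E r i j))"
    by (simp add: sum_distrib_left ac_simps)
  also have "\<dots> = (\<Sum>i\<in>UNIV. \<Sum>E\<in>\<T>. \<Sum>j\<in>UNIV. ?w E * (\<Sum>r\<in>vertices E. ?s E r i j))"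
    by (intro sum.cong refl sum.swap)
  also have "\<dots> = (\<Sum>E\<in>\<T>. \<Sum>i\<in>UNIV. \<Sum>j\<in>UNIV. ?w E * (\<Sum>r\<in>vertices E. ?s E r i j))"
    by (rule sum.swap)
  also have "\<dots> = (\<Sum>E\<in>\<T>. ?w E * (\<Sum>i\<in>UNIV. \<Sum>j\<in>UNIV. \<Sum>r\<in>vertices E. ?s E r i j))"
    by (simp only: sum_distrib_left)
  also have "\<dots> = (\<Sum>E\<in>\<T>. ?w E * (\<Sum>r\<in>vertices E. ?q E r))"
  proof (intro sum.cong refl arg_cong2[of _ _ _ _ "(*)"])
    fix E assume E: "E \<in> \<T>"
    have "(\<Sum>i\<in>UNIV. \<Sum>j\<in>UNIV. \<Sum>r\<in>vertices E. ?s E r i j) =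
        (\<Sum>i\<in>UNIV. \<Sum>r\<in>vertices E. \<Sum>j\<in>UNIV. ?s E r i j)"
      by (intro sum.cong refl sum.swap)
    also have "\<dots> = (\<Sum>r\<in>vertices E. \<Sum>i\<in>UNIV. \<Sum>j\<in>UNIV. ?s E r i j)"
      by (rule sum.swap)
    also have "\<dots> = (\<Sum>r\<in>vertices E. ?q E r)"
    proof (rule sum.cong[OF refl])
      fix r assume r: "r \<in> vertices E"
      have "vertex_value E (\<lambda>y. A y (\<Sum>j\<in>UNIV. x $ j *\<^sub>R vertex_value E (\<tau> j) r)) r =
          (\<Sum>j\<in>UNIV. x $ j *\<^sub>R vertex_value E (\<lambda>y. A y (vertex_value E (\<tau> j) r)) r)"
        using linear_sum[OF vertex_tensor(1)[OF E r], of "\<lambda>j. x $ j *\<^sub>R vertex_value E (\<tau> j) r" UNIV]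
          linear_scale[OF vertex_tensor(1)[OF E r]] by simp
      then show "(\<Sum>i\<in>UNIV. \<Sum>j\<in>UNIV. ?s E r i j) =
          ?q E r"
        by (simp add: inner_sum_left inner_sum_right sum_distrib_left ac_simps)
    qed
    finally show "(\<Sum>i\<in>UNIV. \<Sum>j\<in>UNIV. \<Sum>r\<in>vertices E. ?s E r i j) =
      (\<Sum>r\<in>vertices E. ?q E r)" .
  qed
  finally show ?thesis .
qed

text \<open>
  On each element the combination is affine and vanishes at the vertices, so it is zero almost
  everywhere, and the fields are independent.
\<close>

lemma vertex_values_determine:
  assumes z: "\<And>E r. E \<in> \<T> \<Longrightarrow> r \<in> vertices E \<Longrightarrow> (\<Sum>j\<in>UNIV. x $ j *\<^sub>R vertex_value E (\<tau> j) r) = 0"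
  shows "x = 0"
proof -
  have "AE y in lebesgue_on \<Omega>. (\<Sum>j\<in>UNIV. x $ j *\<^sub>R \<tau> j y) = 0"
    using mesh_AE_interior[OF d m]
  proof eventually_elim
    case (elim y)
    then obtain E where E: "E \<in> \<T>" "y \<in> interior E" by auto
    have "\<forall>j. \<exists>L c. linear L \<and> (\<forall>x\<in>interior E. \<tau> j x = L x + c)" using Xh_basis_affine[OF E(1)] by blast
    then obtain L c where L: "\<And>j. linear (L j)" "\<And>j. \<forall>x\<in>interior E. \<tau> j x = L j x + c j" by metis
    have lin: "linear (\<lambda>y. \<Sum>j\<in>UNIV. x $ j *\<^sub>R L j y)"
      by (intro linear_compose_sum ballI linear_compose_scale_right L)
    have "(\<Sum>j\<in>UNIV. x $ j *\<^sub>R L j y) + (\<Sum>j\<in>UNIV. x $ j *\<^sub>R c j) = 0"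
    proof (rule affine_eq_zero[OF mesh_element(1)[OF m E(1)] lin])
      fix r assume r: "r \<in> vertices E"
      show "(\<Sum>j\<in>UNIV. x $ j *\<^sub>R L j r) + (\<Sum>j\<in>UNIV. x $ j *\<^sub>R c j) = 0"
        using z[OF E(1) r] Xh_vertex_value(1)[OF E(1) r L] by (simp add: scaleR_right_distrib sum.distrib)
    qed
    then show ?case using L(2) E(2) by (simp add: scaleR_right_distrib sum.distrib)
  qed
  then have "\<forall>j. x $ j = 0" using \<tau> unfolding fe_basis_def by blast
  then show ?thesis by (simp add: vec_eq_iff)
qed

lemma A_ss_positive: "positive_definite_matrix (A_ss \<T> A \<tau>)"
  unfolding positive_definite_matrix_def
proof (intro allI impI)
  fix x :: "real^'s" assume x: "x \<noteq> 0"
  let ?w = "\<lambda>E. measure lebesgue E / real (CARD('d) + 1)"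
  let ?T = "\<lambda>E r. \<Sum>j\<in>UNIV. x $ j *\<^sub>R vertex_value E (\<tau> j) r"
  let ?q = "\<lambda>E r. vertex_value E (\<lambda>y. A y (?T E r)) r \<bullet> ?T E r"
  obtain E r where Er: "E \<in> \<T>" "r \<in> vertices E" "?T E r \<noteq> 0" using vertex_values_determine[of x] x by blast
  have w: "?w E > 0" if E: "E \<in> \<T>" for E
  proof -
    have "\<not> negligible E"
      using mesh_interior_nonempty[OF m E] negligible_convex_interior[OF mesh_element(4)[OF m E]] by simp
    then have "measure lebesgue E \<noteq> 0"
      using negligible_iff_measure0[OF lmeasurable_compact[OF mesh_element(3)[OF m E]]] by simp
    then show ?thesis by (simp add: zero_less_measure_iff)
  qed
  have q0: "?q E r \<ge> 0" if "E \<in> \<T>" "r \<in> vertices E" for E r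
    using vertex_tensor(3)[OF that, of "?T E r"] by (cases "?T E r = 0") auto
  have qE: "(\<Sum>r\<in>vertices E. ?q E r) \<ge> 0" if "E \<in> \<T>" for E
    using q0[OF that] by (intro sum_nonneg)
  have "0 < ?q E r" by (rule vertex_tensor(3)[OF Er])
  also have "\<dots> \<le> (\<Sum>r\<in>vertices E. ?q E r)"
    using q0[OF Er(1)] Er(2) affine_frame_finite[OF mesh_element(1)[OF m Er(1)]]
    by (intro member_le_sum) auto
  finally have "0 < ?w E * (\<Sum>r\<in>vertices E. ?q E r)" using w[OF Er(1)] by (rule mult_pos_pos[rotated])
  also have "\<dots> \<le> (\<Sum>E\<in>\<T>. ?w E * (\<Sum>r\<in>vertices E. ?q E r))"
    using qE w Er(1) mesh_finite[OF m]
    by (intro member_le_sum[of E \<T> "\<lambda>E. ?w E * (\<Sum>r\<in>vertices E. ?q E r)"] mult_nonneg_nonneg) (auto intro: less_imp_le)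
  finally show "0 < x \<bullet> (A_ss \<T> A \<tau> *v x)" by (simp only: A_ss_quadratic_form)
qed

end

section \<open>Elimination of the stress\<close>

lemma transpose_adjoint: "x \<bullet> (M *v y) = (transpose M *v x) \<bullet> y" for M :: "real^'n::finite^'m::finite"
  using dot_lmul_matrix[of x M y] by simp

lemma positive_definite_inverse:
  fixes M :: "real^'n::finite^'n"
  assumes s: "transpose M = M" and p: "positive_definite_matrix M"
  shows "transpose (matrix_inv M) = matrix_inv M" "positive_definite_matrix (matrix_inv M)"
proof -
  have ker: "M *v x = 0 \<Longrightarrow> x = 0" for x
    using p unfolding positive_definite_matrix_def by (metis inner_zero_right less_irrefl)
  then have "invertible M"
    using matrix_left_invertible_ker[of M] invertible_left_inverse by blast
  then have inv: "M ** matrix_inv M = mat 1" "matrix_inv M ** M = mat 1"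
    unfolding invertible_def matrix_inv_def by (metis (mono_tags, lifting) someI_ex)+
  have "transpose (matrix_inv M) ** M = mat 1"
    using arg_cong[OF inv(1), of transpose] by (simp add: matrix_transpose_mul s transpose_mat)
  then have "transpose (matrix_inv M) ** (M ** matrix_inv M) = matrix_inv M"
    by (simp add: matrix_mul_assoc)
  then show t: "transpose (matrix_inv M) = matrix_inv M" by (simp add: inv)
  show "positive_definite_matrix (matrix_inv M)"
    unfolding positive_definite_matrix_def
  proof (intro allI impI)
    fix y :: "real^'n" assume "y \<noteq> 0"
    have y: "M *v (matrix_inv M *v y) = y" by (simp add: matrix_vector_mul_assoc inv)
    then have "matrix_inv M *v y \<noteq> 0" using \<open>y \<noteq> 0\<close> by auto
    then have "0 < (matrix_inv M *v y) \<bullet> (M *v (matrix_inv M *v y))"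
      using p unfolding positive_definite_matrix_def by blast
    then show "0 < y \<bullet> (matrix_inv M *v y)" by (simp add: y inner_commute)
  qed
qed

lemma sum_Plus_UNIV:
  fixes f :: "'u::finite + 'g::finite \<Rightarrow> 'b::comm_monoid_add"
  shows "(\<Sum>i\<in>UNIV. f i) = (\<Sum>k\<in>UNIV. f (Inl k)) + (\<Sum>k\<in>UNIV. f (Inr k))"
  using sum.Plus[of UNIV UNIV f] by (simp add: o_def)

lemma congruence_product_swap:
  fixes P :: "real^'s::finite^'p::finite" and Q :: "real^'s^'q::finite"
  assumes "transpose M = M"
  shows "(P ** M ** transpose Q) $ k $ l = (Q ** M ** transpose P) $ l $ k"
proof -
  have "transpose (Q ** M ** transpose P) = P ** M ** transpose Q"
    by (simp add: matrix_transpose_mul assms matrix_mul_assoc)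
  moreover have "transpose X $ k $ l = X $ l $ k" for X :: "real^'p^'q" by (simp add: transpose_def)
  ultimately show ?thesis by metis
qed

lemma displacement_rotation_symmetric:
  fixes Ass :: "real^'s::finite^'s" and Asu :: "real^'s^'u::finite" and Asg :: "real^'s^'g::finite"
  assumes t: "transpose (matrix_inv Ass) = matrix_inv Ass"
  shows "symmetric_matrix (displacement_rotation_matrix Ass Asu Asg)"
proof -
  let ?D = "displacement_rotation_matrix Ass Asu Asg"
  have "?D $ i $ j = ?D $ j $ i" for i j
    unfolding displacement_rotation_matrix_def block_matrix_def
    by (cases i; cases j; simp only: vec_lambda_beta sum.case; rule congruence_product_swap[OF t])
  then show ?thesis by (simp add: symmetric_matrix_def transpose_def vec_eq_iff)
qed

lemma congruence_product_form:
  fixes P :: "real^'s::finite^'p::finite" and Q :: "real^'s^'q::finite"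
  shows "w \<bullet> ((P ** M ** transpose Q) *v u) = (transpose P *v w) \<bullet> (M *v (transpose Q *v u))"
  by (simp only: matrix_vector_mul_assoc[symmetric] transpose_adjoint[of w P])

lemma displacement_rotation_quadratic_form:
  fixes Ass :: "real^'s::finite^'s" and Asu :: "real^'s^'u::finite" and Asg :: "real^'s^'g::finite"
  defines "y \<equiv> \<lambda>z. transpose Asu *v (\<chi> k. z $ Inl k) + transpose Asg *v (\<chi> k. z $ Inr k)"
  shows "z \<bullet> (displacement_rotation_matrix Ass Asu Asg *v z) = y z \<bullet> (matrix_inv Ass *v y z)"
proof -
  define a where "a = (\<chi> k. z $ Inl k)"
  define b where "b = (\<chi> k. z $ Inr k)"
  have form: "z \<bullet> (block_matrix P Q R S *v z) = a \<bullet> (P *v a + Q *v b) + b \<bullet> (R *v a + S *v b)" for P Q R S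
  proof -
    have row: "(block_matrix P Q R S *v z) $ i =
        (case i of Inl k \<Rightarrow> (P *v a) $ k + (Q *v b) $ k | Inr k \<Rightarrow> (R *v a) $ k + (S *v b) $ k)" for i
      by (cases i) (simp_all add: matrix_vector_mult_def block_matrix_def sum_Plus_UNIV a_def b_def)
    have "z \<bullet> (block_matrix P Q R S *v z) = (\<Sum>i\<in>UNIV. z $ i * (block_matrix P Q R S *v z) $ i)"
      by (simp add: inner_vec_def)
    also have "\<dots> = (\<Sum>k\<in>UNIV. a $ k * ((P *v a) $ k + (Q *v b) $ k)) + (\<Sum>k\<in>UNIV. b $ k * ((R *v a) $ k + (S *v b) $ k))"
      by (simp only: sum_Plus_UNIV row sum.case) (simp add: a_def b_def)
    finally show ?thesis by (simp add: inner_vec_def)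
  qed
  show ?thesis
    unfolding displacement_rotation_matrix_def form y_def a_def[symmetric] b_def[symmetric]
    by (simp only: inner_add_right inner_add_left matrix_vector_right_distrib congruence_product_form)
qed

text \<open>
  With \<open>y = B\<^sup>T z\<close>, the quadratic form of the matrix is \<open>y \<bullet> M\<inverse> y\<close>.
\<close>

lemma displacement_rotation_SPD:
  fixes Ass :: "real^'s::finite^'s" and Asu :: "real^'s^'u::finite" and Asg :: "real^'s^'g::finite"
  assumes "transpose Ass = Ass" "positive_definite_matrix Ass"
    and inj: "\<And>a b. transpose Asu *v a + transpose Asg *v b = 0 \<Longrightarrow> a = 0 \<and> b = 0"
  shows "symmetric_matrix (displacement_rotation_matrix Ass Asu Asg)"
    "positive_definite_matrix (displacement_rotation_matrix Ass Asu Asg)"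
proof -
  note I = positive_definite_inverse[OF assms(1,2)]
  show "symmetric_matrix (displacement_rotation_matrix Ass Asu Asg)"
    by (rule displacement_rotation_symmetric[OF I(1)])
  show "positive_definite_matrix (displacement_rotation_matrix Ass Asu Asg)"
    unfolding positive_definite_matrix_def displacement_rotation_quadratic_form
  proof (intro allI impI)
    fix z :: "real^('u + 'g)" assume z: "z \<noteq> 0"
    let ?y = "transpose Asu *v (\<chi> k. z $ Inl k) + transpose Asg *v (\<chi> k. z $ Inr k)"
    have "?y \<noteq> 0"
    proof
      assume "?y = 0"
      from inj[OF this] have "z $ Inl k = 0" "z $ Inr l = 0" for k l by (auto simp: vec_eq_iff)
      then have "z $ i = 0" for i by (cases i) auto
      then show False using z by (simp add: vec_eq_iff)
    qed
    then show "0 < ?y \<bullet> (matrix_inv Ass *v ?y)" using I(2) by (auto simp: positive_definite_matrix_def)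
  qed
qed

section \<open>Kernel of the adjoint of the constraints\<close>

lemma vertex_field_affine:
  assumes m: "simplicial_mesh \<Omega> \<T>" and E: "E \<in> \<T>" "E' \<in> \<T>"
  shows "\<exists>L c. linear L \<and> (\<forall>x\<in>interior E'. vertex_field (vertices E) r p s a x = L x + c)"
proof (cases "E' = E")
  case True
  let ?V = "vertices E"
  let ?L = "\<lambda>x. (s * (bary_grad ?V r \<bullet> x)) *\<^sub>R outer a (p - r)"
  have "linear ?L" by (rule linearI) (simp_all add: inner_simps algebra_simps)
  moreover have "vertex_field ?V r p s a x = ?L x + (s * snd (bary_coeffs ?V) r) *\<^sub>R outer a (p - r)" if "x \<in> interior E'" for x
    using that True mesh_element(2)[OF m E(1)] by (simp add: vertex_field_def bary_def algebra_simps)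
  ultimately show ?thesis by blast
next
  case False
  have "vertex_field (vertices E) r p s a x = 0" if "x \<in> interior E'" for x
    using mesh_interior_inter[OF m E(2,1) that] False interior_subset[of E] mesh_element(2)[OF m E(1)]
    by (auto simp: vertex_field_def)
  then show ?thesis by (intro exI[of _ "\<lambda>_. 0"] exI[of _ 0]) (simp add: linear_zero)
qed

lemma has_derivative_inner_field:
  fixes w :: "real^'d::finite \<Rightarrow> real^'d"
  assumes w: "C1_field w"
  shows "((\<lambda>x. a \<bullet> w x) has_derivative (\<lambda>h. (transpose (jacobian w (at x)) *v a) \<bullet> h)) (at x)"
    and "continuous_on UNIV (\<lambda>x. transpose (jacobian w (at x)) *v a)"
proof -
  have "((\<lambda>x. a \<bullet> w x) has_derivative (\<lambda>h. a \<bullet> (jacobian w (at x) *v h))) (at x)"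
    using has_derivative_inner_right[OF C1_field_derivative[OF w]] .
  then show "((\<lambda>x. a \<bullet> w x) has_derivative (\<lambda>h. (transpose (jacobian w (at x)) *v a) \<bullet> h)) (at x)"
    using dot_lmul_matrix[of a "jacobian w (at x)"] by simp
  show "continuous_on UNIV (\<lambda>x. transpose (jacobian w (at x)) *v a)"
    using w unfolding C1_field_def matrix_vector_mult_def transpose_def by (auto intro!: continuous_intros)
qed

lemma frame_enumeration:
  fixes V :: "(real^'d::finite) set"
  assumes V: "affine_frame V" and r: "r \<in> V" and p: "p \<in> V" "p \<noteq> r"
  obtains b :: "'d \<Rightarrow> real^'d" and k where "bij_betw b UNIV (V - {r})" "b k = p"
proof -
  have "card (V - {r}) = CARD('d)" "finite (V - {r})"
    using V r affine_frame_finite[OF V] by (auto simp: affine_frame_def)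
  then obtain b :: "'d \<Rightarrow> real^'d" where b: "bij_betw b UNIV (V - {r})"
    using finite_same_card_bij[of "UNIV :: 'd set" "V - {r}"] by auto
  moreover have "p \<in> range b" using b p unfolding bij_betw_def by auto
  then obtain k where "p = b k" by blast
  ultimately show ?thesis using that[of b k] by simp
qed

text \<open>
  Replacing \<open>p\<close> by \<open>p'\<close> turns an enumeration of the vertices of one element into one of its
  neighbour, so that the two element maps agree on the common facet.
\<close>

lemma frame_enumeration_swap:
  assumes b: "bij_betw b UNIV (V - {r})" "b k = p" and p: "p \<noteq> r" "p' \<noteq> r" "p \<in> V" "p' \<in> V'" and R: "V - {p} = V' - {p'}"
  shows "bij_betw (b(k := p')) UNIV (V' - {r})"
proof -
  have inj: "inj b" and im: "range b = V - {r}" using b(1) by (auto simp: bij_betw_def)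
  have other: "b i \<in> V' - {p', r}" if "i \<noteq> k" for i
  proof -
    have "b i \<noteq> p" using that inj b(2) by (auto simp: inj_def)
    moreover have "b i \<in> V - {r}" using im by auto
    ultimately have "b i \<in> V - {p}" "b i \<noteq> r" by auto
    then show ?thesis using R by auto
  qed
  have "inj (b(k := p'))"
  proof (rule injI)
    fix i j assume e: "(b(k := p')) i = (b(k := p')) j"
    show "i = j"
      using e other[of i] other[of j] injD[OF inj, of i j] by (auto split: if_splits)
  qed
  moreover have "range (b(k := p')) = V' - {r}"
  proof
    show "range (b(k := p')) \<subseteq> V' - {r}" using other p by auto
    show "V' - {r} \<subseteq> range (b(k := p'))"
    proof
      fix q assume q: "q \<in> V' - {r}"
      show "q \<in> range (b(k := p'))"
      proof (cases "q = p'")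
        case True
        then have "q = (b(k := p')) k" by simp
        then show ?thesis by (rule range_eqI)
      next
        case False
        then have "q \<in> V' - {p'}" using q by simp
        then have qV: "q \<in> V - {p}" unfolding R .
        then have "q \<in> range b" using q unfolding im by simp
        then obtain i where i: "q = b i" by (rule rangeE)
        then have "i \<noteq> k" using qV b(2) by auto
        then have "q = (b(k := p')) i" using i by simp
        then show ?thesis by (rule range_eqI)
      qed
    qed
  qed
  ultimately show ?thesis by (simp add: bij_betw_def)
qed

text \<open>
  From here on, \<open>(v, \<xi>)\<close> is a pair in the kernel of the adjoint.
\<close>

context
  fixes \<Omega> \<Gamma>D \<Gamma>N :: "(real^'d::finite) set" and \<T> :: "(real^'d) set set"
    and v :: "real^'d \<Rightarrow> real^'d" and \<xi> :: "real^'d \<Rightarrow> real^'d^'d"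
  assumes d: "polyhedral_domain \<Omega>" and m: "simplicial_mesh \<Omega> \<T>" and bp: "boundary_parts \<Omega> \<Gamma>D \<Gamma>N"
    and v: "v \<in> Vh \<Omega> \<T>" and \<xi>: "\<xi> \<in> Wh0 \<Omega> \<T>"
    and orth: "\<And>\<sigma>. \<sigma> \<in> Xh \<Omega> \<Gamma>N \<T> \<Longrightarrow> L2_inner \<Omega> (wdiv \<Omega> \<sigma>) v + L2_inner \<Omega> \<sigma> \<xi> = 0"
begin

lemma v_L2: "v \<in> L2 \<Omega>"
proof -
  show "v \<in> L2 \<Omega>" using v unfolding Vh_def V_space_def by (elim CollectE conjE)
qed

lemma \<xi>_L2: "\<xi> \<in> L2 \<Omega>"
proof -
  show "\<xi> \<in> L2 \<Omega>" using \<xi> unfolding Wh0_def W_space_def by (elim CollectE conjE)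
qed

text \<open>
  An explicit stress enters the orthogonality relation together with its explicit divergence.
\<close>

lemma orth_Green:
  assumes \<sigma>: "\<sigma> \<in> L2 \<Omega>" and \<delta>: "\<delta> \<in> L2 \<Omega>"
    and green: "\<And>w. C1_field w \<Longrightarrow> (\<forall>x\<in>frontier \<Omega> - \<Gamma>N. w x = 0) \<Longrightarrow>
      L2_inner \<Omega> \<sigma> (\<lambda>x. jacobian w (at x)) + L2_inner \<Omega> \<delta> w = 0"
    and aff: "\<And>E. E \<in> \<T> \<Longrightarrow> \<exists>L c. linear L \<and> (\<forall>x\<in>interior E. \<sigma> x = L x + c)"
  shows "L2_inner \<Omega> \<delta> v + L2_inner \<Omega> \<sigma> \<xi> = 0"
proof -
  have "\<sigma> \<in> X_space \<Omega> \<Gamma>N" by (rule X_spaceI_Green(1)[OF d m \<sigma> \<delta> green])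
  then have "\<sigma> \<in> Xh \<Omega> \<Gamma>N \<T>" using aff by (simp add: Xh_def)
  moreover have "L2_inner \<Omega> (wdiv \<Omega> \<sigma>) v = L2_inner \<Omega> \<delta> v"
    by (rule X_spaceI_Green(2)[OF d m \<sigma> \<delta> green Vh_piecewise[OF v]])
  ultimately show ?thesis using orth[of \<sigma>] by simp
qed

text \<open>
  The scaling by the volume factor makes the result depend on the element only through \<open>c\<close>, \<open>K\<close>
  and \<open>p - r\<close>; both constants are those of the reference simplex.
\<close>

lemma vertex_field_pairing:
  assumes E: "E \<in> \<T>" and r: "r \<in> vertices E" and b: "bij_betw b UNIV (vertices E - {r})"
    and c: "\<And>x. x \<in> interior E \<Longrightarrow> v x = c" and K: "\<And>x. x \<in> interior E \<Longrightarrow> \<xi> x = K"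
  shows "L2_inner \<Omega> (vertex_field_div (vertices E) (1 / elem_scale r b) a) v +
      L2_inner \<Omega> (vertex_field (vertices E) r p (1 / elem_scale r b) a) \<xi> =
    - ref_volume TYPE('d) * (a \<bullet> c) + ref_moment TYPE('d) * (a \<bullet> (K *v (p - r)))"
proof -
  note V = mesh_element(1)[OF m E] and hull = mesh_element(2)[OF m E]
  have sub: "interior (convex hull (vertices E)) \<subseteq> \<Omega>" using mesh_interior_subset[OF d m E] hull by simp
  have D: "elem_scale r b > 0" by (rule elem_scale_pos[OF V r b])
  have c': "x \<in> interior (convex hull (vertices E)) \<Longrightarrow> v x = c"
    and K': "x \<in> interior (convex hull (vertices E)) \<Longrightarrow> \<xi> x = K" for x using c K hull by auto
  show ?thesis
    using D by (simp add: vertex_field_div_inner[OF d V sub r b c'] vertex_field_inner[OF d V sub r b K'])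
qed

text \<open>
  With \<open>\<mu>\<close> the mean of a barycentric coordinate, the condition for all \<open>a\<close> says that the rigid
  motion \<open>x \<mapsto> c + \<mu> K (x - p)\<close> vanishes at the vertices of the facet opposite \<open>p\<close>.
\<close>

lemma eq_zero_if_vertex_conditions:
  assumes E: "E \<in> \<T>" and p: "p \<in> vertices E"
    and c: "\<And>x. x \<in> interior E \<Longrightarrow> v x = c"
    and K: "skew K" "\<And>x. x \<in> interior E \<Longrightarrow> \<xi> x = K"
    and z: "\<And>r a. r \<in> vertices E - {p} \<Longrightarrow>
      - ref_volume TYPE('d) * (a \<bullet> c) + ref_moment TYPE('d) * (a \<bullet> (K *v (p - r))) = 0"
  shows "x \<in> interior E \<Longrightarrow> v x = 0 \<and> \<xi> x = 0"
proof -
  define \<mu> where "\<mu> = ref_moment TYPE('d) / ref_volume TYPE('d)"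
  have \<mu>: "\<mu> \<noteq> 0" using ref_moment_pos[where 'd='d] ref_volume_pos[where 'd='d] by (simp add: \<mu>_def)
  have "c + \<mu> *\<^sub>R (K *v (r - p)) = 0" if r: "r \<in> vertices E - {p}" for r
  proof -
    \<comment> \<open>the vector that is to be shown zero is itself the best choice of \<open>a\<close>\<close>
    define k where "k = K *v (r - p)"
    define y where "y = c + \<mu> *\<^sub>R k"
    have neg: "K *v (p - r) = - k" by (simp add: k_def matrix_vector_mult_diff_distrib)
    have mom: "ref_moment TYPE('d) = ref_volume TYPE('d) * \<mu>"
      using ref_volume_pos[where 'd='d] by (simp add: \<mu>_def)
    have yy: "y \<bullet> y = y \<bullet> c + \<mu> * (y \<bullet> k)" by (subst (2) y_def) (simp add: inner_add_right)
    have "ref_volume TYPE('d) * (y \<bullet> y) = 0"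
      using z[OF r, of y] unfolding yy neg mom by (simp add: algebra_simps)
    then show ?thesis using ref_volume_pos[where 'd='d] by (simp add: y_def k_def)
  qed
  then have "c = 0" "K = 0" using rigid_motion_eq_zero[OF mesh_element(1)[OF m E] p K(1) _ \<mu>] by blast+
  then show "x \<in> interior E \<Longrightarrow> v x = 0 \<and> \<xi> x = 0" using c K(2) by simp
qed

lemma element_constants:
  assumes "E \<in> \<T>"
  obtains c K where "\<And>x. x \<in> interior E \<Longrightarrow> v x = c" "skew K" "\<And>x. x \<in> interior E \<Longrightarrow> \<xi> x = K"
proof -
  obtain c where c: "\<forall>x\<in>interior E. v x = c" using v assms by (auto simp: Vh_def)
  obtain K where K: "skew K \<and> (\<forall>x\<in>interior E. \<xi> x = K)" using \<xi> assms unfolding Wh0_def by blast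
  show ?thesis by (rule that[of c K]) (use c K in simp_all)
qed

text \<open>
  The test fields for the normal trace on \<open>\<Gamma>N\<close> vanish on \<open>\<Gamma>D\<close>, hence on the facet. So the field of
  a single element is already an admissible stress.
\<close>

lemma vanish_on_dirichlet_element:
  assumes E: "E \<in> \<T>" and p: "p \<in> vertices E" and F: "convex hull (vertices E - {p}) \<subseteq> closure \<Gamma>D"
    and x: "x \<in> interior E"
  shows "v x = 0 \<and> \<xi> x = 0"
proof -
  let ?V = "vertices E"
  note V = mesh_element(1)[OF m E] and hull = mesh_element(2)[OF m E]
  have sub: "interior (convex hull ?V) \<subseteq> \<Omega>" using mesh_interior_subset[OF d m E] hull by simp
  obtain c K where c: "\<And>x. x \<in> interior E \<Longrightarrow> v x = c" and K: "skew K" "\<And>x. x \<in> interior E \<Longrightarrow> \<xi> x = K"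
    using element_constants[OF E] by metis
  show ?thesis
  proof (rule eq_zero_if_vertex_conditions[OF E p c K _ x])
    fix r a assume r: "r \<in> ?V - {p}"
    then have rV: "r \<in> ?V" by simp
    obtain b :: "'d \<Rightarrow> real^'d" and k where b: "bij_betw b UNIV (?V - {r})" "b k = p"
      using frame_enumeration[OF V rV p] r by auto
    let ?s = "1 / elem_scale r b"
    have "L2_inner \<Omega> (vertex_field_div ?V ?s a) v + L2_inner \<Omega> (vertex_field ?V r p ?s a) \<xi> = 0"
    proof (rule orth_Green)
      show "vertex_field ?V r p ?s a \<in> L2 \<Omega>" "vertex_field_div ?V ?s a \<in> L2 \<Omega>"
        by (rule vertex_field_L2[OF d V sub rV] vertex_field_div_L2[OF d V sub rV])+
      fix w :: "real^'d \<Rightarrow> real^'d" assume w: "C1_field w" "\<forall>x\<in>frontier \<Omega> - \<Gamma>N. w x = 0"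
      have "w x = 0" if "x \<in> closure \<Gamma>D" for x
      proof (rule continuous_constant_on_closure[OF _ _ that])
        show "continuous_on (closure \<Gamma>D) w" by (rule C1_field_continuous[OF w(1)])
        show "\<And>x. x \<in> \<Gamma>D \<Longrightarrow> w x = 0" using w(2) bp by (auto simp: boundary_parts_def)
      qed
      then have "element_flux ?V r (b k) (\<lambda>x. a \<bullet> w x) (\<lambda>x. transpose (jacobian w (at x)) *v a) = 0"
        using F b(2) by (intro element_flux_boundary[OF V rV b(1)] has_derivative_inner_field w(1)) auto
      then show "L2_inner \<Omega> (vertex_field ?V r p ?s a) (\<lambda>x. jacobian w (at x)) + L2_inner \<Omega> (vertex_field_div ?V ?s a) w = 0"
        by (simp add: vertex_field_Green[OF d V sub rV w(1)] b(2))
    qed (rule vertex_field_affine[OF m E])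
    then show "- ref_volume TYPE('d) * (a \<bullet> c) + ref_moment TYPE('d) * (a \<bullet> (K *v (p - r))) = 0"
      by (simp add: vertex_field_pairing[OF E rV b(1) c K(2)])
  qed
qed

text \<open>
  The difference of the fields of the two elements is an admissible stress: their fluxes through
  the common facet cancel for every test field. The element on which \<open>v\<close> and \<open>\<xi>\<close> vanish
  contributes nothing to the pairing.
\<close>

lemma vanish_across_facet:
  assumes E: "E \<in> \<T>" "E' \<in> \<T>" "E \<noteq> E'" and p: "p \<in> vertices E" "p' \<in> vertices E'"
    and R: "vertices E - {p} = vertices E' - {p'}"
    and zero: "\<And>x. x \<in> interior E \<Longrightarrow> v x = 0 \<and> \<xi> x = 0" and x: "x \<in> interior E'"
  shows "v x = 0 \<and> \<xi> x = 0"
proof -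
  let ?V = "vertices E" and ?V' = "vertices E'"
  note V = mesh_element(1)[OF m E(1)] and hull = mesh_element(2)[OF m E(1)]
  note V' = mesh_element(1)[OF m E(2)] and hull' = mesh_element(2)[OF m E(2)]
  have sub: "interior (convex hull ?V) \<subseteq> \<Omega>" "interior (convex hull ?V') \<subseteq> \<Omega>"
    using mesh_interior_subset[OF d m] E hull hull' by auto
  obtain c K where c: "\<And>x. x \<in> interior E' \<Longrightarrow> v x = c" and K: "skew K" "\<And>x. x \<in> interior E' \<Longrightarrow> \<xi> x = K"
    using element_constants[OF E(2)] by metis
  show ?thesis
  proof (rule eq_zero_if_vertex_conditions[OF E(2) p(2) c K _ x])
    fix r a assume r': "r \<in> ?V' - {p'}"
    then have r: "r \<in> ?V - {p}" using R by simp
    have rV: "r \<in> ?V" "r \<in> ?V'" using r r' by auto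
    have pr: "p \<noteq> r" "p' \<noteq> r" using r r' by auto
    obtain b :: "'d \<Rightarrow> real^'d" and k where b: "bij_betw b UNIV (?V - {r})" "b k = p"
      using frame_enumeration[OF V rV(1) p(1) pr(1)] by metis
    define b' where "b' = b(k := p')"
    have b': "bij_betw b' UNIV (?V' - {r})" "b' k = p'" "\<And>i. i \<noteq> k \<Longrightarrow> b' i = b i"
      using frame_enumeration_swap[OF b pr p R] by (auto simp: b'_def)
    let ?s = "1 / elem_scale r b" and ?s' = "1 / elem_scale r b'"
    let ?\<sigma> = "vertex_field ?V r p ?s a" and ?\<delta> = "vertex_field_div ?V ?s a"
    let ?\<sigma>' = "vertex_field ?V' r p' ?s' a" and ?\<delta>' = "vertex_field_div ?V' ?s' a"
    have L: "?\<sigma> \<in> L2 \<Omega>" "?\<delta> \<in> L2 \<Omega>" "?\<sigma>' \<in> L2 \<Omega>" "?\<delta>' \<in> L2 \<Omega>"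
      by (rule vertex_field_L2[OF d V sub(1) rV(1)] vertex_field_L2[OF d V' sub(2) rV(2)]
          vertex_field_div_L2[OF d V sub(1) rV(1)] vertex_field_div_L2[OF d V' sub(2) rV(2)])+
    have "L2_inner \<Omega> (\<lambda>x. ?\<delta> x - ?\<delta>' x) v + L2_inner \<Omega> (\<lambda>x. ?\<sigma> x - ?\<sigma>' x) \<xi> = 0"
    proof (rule orth_Green)
      show "(\<lambda>x. ?\<sigma> x - ?\<sigma>' x) \<in> L2 \<Omega>" "(\<lambda>x. ?\<delta> x - ?\<delta>' x) \<in> L2 \<Omega>" by (intro L2_diff L)+
      fix w :: "real^'d \<Rightarrow> real^'d" assume w: "C1_field w"
      have wL: "w \<in> L2 \<Omega>" "(\<lambda>x. jacobian w (at x)) \<in> L2 \<Omega>"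
        using w C1_field_continuous[OF w] domain_sets[OF d] by (auto intro!: L2_continuous simp: C1_field_def)
      let ?f = "\<lambda>x. a \<bullet> w x" and ?Df = "\<lambda>x. transpose (jacobian w (at x)) *v a"
      have "element_flux ?V r (b k) ?f ?Df / elem_scale r b = element_flux ?V' r (b' k) ?f ?Df / elem_scale r b'"
        by (rule element_flux_interior[OF V rV(1) b(1) V' rV(2) b'(1)])
          (assumption | rule b'(3) has_derivative_inner_field w)+
      then have flux: "?s * element_flux ?V r p ?f ?Df = ?s' * element_flux ?V' r p' ?f ?Df"
        unfolding b(2) b'(2) by simp
      show "L2_inner \<Omega> (\<lambda>x. ?\<sigma> x - ?\<sigma>' x) (\<lambda>x. jacobian w (at x)) + L2_inner \<Omega> (\<lambda>x. ?\<delta> x - ?\<delta>' x) w = 0"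
        unfolding L2_inner_diff_left[OF L(1,3) wL(2)] L2_inner_diff_left[OF L(2,4) wL(1)]
        using flux vertex_field_Green[OF d V sub(1) rV(1) w, of p ?s a]
          vertex_field_Green[OF d V' sub(2) rV(2) w, of p' ?s' a]
        by linarith
    next
      fix E'' assume E'': "E'' \<in> \<T>"
      obtain L1 c1 where 1: "linear L1" "\<forall>x\<in>interior E''. ?\<sigma> x = L1 x + c1"
        using vertex_field_affine[OF m E(1) E''] by metis
      obtain L2 c2 where 2: "linear L2" "\<forall>x\<in>interior E''. ?\<sigma>' x = L2 x + c2"
        using vertex_field_affine[OF m E(2) E''] by metis
      have "linear (\<lambda>x. L1 x - L2 x)" by (rule linear_compose_sub[OF 1(1) 2(1)])
      moreover have "?\<sigma> x - ?\<sigma>' x = (L1 x - L2 x) + (c1 - c2)" if "x \<in> interior E''" for x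
        using 1(2) 2(2) that by simp
      ultimately show "\<exists>L c. linear L \<and> (\<forall>x\<in>interior E''. ?\<sigma> x - ?\<sigma>' x = L x + c)" by blast
    qed
    then have "(L2_inner \<Omega> ?\<delta> v + L2_inner \<Omega> ?\<sigma> \<xi>) - (L2_inner \<Omega> ?\<delta>' v + L2_inner \<Omega> ?\<sigma>' \<xi>) = 0"
      unfolding L2_inner_diff_left[OF L(1,3) \<xi>_L2] L2_inner_diff_left[OF L(2,4) v_L2] by linarith
    moreover have "L2_inner \<Omega> ?\<delta> v + L2_inner \<Omega> ?\<sigma> \<xi> = 0"
      using vertex_field_pairing[OF E(1) rV(1) b(1), of 0 0 a p] zero by simp
    ultimately show "- ref_volume TYPE('d) * (a \<bullet> c) + ref_moment TYPE('d) * (a \<bullet> (K *v (p' - r))) = 0"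
      using vertex_field_pairing[OF E(2) rV(2) b'(1) c K(2), of a p'] by simp
  qed
qed

lemma kernel_trivial:
  assumes res: "mesh_resolves_boundary \<Omega> \<Gamma>D \<Gamma>N \<T>"
  shows "AE x in lebesgue_on \<Omega>. v x = 0 \<and> \<xi> x = 0"
proof -
  \<comment> \<open>nonempty by the Dirichlet facet, and closed under passing to neighbours\<close>
  define \<U> where "\<U> = {E \<in> \<T>. \<forall>x\<in>interior E. v x = 0 \<and> \<xi> x = 0}"
  have all: "\<U> = \<T>"
  proof (rule mesh_facet_connected[OF d m])
    obtain E p where E: "E \<in> \<T>" and p: "p \<in> vertices E" "convex hull (vertices E - {p}) \<subseteq> closure \<Gamma>D"
      using dirichlet_facet[OF d bp m res] by blast
    then have "E \<in> \<U>" using vanish_on_dirichlet_element[OF E p] by (simp add: \<U>_def)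
    then show "\<U> \<noteq> {}" by auto
    show "\<U> \<subseteq> \<T>" by (simp add: \<U>_def)
    fix E E' p p'
    assume E: "E \<in> \<U>" and E': "E' \<in> \<T>" "E \<noteq> E'" "p \<in> vertices E" "p' \<in> vertices E'"
      "vertices E - {p} = vertices E' - {p'}"
    have "E \<in> \<T>" "\<And>x. x \<in> interior E \<Longrightarrow> v x = 0 \<and> \<xi> x = 0" using E by (simp_all add: \<U>_def)
    from vanish_across_facet[OF this(1) E' this(2)] show "E' \<in> \<U>" using E'(1) by (simp add: \<U>_def)
  qed
  show ?thesis
    using mesh_AE_interior[OF d m]
  proof eventually_elim
    case (elim x)
    then obtain E where "E \<in> \<T>" "x \<in> interior E" by blast
    then show ?case using all by (auto simp: \<U>_def)
  qed
qed

end

lemma has_weak_div_sum: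
  fixes \<Omega> :: "(real^'d::finite) set" and \<tau> :: "'s::finite \<Rightarrow> real^'d \<Rightarrow> real^'d^'d"
  assumes d: "polyhedral_domain \<Omega>" and \<tau>: "\<And>j. \<tau> j \<in> L2 \<Omega>" and g: "\<And>j. g j \<in> L2 \<Omega>"
    and div: "\<And>j. has_weak_div \<Omega> (\<tau> j) (g j)"
  shows "has_weak_div \<Omega> (\<lambda>x. \<Sum>j\<in>UNIV. a j *\<^sub>R \<tau> j x) (\<lambda>x. \<Sum>j\<in>UNIV. a j *\<^sub>R g j x)"
  unfolding has_weak_div_def
proof (intro allI impI)
  fix \<phi> assume \<phi>: "C1_field \<phi> \<and> (\<exists>K. compact K \<and> K \<subseteq> \<Omega> \<and> (\<forall>x. x \<notin> K \<longrightarrow> \<phi> x = 0))"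
  then have "C1_field \<phi>" by (rule conjunct1)
  then have L: "\<phi> \<in> L2 \<Omega>" "(\<lambda>x. jacobian \<phi> (at x)) \<in> L2 \<Omega>"
    using C1_field_continuous[OF \<open>C1_field \<phi>\<close>] domain_sets(1,2)[OF d]
    by (simp_all add: L2_continuous C1_field_def)
  have "L2_inner \<Omega> (\<tau> j) (\<lambda>x. jacobian \<phi> (at x)) = - L2_inner \<Omega> (g j) \<phi>" for j
    using div[of j] \<phi> by (simp add: has_weak_div_def)
  then show "L2_inner \<Omega> (\<lambda>x. \<Sum>j\<in>UNIV. a j *\<^sub>R \<tau> j x) (\<lambda>x. jacobian \<phi> (at x)) =
      - L2_inner \<Omega> (\<lambda>x. \<Sum>j\<in>UNIV. a j *\<^sub>R g j x) \<phi>"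
    by (subst (1 2) L2_inner_sum_left) (simp_all add: \<tau> g L sum_negf)
qed

text \<open>
  The coefficient vectors describe a pair \<open>(v, \<xi>)\<close> that is orthogonal to the basis stresses. By
  linearity, and because the weak divergence of a combination is determined up to its pairings,
  the pair is orthogonal to all discrete stresses.
\<close>

lemma discrete_adjoint_injective:
  fixes \<Omega> \<Gamma>D \<Gamma>N :: "(real^'d::finite) set"
    and \<T> :: "(real^'d) set set"
    and \<tau> :: "'s::finite \<Rightarrow> real^'d \<Rightarrow> real^'d^'d"
    and v :: "'u::finite \<Rightarrow> real^'d \<Rightarrow> real^'d"
    and \<xi> :: "'g::finite \<Rightarrow> real^'d \<Rightarrow> real^'d^'d"
  assumes d: "polyhedral_domain \<Omega>" and bp: "boundary_parts \<Omega> \<Gamma>D \<Gamma>N" and m: "simplicial_mesh \<Omega> \<T>"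
    and res: "mesh_resolves_boundary \<Omega> \<Gamma>D \<Gamma>N \<T>"
    and \<tau>: "fe_basis \<Omega> (Xh \<Omega> \<Gamma>N \<T>) \<tau>" and v: "fe_basis \<Omega> (Vh \<Omega> \<T>) v" and \<xi>: "fe_basis \<Omega> (Wh0 \<Omega> \<T>) \<xi>"
    and z: "transpose (A_su \<Omega> \<tau> v) *v a + transpose (A_sg \<Omega> \<tau> \<xi>) *v b = 0"
  shows "a = 0 \<and> b = 0"
proof -
  define v0 where "v0 x = (\<Sum>k\<in>UNIV. a $ k *\<^sub>R v k x)" for x
  define \<xi>0 where "\<xi>0 x = (\<Sum>k\<in>UNIV. b $ k *\<^sub>R \<xi> k x)" for x
  have vk: "v k \<in> Vh \<Omega> \<T>" and \<xi>k: "\<xi> l \<in> Wh0 \<Omega> \<T>" for k l using v \<xi> by (auto simp: fe_basis_def)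
  have vL: "v k \<in> L2 \<Omega>" and \<xi>L: "\<xi> l \<in> L2 \<Omega>" for k l
    using vk \<xi>k by (auto simp: Vh_def V_space_def Wh0_def W_space_def)
  have \<tau>X: "\<tau> j \<in> Hdiv \<Omega>" and \<tau>L: "\<tau> j \<in> L2 \<Omega>" for j
    using \<tau> by (auto simp: fe_basis_def Xh_def X_space_def Hdiv_def)
  note wd = wdiv_works[OF \<tau>X]
  have v0: "v0 \<in> Vh \<Omega> \<T>"
    unfolding Vh_def V_space_def
  proof (intro CollectI conjI ballI)
    show "v0 \<in> L2 \<Omega>" unfolding v0_def by (intro L2_sum L2_scaleR vL)
    fix E assume E: "E \<in> \<T>"
    have "\<forall>k. \<exists>c. \<forall>x\<in>interior E. v k x = c" using vk E unfolding Vh_def by blast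
    then obtain c where "\<And>k. \<forall>x\<in>interior E. v k x = c k" by metis
    then show "\<exists>c. \<forall>x\<in>interior E. v0 x = c" unfolding v0_def by (intro exI[of _ "\<Sum>k\<in>UNIV. a $ k *\<^sub>R c k"]) simp
  qed
  have \<xi>0L: "\<xi>0 \<in> L2 \<Omega>" unfolding \<xi>0_def by (intro L2_sum L2_scaleR \<xi>L)
  have skew_sum: "skew (\<Sum>k\<in>UNIV. b $ k *\<^sub>R c k)" if "\<And>k. skew (c k)" for c
  proof -
    have "transpose (\<Sum>k\<in>UNIV. b $ k *\<^sub>R c k) = (\<Sum>k\<in>UNIV. b $ k *\<^sub>R transpose (c k))"
      by (simp add: transpose_def vec_eq_iff)
    also have "\<dots> = - (\<Sum>k\<in>UNIV. b $ k *\<^sub>R c k)"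
      using that by (simp add: skew_def sum_negf)
    finally show ?thesis by (simp add: skew_def)
  qed
  have \<xi>0: "\<xi>0 \<in> Wh0 \<Omega> \<T>"
    unfolding Wh0_def W_space_def
  proof (intro CollectI conjI ballI)
    show "\<xi>0 \<in> L2 \<Omega>" by (rule \<xi>0L)
    have "AE x in lebesgue_on \<Omega>. \<forall>k\<in>UNIV. skew (\<xi> k x)"
      using \<xi>k by (intro AE_finite_allI) (auto simp: Wh0_def W_space_def)
    then show "AE x in lebesgue_on \<Omega>. skew (\<xi>0 x)"
      unfolding \<xi>0_def by eventually_elim (intro skew_sum, simp)
    fix E assume E: "E \<in> \<T>"
    have "\<forall>k. \<exists>c. skew c \<and> (\<forall>x\<in>interior E. \<xi> k x = c)" using \<xi>k E unfolding Wh0_def by blast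
    then obtain c where "\<And>k. skew (c k) \<and> (\<forall>x\<in>interior E. \<xi> k x = c k)" by metis
    then show "\<exists>c. skew c \<and> (\<forall>x\<in>interior E. \<xi>0 x = c)"
      unfolding \<xi>0_def by (intro exI[of _ "\<Sum>k\<in>UNIV. b $ k *\<^sub>R c k"]) (simp add: skew_sum)
  qed
  have v0L: "v0 \<in> L2 \<Omega>" using v0 by (simp add: Vh_def V_space_def)
  have basis: "L2_inner \<Omega> (wdiv \<Omega> (\<tau> j)) v0 + L2_inner \<Omega> (\<tau> j) \<xi>0 = 0" for j
  proof -
    have "L2_inner \<Omega> (wdiv \<Omega> (\<tau> j)) v0 = (\<Sum>k\<in>UNIV. a $ k * L2_inner \<Omega> (wdiv \<Omega> (\<tau> j)) (v k))"
      unfolding L2_inner_commute[of _ "wdiv \<Omega> (\<tau> j)"] v0_def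
      by (rule L2_inner_sum_left) (auto simp: vL wd)
    moreover have "L2_inner \<Omega> (\<tau> j) \<xi>0 = (\<Sum>k\<in>UNIV. b $ k * L2_inner \<Omega> (\<tau> j) (\<xi> k))"
      unfolding L2_inner_commute[of _ "\<tau> j"] \<xi>0_def
      by (rule L2_inner_sum_left) (auto simp: \<xi>L \<tau>L)
    moreover have "(transpose (A_su \<Omega> \<tau> v) *v a + transpose (A_sg \<Omega> \<tau> \<xi>) *v b) $ j = 0" using z by simp
    ultimately show ?thesis
      by (simp add: A_su_def A_sg_def transpose_def matrix_vector_mult_def mult.commute)
  qed
  have orth: "L2_inner \<Omega> (wdiv \<Omega> \<sigma>) v0 + L2_inner \<Omega> \<sigma> \<xi>0 = 0" if \<sigma>: "\<sigma> \<in> Xh \<Omega> \<Gamma>N \<T>" for \<sigma>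
  proof -
    obtain e where e: "AE x in lebesgue_on \<Omega>. \<sigma> x = (\<Sum>j\<in>UNIV. e j *\<^sub>R \<tau> j x)"
      using \<tau> \<sigma> unfolding fe_basis_def by blast
    have \<sigma>H: "\<sigma> \<in> Hdiv \<Omega>" and \<sigma>L: "\<sigma> \<in> L2 \<Omega>" using \<sigma> by (auto simp: Xh_def X_space_def Hdiv_def)
    have sL: "(\<lambda>x. \<Sum>j\<in>UNIV. e j *\<^sub>R \<tau> j x) \<in> L2 \<Omega>" by (intro L2_sum L2_scaleR \<tau>L)
    have gL: "(\<lambda>x. \<Sum>j\<in>UNIV. e j *\<^sub>R wdiv \<Omega> (\<tau> j) x) \<in> L2 \<Omega>" by (intro L2_sum L2_scaleR wd)
    have "L2_inner \<Omega> (wdiv \<Omega> \<sigma>) v0 = L2_inner \<Omega> (\<lambda>x. \<Sum>j\<in>UNIV. e j *\<^sub>R wdiv \<Omega> (\<tau> j) x) v0"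
      by (rule weak_div_unique[OF d m \<sigma>L sL e wdiv_works(1)[OF \<sigma>H] gL wdiv_works(2)[OF \<sigma>H]
            has_weak_div_sum[OF d \<tau>L wd] Vh_piecewise[OF v0]])
    also have "\<dots> = (\<Sum>j\<in>UNIV. e j * L2_inner \<Omega> (wdiv \<Omega> (\<tau> j)) v0)"
      by (rule L2_inner_sum_left[OF wd(1) v0L])
    finally have 1: "L2_inner \<Omega> (wdiv \<Omega> \<sigma>) v0 = (\<Sum>j\<in>UNIV. e j * L2_inner \<Omega> (wdiv \<Omega> (\<tau> j)) v0)" .
    have "L2_inner \<Omega> \<sigma> \<xi>0 = L2_inner \<Omega> (\<lambda>x. \<Sum>j\<in>UNIV. e j *\<^sub>R \<tau> j x) \<xi>0"
      by (rule L2_inner_cong_AE[OF e _ \<sigma>L sL \<xi>0L \<xi>0L]) simp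
    also have "\<dots> = (\<Sum>j\<in>UNIV. e j * L2_inner \<Omega> (\<tau> j) \<xi>0)" by (rule L2_inner_sum_left[OF \<tau>L \<xi>0L])
    finally have "L2_inner \<Omega> (wdiv \<Omega> \<sigma>) v0 + L2_inner \<Omega> \<sigma> \<xi>0 =
        (\<Sum>j\<in>UNIV. e j * (L2_inner \<Omega> (wdiv \<Omega> (\<tau> j)) v0 + L2_inner \<Omega> (\<tau> j) \<xi>0))"
      unfolding 1 by (simp add: sum.distrib distrib_left)
    then show ?thesis by (simp add: basis)
  qed
  have "AE x in lebesgue_on \<Omega>. v0 x = 0 \<and> \<xi>0 x = 0"
    by (rule kernel_trivial[OF d m bp v0 \<xi>0 orth res])
  then have "AE x in lebesgue_on \<Omega>. (\<Sum>k\<in>UNIV. a $ k *\<^sub>R v k x) = 0"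
    and "AE x in lebesgue_on \<Omega>. (\<Sum>k\<in>UNIV. b $ k *\<^sub>R \<xi> k x) = 0"
    unfolding v0_def \<xi>0_def by auto
  then have "\<forall>k. a $ k = 0" "\<forall>k. b $ k = 0" using v \<xi> unfolding fe_basis_def by blast+
  then show ?thesis by (simp add: vec_eq_iff)
qed

section \<open>The displacement-rotation matrix\<close>

theorem lemma3p2:
  fixes \<Omega> \<Gamma>D \<Gamma>N :: "(real^'d::finite) set"
    and A :: "real^'d \<Rightarrow> real^'d^'d \<Rightarrow> real^'d^'d"
    and \<T> :: "(real^'d) set set"
    and \<kappa> c :: real
    and \<tau> :: "'s::finite \<Rightarrow> real^'d \<Rightarrow> real^'d^'d"
    and v :: "'u::finite \<Rightarrow> real^'d \<Rightarrow> real^'d"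
    and \<xi> :: "'g::finite \<Rightarrow> real^'d \<Rightarrow> real^'d^'d"
  assumes "CARD('d) \<in> {2, 3}"
    and "polyhedral_domain \<Omega>" and "simply_connected \<Omega>"
    and "boundary_parts \<Omega> \<Gamma>D \<Gamma>N"
    and "material_tensor \<Omega> A"
    and "simplicial_mesh \<Omega> \<T>"
    and "shape_regular \<kappa> \<T>" and "quasi_uniform c \<T>"
    and "mesh_resolves_boundary \<Omega> \<Gamma>D \<Gamma>N \<T>"
    and "has_vertex_values \<T> A"
    and "fe_basis \<Omega> (Xh \<Omega> \<Gamma>N \<T>) \<tau>"
    and "fe_basis \<Omega> (Vh \<Omega> \<T>) v"
    and "fe_basis \<Omega> (Wh0 \<Omega> \<T>) \<xi>"
  shows "symmetric_matrix
           (displacement_rotation_matrix (A_ss \<T> A \<tau>) (A_su \<Omega> \<tau> v) (A_sg \<Omega> \<tau> \<xi>)) \<and>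
         positive_definite_matrix
           (displacement_rotation_matrix (A_ss \<T> A \<tau>) (A_su \<Omega> \<tau> v) (A_sg \<Omega> \<tau> \<xi>))"
proof -
  note SPD = displacement_rotation_SPD[OF
      A_ss_symmetric[OF assms(2,5,6,10,11)] A_ss_positive[OF assms(2,5,6,10,11)]
      discrete_adjoint_injective[OF assms(2,4,6,9,11,12,13)]]
  show ?thesis by (rule conjI; rule SPD)
qed

end
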